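(* Let $F\in\mathfrak{F}$ and let $L$ be a (possibly killed) Lévy subordinator without drift and with non-zero Lévy measure $\nu_L$ on $(0,\infty]$ such that $(F,L)$ is admissible and normalized by $\Psi_H(1)=\int_{(0,\infty]}\Psi_F(z)\,\nu_L(\mathrm{d}z)=1$. Let $d\in\mathbb{N}$, $d\ge2$, and let $\mathbf{Q}=(Q_1,\ldots,Q_d)$ be the random vector, unique in law, with values in the unit simplex $S_d$ satisfying $\mathbb{E}[Q_k]=1/d$ for $k=1,\ldots,d$ and $$\ell_d(t_1,\ldots,t_d)=d\,\mathbb{E}[\max\{t_1Q_1,\ldots,t_dQ_d\}],\quad t_1,\ldots,t_d\ge0.$$ A random sample from $\mathbf{Q}$ can be drawn according to the following algorithm. (i) Draw $D$ uniformly distributed on $\{1,\ldots,d\}$. (ii) Draw (independently of $D$) a sample of the random variable $Z$ from the probability law $\Psi_F(z)\,\nu_L(\mathrm{d}z)$ on $(0,\infty]$. (iii) Given $Z$, draw $d$ independent and identically distributed random variables $X_1,\ldots,X_d$ from the distribution function $F^Z$ (independent of $D$). (iv) Given $Z$, draw (independently of $X_1,\ldots,X_d$ and $D$) a random variable $M$ from the probability law $x\,\mathrm{d}F^Z(x)/\Psi_F(Z)$. (v) Compute the random vector $(W_1,\ldots,W_d)$ defined by $W_k:=X_k$ if $k\ne D$, and $W_k:=M$ if $k=D$. (vi) Return $$\mathbf{Q}:=\Big(\frac{W_1}{\sum_{k=1}^dW_k},\ldots,\frac{W_d}{\sum_{k=1}^dW_k}\Big).$$ That is, the vector returned in (vi)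 has the law of $\mathbf{Q}$.
   Context: $\mathfrak{F}$ is the set of distribution functions $F$ of random variables $X\in[0,\infty)$ with $\mathbb{E}[X]=\int_0^\infty(1-F(s))\,\mathrm{d}s\in(0,\infty)$. For $F\in\mathfrak{F}$, $\Psi_F(x):=\int_0^\infty(1-F(s)^x)\,\mathrm{d}s$, $x\ge0$ (with $\Psi_F(\infty):=\lim_{x\to\infty}\Psi_F(x)$). A (possibly killed) Lévy subordinator without drift is a non-decreasing, almost surely right-continuous, $[0,\infty]$-valued process $L=\{L_t\}_{t\ge0}$ with $L_0=0$ and independent and stationary increments (possibly jumping to the absorbing state $\infty$), whose law is determined by $\mathbb{E}[e^{-xL_t}]=e^{-t\Psi_L(x)}$, $\Psi_L(x)=\int_{(0,\infty]}(1-e^{-ux})\,\nu_L(\mathrm{d}u)$, where $\int\min\{u,1\}\,\nu_L(\mathrm{d}u)<\infty$. The process $H$ is $H_t=\int_0^\infty -\log\{F(\frac{s}{t}-)\}\,\mathrm{d}L_s$ (pathwise Riemann–Stieltjes, values in $[0,\infty]$), and $(F,L)$ is admissible if $H_t$ is not a.s. equal to $\infty\cdot\mathbf{1}_{\{t>0\}}$, equivalently $\int_{(0,\infty]}\Psi_F(y)\,\nu_L(\mathrm{d}y)<\infty$. $\Psi_H(x)=-\log\mathbb{E}[e^{-xH_1}]=\int_{(0,\infty]}\Psi_F(xy)\,\nu_L(\mathrm{d}y)$. The function $$\ell_d(t_1,\ldots,t_d)=-\log\mathbb{E}\big[e^{-\sum_{k=1}^dH_{t_k}}\big]=\int_{(0,\infty]}\int_0^\infty\Big(1-\prod_{k=1}^dF\big(\tfrac{s}{t_k}\big)^y\Big)\,\mathrm{d}s\,\nu_L(\mathrm{d}y)$$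 is, under $\Psi_H(1)=1$, a stable tail dependence function, so it has a unique Pickands representation as displayed in the claim, where $S_d=\{(q_1,\ldots,q_d)\in[0,1]^d:q_1+\ldots+q_d=1\}$. Conventions: $1/0:=\infty$, $F(\infty)=F(\infty-):=1$, $\exp(-\infty):=0$, $0\cdot\infty:=0$, $-\log0:=\infty$; $F^z$ denotes $x\mapsto F(x)^z$, read for $z=\infty$ as $\exp(-z\cdot(-\log F(x)))$. *)

theory Defs
  imports "HOL-Probability.Probability"
begin

text \<open>Exponents, jump sizes and integrals live in \<^typ>\<open>ennreal\<close>, where \<open>0 * \<infinity> = 0\<close> and
  \<open>s / 0 = \<infinity>\<close> for \<open>s > 0\<close>. The next two functions add \<open>-log 0 = \<infinity>\<close> and
  \<open>exp (-\<infinity>) = 0\<close>.\<close>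

definition neglog :: "real \<Rightarrow> ennreal" where
  "neglog p = (if p \<le> 0 then \<infinity> else ennreal (- ln p))"

definition expneg :: "ennreal \<Rightarrow> real" where
  "expneg u = (if u = \<infinity> then 0 else exp (- enn2real u))"

definition dist_funs :: "(real \<Rightarrow> real) set" where
  "dist_funs = {F. \<exists>\<mu>. real_distribution \<mu> \<and> (AE x in \<mu>. 0 \<le> x) \<and> F = cdf \<mu>
      \<and> integrable \<mu> (\<lambda>x. x) \<and> 0 < (\<integral>x. x \<partial>\<mu>)}"

text \<open>The left limit \<open>F(x-)\<close>, with \<open>F(\<infinity>-) = 1\<close>.\<close>

definition left_val :: "(real \<Rightarrow> real) \<Rightarrow> ennreal \<Rightarrow> real" where
  "left_val F x = (if x = \<infinity> then 1 else Lim (at_left (enn2real x)) F)"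

text \<open>The power \<open>F\<^sup>z\<close>. For \<open>0 < z < \<infinity>\<close> this is \<open>F(x) powr z\<close>; for \<open>z = \<infinity>\<close> it is the
  indicator of \<open>F(x) = 1\<close>.\<close>

definition df_pow :: "(real \<Rightarrow> real) \<Rightarrow> ennreal \<Rightarrow> real \<Rightarrow> real" where
  "df_pow F z x = expneg (z * neglog (F x))"

definition Psi_fin :: "(real \<Rightarrow> real) \<Rightarrow> real \<Rightarrow> ennreal" where
  "Psi_fin F x = (\<integral>\<^sup>+ s\<in>{0..}. ennreal (1 - df_pow F (ennreal x) s) \<partial>lborel)"

definition Psi :: "(real \<Rightarrow> real) \<Rightarrow> ennreal \<Rightarrow> ennreal" where
  "Psi F z = (if z = \<infinity> then Lim at_top (Psi_fin F) else Psi_fin F (enn2real z))"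

text \<open>A measure on \<open>(0, \<infinity>]\<close> is represented as a Borel measure on \<^typ>\<open>ennreal\<close> without mass in
  \<open>0\<close>; an atom in \<open>\<infinity>\<close> is the killing rate.\<close>

definition levy_measure :: "ennreal measure \<Rightarrow> bool" where
  "levy_measure \<nu> \<longleftrightarrow> sets \<nu> = sets borel \<and> emeasure \<nu> {0} = 0
      \<and> (\<integral>\<^sup>+ u. min u 1 \<partial>\<nu>) < \<infinity>"

definition Psi_L :: "ennreal measure \<Rightarrow> ennreal \<Rightarrow> ennreal" where
  "Psi_L \<nu> x = (\<integral>\<^sup>+ u. ennreal (1 - expneg (u * x)) \<partial>\<nu>)"

definition natural_filtration :: "'a measure \<Rightarrow> (real \<Rightarrow> 'a \<Rightarrow> ennreal) \<Rightarrow> real \<Rightarrow> 'a set set" where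
  "natural_filtration P L t = sigma_sets (space P)
      {L u -` B \<inter> space P | u B. 0 \<le> u \<and> u \<le> t \<and> B \<in> sets borel}"

text \<open>Independence and stationarity of the increments is required as long as the process is alive:
  given the past up to time \<open>t\<close>, and on the event that \<open>L\<^sub>t < \<infinity>\<close>, the increment over
  \<open>(t, t + s]\<close> (which is \<open>\<infinity>\<close> if the process jumps to \<open>\<infinity>\<close>) has the law of
  \<open>L\<^sub>s\<close>. If \<open>L\<close> is almost surely finite, this is the usual requirement.\<close>

definition subordinator ::
  "'a measure \<Rightarrow> (real \<Rightarrow> 'a \<Rightarrow> ennreal) \<Rightarrow> ennreal measure \<Rightarrow> bool" where
  "subordinator P L \<nu> \<longleftrightarrow>
     prob_space P \<and> levy_measure \<nu>
   \<and> (\<forall>t\<ge>0. L t \<in> borel_measurable P)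
   \<and> (\<forall>\<omega>\<in>space P. L 0 \<omega> = 0)
   \<and> (\<forall>\<omega>\<in>space P. mono_on {0..} (\<lambda>t. L t \<omega>))
   \<and> (AE \<omega> in P. \<forall>t\<ge>0. continuous (at_right t) (\<lambda>s. L s \<omega>))
   \<and> (\<forall>t\<ge>0. \<forall>s\<ge>0. \<forall>A\<in>natural_filtration P L t. \<forall>B\<in>sets borel.
        measure P {\<omega>\<in>A. L t \<omega> < \<infinity> \<and> L (t + s) \<omega> - L t \<omega> \<in> B}
        = measure P {\<omega>\<in>A. L t \<omega> < \<infinity>} * measure P {\<omega>\<in>space P. L s \<omega> \<in> B})
   \<and> (\<forall>t\<ge>0. \<forall>x\<ge>0. (\<integral>\<omega>. expneg (ennreal x * L t \<omega>) \<partial>P)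
        = expneg (ennreal t * Psi_L \<nu> (ennreal x)))"

text \<open>The Riemann--Stieltjes integral of \<open>g \<ge> 0\<close> over \<open>(0, \<infinity>)\<close> with respect to a
  non-decreasing \<open>A\<close>, as the supremum of the lower sums over all finite partitions; thus it is
  defined for unbounded \<open>g\<close> and for \<open>A\<close> jumping to \<open>\<infinity>\<close>. The cells \<open>(a, b]\<close> match the
  right-continuity of \<open>A\<close>: a jump of \<open>A\<close> in \<open>b\<close> is charged with \<open>g(b)\<close> if \<open>g\<close> is
  left-continuous, as the integrand of \<open>H\<close> is.\<close>

definition stieltjes :: "(real \<Rightarrow> ennreal) \<Rightarrow> (real \<Rightarrow> ennreal) \<Rightarrow> ennreal" where
  "stieltjes g A = (\<Squnion>p\<in>{p. sorted_wrt (<) p \<and> set p \<subseteq> {0..}}.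
     \<Sum>i<length p - 1. (\<Sqinter>s\<in>{p ! i<..p ! Suc i}. g s) * (A (p ! Suc i) - A (p ! i)))"

definition H :: "(real \<Rightarrow> real) \<Rightarrow> (real \<Rightarrow> 'a \<Rightarrow> ennreal) \<Rightarrow> real \<Rightarrow> 'a \<Rightarrow> ennreal" where
  "H F L t \<omega> = stieltjes (\<lambda>s. neglog (left_val F (ennreal s / ennreal t))) (\<lambda>s. L s \<omega>)"

definition admissible ::
  "'a measure \<Rightarrow> (real \<Rightarrow> real) \<Rightarrow> (real \<Rightarrow> 'a \<Rightarrow> ennreal) \<Rightarrow> bool" where
  "admissible P F L \<longleftrightarrow>
     \<not> (\<forall>t\<ge>0. AE \<omega> in P. H F L t \<omega> = (if t > 0 then \<infinity> else 0))"

text \<open>The expectations of \<open>[0, 1]\<close>-valued variables below are written as non-negative integrals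
  because \<open>H\<close> agrees with a measurable function only up to a null set (the paths of \<open>L\<close> are
  right-continuous only almost surely).\<close>

definition Psi_H ::
  "'a measure \<Rightarrow> (real \<Rightarrow> real) \<Rightarrow> (real \<Rightarrow> 'a \<Rightarrow> ennreal) \<Rightarrow> real \<Rightarrow> ennreal" where
  "Psi_H P F L x =
     neglog (enn2real (\<integral>\<^sup>+ \<omega>. ennreal (expneg (ennreal x * H F L 1 \<omega>)) \<partial>P))"

definition ell ::
  "'a measure \<Rightarrow> (real \<Rightarrow> real) \<Rightarrow> (real \<Rightarrow> 'a \<Rightarrow> ennreal) \<Rightarrow> nat \<Rightarrow> (nat \<Rightarrow> real) \<Rightarrow> ennreal" where
  "ell P F L d t =
     neglog (enn2real (\<integral>\<^sup>+ \<omega>. ennreal (expneg (\<Sum>k\<in>{1..d}. H F L (t k) \<omega>)) \<partial>P))"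

definition simplex_pts :: "nat \<Rightarrow> (nat \<Rightarrow> real) set" where
  "simplex_pts d = {q \<in> {1..d} \<rightarrow>\<^sub>E {0..1}. (\<Sum>k\<in>{1..d}. q k) = 1}"

text \<open>Random vectors indexed by \<open>1, \<dots>, d\<close> are identified with their laws on the product
  space; "values in the simplex" is understood almost surely.\<close>

definition pickands_law :: "nat \<Rightarrow> ((nat \<Rightarrow> real) \<Rightarrow> ennreal) \<Rightarrow> (nat \<Rightarrow> real) measure \<Rightarrow> bool" where
  "pickands_law d l \<mu> \<longleftrightarrow>
     prob_space \<mu> \<and> sets \<mu> = sets (Pi\<^sub>M {1..d} (\<lambda>_. borel))
   \<and> (AE q in \<mu>. q \<in> simplex_pts d)
   \<and> (\<forall>k\<in>{1..d}. (\<integral>q. q k \<partial>\<mu>) = 1 / real d)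
   \<and> (\<forall>t. (\<forall>k\<in>{1..d}. 0 \<le> t k) \<longrightarrow>
        l t = ennreal (real d * (\<integral>q. Max ((\<lambda>k. t k * q k) ` {1..d}) \<partial>\<mu>)))"

definition law_X :: "(real \<Rightarrow> real) \<Rightarrow> ennreal \<Rightarrow> real measure" where
  "law_X F z = interval_measure (df_pow F z)"

definition law_M :: "(real \<Rightarrow> real) \<Rightarrow> ennreal \<Rightarrow> real measure" where
  "law_M F z = density (law_X F z) (\<lambda>x. ennreal x / Psi F z)"

definition mix :: "nat \<Rightarrow> nat \<Rightarrow> (nat \<Rightarrow> real) \<Rightarrow> real \<Rightarrow> nat \<Rightarrow> real" where
  "mix d D X M = (\<lambda>k\<in>{1..d}. if k = D then M else X k)"

definition normalize_sum :: "nat \<Rightarrow> (nat \<Rightarrow> real) \<Rightarrow> nat \<Rightarrow> real" where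
  "normalize_sum d W = (\<lambda>k\<in>{1..d}. W k / (\<Sum>j\<in>{1..d}. W j))"

text \<open>Conditional draws "given \<open>Z\<close>" are kernels, composed in the Giry monad. If \<open>F < 1\<close>
  everywhere, then \<open>law_X F \<infinity>\<close> is the null measure; in this case \<open>Psi F \<infinity> = \<infinity>\<close>, so
  admissibility excludes \<open>Z = \<infinity>\<close>.\<close>

definition sample_law :: "(real \<Rightarrow> real) \<Rightarrow> ennreal measure \<Rightarrow> nat \<Rightarrow> (nat \<Rightarrow> real) measure" where
  "sample_law F \<nu> d =
     uniform_count_measure {1..d} \<bind> (\<lambda>D.
     density \<nu> (Psi F) \<bind> (\<lambda>Z.
     Pi\<^sub>M {1..d} (\<lambda>_. law_X F Z) \<bind> (\<lambda>X.
     law_M F Z \<bind> (\<lambda>M.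
     return (Pi\<^sub>M {1..d} (\<lambda>_. borel)) (normalize_sum d (mix d D X M))))))"

end

theory Submission
  imports Defs
begin

text \<open>Write \<open>V(t) = \<integral> \<integral> (1 - \<Prod>\<^sub>k F(s/t\<^sub>k)\<^sup>u) ds \<nu>(du)\<close> (the constant \<open>exponent\<close>). The theorem follows
  from three facts, proved independently of each other.

  \<^bold>\<open>The function \<open>ell\<close> is \<open>V\<close>\<close> (\<open>laplace_H\<close>). Each \<open>H\<^sub>t\<close> integrates a nonincreasing function against the
  path of \<open>L\<close>, so by the layer cake formula it is, on every path, the increasing limit of its lower
  sums along one fixed sequence of partitions, which need only exhaust the rationals and the right
  jumps of the integrand (\<open>stieltjes_SUP\<close>). The sum of several such integrals has the lower sums of
  the sum \<open>h\<close> of the integrands. Their Laplace transforms are explicit because \<open>L\<close> has independent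
  and stationary increments (\<open>subordinator_laplace_partition\<close>): the negative logarithm is a lower sum of
  \<open>\<Psi>\<^sub>L \<circ> h\<close> against Lebesgue measure, which converges by the same lemma. Fubini turns
  \<open>\<integral> \<Psi>\<^sub>L(h(s)) ds\<close> into \<open>V(t)\<close>.

  \<^bold>\<open>The sampled law represents \<open>V\<close>\<close> (\<open>pickands_sample_law\<close>). Replacing the coordinate \<open>X\<^sub>D\<close> by \<open>M\<close>
  multiplies the law of \<open>X\<close> by \<open>X\<^sub>D / \<Psi>\<^sub>F(Z)\<close>; the denominator cancels against the density \<open>\<Psi>\<^sub>F\<close> of the
  law of \<open>Z\<close>, and the average over \<open>D\<close> produces the weight \<open>(X\<^sub>1 + \<dots> + X\<^sub>d) / d\<close>. Hence
  \<open>E f(Q) = d\<^sup>-\<^sup>1 \<integral> E[(\<Sum>\<^sub>k X\<^sub>k) f(X / \<Sum>\<^sub>k X\<^sub>k)] \<nu>(dz)\<close> with \<open>X\<^sub>1, \<dots>, X\<^sub>d\<close> independent with distribution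
  function \<open>F\<^sup>z\<close> (\<open>nn_integral_sample_law\<close>). If \<open>f\<close> is homogeneous of degree \<open>1\<close>, then the weight undoes
  the normalization. For \<open>f(q) = max\<^sub>k t\<^sub>k q\<^sub>k\<close> there remains \<open>E max\<^sub>k t\<^sub>k X\<^sub>k\<close>, whose tail formula is the
  inner integral of \<open>V(t)\<close>.

  \<^bold>\<open>A law on the simplex is determined by the integrals of \<open>max\<^sub>k t\<^sub>k q\<^sub>k\<close>\<close> (\<open>pickands_law_unique\<close>). Push the
  product of the law and Lebesgue measure on \<open>{s. 0 < s < d max\<^sub>k q\<^sub>k}\<close> forward under
  \<open>(q, s) \<mapsto> q / s\<close>. The mass of a box \<open>{y. \<forall>k. y\<^sub>k \<le> 1 / t\<^sub>k}\<close> is a difference of two such integrals, so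
  the image measure is determined; and the law is read off from it as the mass of
  \<open>{y. \<Sum>\<^sub>k y\<^sub>k > 1 \<and> y / \<Sum>\<^sub>k y\<^sub>k \<in> A}\<close>.\<close>

section \<open>Exponential and logarithm on the extended half line\<close>

lemma expneg_nonneg [simp]: "0 \<le> expneg u"
  by (simp add: expneg_def)

lemma expneg_le_1 [simp]: "expneg u \<le> 1"
  by (simp add: expneg_def)

lemma expneg_0 [simp]: "expneg 0 = 1"
  by (simp add: expneg_def)

lemma expneg_top [simp]: "expneg \<top> = 0"
  by (simp add: expneg_def)

lemma expneg_add: "expneg (u + v) = expneg u * expneg v"
proof (cases "u = \<infinity> \<or> v = \<infinity>")
  case False
  then have "enn2real (u + v) = enn2real u + enn2real v"
    by (intro enn2real_plus) (auto simp: less_top)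
  then show ?thesis using False
    by (auto simp: expneg_def exp_add [symmetric])
qed (auto simp: expneg_def)

lemma expneg_sum: "expneg (\<Sum>i\<in>I. u i) = (\<Prod>i\<in>I. expneg (u i))"
  by (induction I rule: infinite_finite_induct) (auto simp: expneg_add)

lemma expneg_antimono: "u \<le> v \<Longrightarrow> expneg v \<le> expneg u"
  by (auto simp: expneg_def top_unique less_top intro!: enn2real_mono)

lemma borel_measurable_expneg [measurable]: "expneg \<in> borel_measurable borel"
  unfolding expneg_def by measurable

lemma borel_measurable_neglog [measurable]: "neglog \<in> borel_measurable borel"
  unfolding neglog_def by measurable

text \<open>Continuity of \<open>exp (-u)\<close> on the whole of \<open>[0, \<infinity>]\<close>; it lets all limits below run through infinite
  exponents.\<close>

lemma tendsto_expneg: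
  assumes "(f \<longlongrightarrow> u) G"
  shows "((\<lambda>x. expneg (f x)) \<longlongrightarrow> expneg u) G"
proof (cases "u = \<infinity>")
  case False
  then have fin: "u < top" by (simp add: less_top)
  have ev: "\<forall>\<^sub>F x in G. exp (- enn2real (f x)) = expneg (f x)"
    using order_tendstoD(2)[OF assms fin] by eventually_elim (auto simp: expneg_def)
  have "((\<lambda>x. enn2real (f x)) \<longlongrightarrow> enn2real u) G"
    by (intro tendsto_enn2real) (use assms fin in simp_all)
  then have "((\<lambda>x. exp (- enn2real (f x))) \<longlongrightarrow> exp (- enn2real u)) G"
    by (intro tendsto_exp tendsto_minus)
  then show ?thesis
    using Lim_transform_eventually[OF _ ev] False by (simp add: expneg_def)
next
  case True
  show ?thesis
  proof (rule order_tendstoI)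
    fix a assume "a < expneg u"
    then have "a < 0" using True by simp
    then show "\<forall>\<^sub>F x in G. a < expneg (f x)"
      by (intro always_eventually) (auto intro: less_le_trans)
  next
    fix a assume "expneg u < a"
    then have a: "0 < a" using True by simp
    \<comment> \<open>large enough for \<open>exp (- b) < a\<close>\<close>
    define b where "b = \<bar>ln a\<bar> + 1"
    have "ennreal b < u" using True by simp
    from order_tendstoD(1)[OF assms this] show "\<forall>\<^sub>F x in G. expneg (f x) < a"
    proof eventually_elim
      case (elim x)
      show ?case
      proof (cases "f x = \<infinity>")
        case False
        then have "b \<le> enn2real (f x)"
          using elim by (metis b_def abs_ge_zero add_nonneg_nonneg enn2real_ennreal enn2real_mono
              infinity_ennreal_def less_imp_le less_top zero_le_one)
        then have "- enn2real (f x) < ln a" unfolding b_def by linarith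
        then show ?thesis using False a
          by (auto simp: expneg_def) (metis exp_less_mono exp_ln)
      qed (use a in simp)
    qed
  qed
qed

lemma expneg_SUP_incseq:
  assumes "incseq u"
  shows "(\<lambda>n. expneg (u n)) \<longlonglongrightarrow> expneg (SUP n. u n)"
  by (intro tendsto_expneg LIMSEQ_SUP assms)

lemma neglog_expneg: "neglog (expneg u) = u"
  by (cases u) (auto simp: expneg_def neglog_def)

lemma neglog_antimono: "p \<le> q \<Longrightarrow> neglog q \<le> neglog p"
  by (auto simp: neglog_def intro!: ennreal_leI)

lemma neglog_1 [simp]: "neglog 1 = 0"
  by (simp add: neglog_def)

section \<open>The Laplace exponent of a Levy measure\<close>

lemma Psi_L_0 [simp]: "Psi_L \<nu> 0 = 0"
  by (simp add: Psi_L_def)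

lemma Psi_L_mono: "x \<le> y \<Longrightarrow> Psi_L \<nu> x \<le> Psi_L \<nu> y"
  unfolding Psi_L_def
  by (intro nn_integral_mono ennreal_leI diff_left_mono expneg_antimono mult_left_mono) auto

text \<open>Monotone convergence for integrals of \<open>1 - e\<^sup>-\<^sup>f\<close>; it is used for \<open>\<Psi>\<^sub>L\<close> and for \<open>\<Psi>\<^sub>F(\<infinity>)\<close>.\<close>

lemma nn_integral_expneg_SUP:
  assumes inc: "\<And>u. incseq (\<lambda>n. f n u)"
    and [measurable]: "\<And>n. f n \<in> borel_measurable M"
  shows "(\<integral>\<^sup>+ u. ennreal (1 - expneg (SUP n. f n u)) \<partial>M)
    = (SUP n. \<integral>\<^sup>+ u. ennreal (1 - expneg (f n u)) \<partial>M)"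
proof -
  have incs: "incseq (\<lambda>n. ennreal (1 - expneg (f n u)))" for u
    using inc[of u] by (auto simp: incseq_def intro!: ennreal_leI expneg_antimono diff_left_mono)
  have "ennreal (1 - expneg (SUP n. f n u)) = (SUP n. ennreal (1 - expneg (f n u)))" for u
    by (rule LIMSEQ_unique[OF _ LIMSEQ_SUP[OF incs]])
       (intro tendsto_intros expneg_SUP_incseq inc)
  then have "(\<integral>\<^sup>+ u. ennreal (1 - expneg (SUP n. f n u)) \<partial>M)
      = (\<integral>\<^sup>+ u. (SUP n. ennreal (1 - expneg (f n u))) \<partial>M)" by simp
  also have "\<dots> = (SUP n. \<integral>\<^sup>+ u. ennreal (1 - expneg (f n u)) \<partial>M)"
    using incs by (intro nn_integral_monotone_convergence_SUP) (auto simp: incseq_def le_fun_def)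
  finally show ?thesis .
qed

lemma Psi_L_SUP:
  assumes "incseq x" and [measurable_cong]: "sets \<nu> = sets borel"
  shows "Psi_L \<nu> (SUP n. x n) = (SUP n. Psi_L \<nu> (x n))"
  unfolding Psi_L_def SUP_mult_left_ennreal
  by (rule nn_integral_expneg_SUP)
     (use assms(1) in \<open>auto simp: incseq_def intro!: mult_left_mono\<close>)

text \<open>The sets \<open>{u. u \<ge> 1/n}\<close> have finite mass by integrability of \<open>min u 1\<close>, and they exhaust everything
  but the null set \<open>{0}\<close>. This is what Fubini needs.\<close>

lemma sigma_finite_levy_measure:
  assumes "levy_measure \<nu>"
  shows "sigma_finite_measure \<nu>"
proof
  have sets: "sets \<nu> = sets borel" and null: "emeasure \<nu> {0} = 0"
    and int: "(\<integral>\<^sup>+ u. min u 1 \<partial>\<nu>) < \<infinity>"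
    using assms by (auto simp: levy_measure_def)
  note [measurable_cong] = sets
  have space: "space \<nu> = UNIV" using sets_eq_imp_space_eq[OF sets] by simp
  define A where "A n = {u::ennreal. ennreal (1 / Suc n) \<le> u}" for n :: nat
  have [measurable]: "A n \<in> sets \<nu>" for n unfolding A_def sets by simp
  have fin: "emeasure \<nu> (A n) \<noteq> \<infinity>" for n
  proof -
    have "ennreal (1 / Suc n) * emeasure \<nu> (A n) = (\<integral>\<^sup>+ u. ennreal (1 / Suc n) * indicator (A n) u \<partial>\<nu>)"
      by (rule nn_integral_cmult_indicator [symmetric]) measurable
    also have "\<dots> \<le> (\<integral>\<^sup>+ u. min u 1 \<partial>\<nu>)"
      by (intro nn_integral_mono)
        (auto simp: A_def indicator_def ennreal_le_1 intro!: min.boundedI)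
    finally show ?thesis using int
      by (auto simp: ennreal_mult_top top_unique)
  qed
  have "(\<Union>n. A n) \<union> {0} = UNIV"
  proof -
    have "\<exists>n. ennreal (1 / Suc n) \<le> u" if "u \<noteq> 0" for u
    proof (cases u)
      case (real r)
      then have "0 < r" using that by (auto simp: less_le)
      from reals_Archimedean[OF this] obtain n where "inverse (real (Suc n)) < r" by blast
      then show ?thesis using real by (auto simp: inverse_eq_divide intro!: exI[of _ n] ennreal_leI)
    qed auto
    then show ?thesis by (auto simp: A_def)
  qed
  moreover have "{0} \<in> sets \<nu>" unfolding sets by simp
  ultimately show "\<exists>B. countable B \<and> B \<subseteq> sets \<nu> \<and> \<Union>B = space \<nu> \<and> (\<forall>a\<in>B. emeasure \<nu> a \<noteq> \<infinity>)"
    using fin null unfolding space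
    by (intro exI[of _ "range A \<union> {{0}}"]) auto
qed

section \<open>Laplace transforms of step integrals of a subordinator\<close>

lemma subordinatorD:
  assumes "subordinator P L \<nu>"
  shows "prob_space P" "levy_measure \<nu>" "0 \<le> t \<Longrightarrow> L t \<in> borel_measurable P"
    "\<omega> \<in> space P \<Longrightarrow> L 0 \<omega> = 0"
    "\<omega> \<in> space P \<Longrightarrow> 0 \<le> t \<Longrightarrow> t \<le> s \<Longrightarrow> L t \<omega> \<le> L s \<omega>"
  using assms by (auto simp: subordinator_def mono_on_def monotone_on_def)

text \<open>The defining Laplace transform extends to \<open>x = \<infinity>\<close> by monotone limits. The infinite argument does occur:
  the integrand of \<open>H\<close> is infinite wherever \<open>F\<close> vanishes.\<close>

lemma subordinator_laplace:
  assumes sub: "subordinator P L \<nu>" and t: "0 \<le> t"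
  shows "(\<integral>\<^sup>+ \<omega>. ennreal (expneg (x * L t \<omega>)) \<partial>P) = ennreal (expneg (ennreal t * Psi_L \<nu> x))"
proof -
  interpret prob_space P by (rule subordinatorD[OF sub])
  note [measurable] = subordinatorD(3)[OF sub t]
  have sets: "sets \<nu> = sets borel"
    using subordinatorD(2)[OF sub] by (simp add: levy_measure_def)
  have fin: "(\<integral>\<^sup>+ \<omega>. ennreal (expneg (ennreal x * L t \<omega>)) \<partial>P)
      = ennreal (expneg (ennreal t * Psi_L \<nu> (ennreal x)))" if "0 \<le> x" for x
  proof -
    have "integrable P (\<lambda>\<omega>. expneg (ennreal x * L t \<omega>))"
      by (rule integrable_const_bound[of _ 1]) auto
    then have "(\<integral>\<^sup>+ \<omega>. ennreal (expneg (ennreal x * L t \<omega>)) \<partial>P)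
        = ennreal (\<integral>\<omega>. expneg (ennreal x * L t \<omega>) \<partial>P)"
      by (rule nn_integral_eq_integral) simp
    also have "(\<integral>\<omega>. expneg (ennreal x * L t \<omega>) \<partial>P) = expneg (ennreal t * Psi_L \<nu> (ennreal x))"
      using sub t that by (simp add: subordinator_def)
    finally show ?thesis .
  qed
  show ?thesis
  proof (cases x)
    case (real r)
    then show ?thesis using fin by simp
  next
    case top
    define X where "X n = ennreal (real n)" for n
    have inc: "incseq X" by (auto simp: X_def incseq_def intro!: ennreal_leI)
    have X: "x = (SUP n. X n)"
      unfolding top X_def ennreal_of_nat_eq_real_of_nat [symmetric]
      by (rule ennreal_SUP_of_nat_eq_top [symmetric])
    have "(\<lambda>n. \<integral>\<^sup>+ \<omega>. ennreal (expneg (X n * L t \<omega>)) \<partial>P)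
        \<longlonglongrightarrow> (\<integral>\<^sup>+ \<omega>. ennreal (expneg (x * L t \<omega>)) \<partial>P)"
    proof (rule nn_integral_dominated_convergence[where w = "\<lambda>_. 1"])
      show "AE \<omega> in P. (\<lambda>n. ennreal (expneg (X n * L t \<omega>))) \<longlonglongrightarrow> ennreal (expneg (x * L t \<omega>))"
        unfolding X SUP_mult_right_ennreal
        by (intro always_eventually allI tendsto_ennrealI expneg_SUP_incseq)
          (use inc in \<open>auto simp: incseq_def intro!: mult_right_mono\<close>)
    qed (auto simp: emeasure_space_1)
    moreover have "(\<lambda>n. ennreal (expneg (ennreal t * Psi_L \<nu> (X n))))
        \<longlonglongrightarrow> ennreal (expneg (ennreal t * Psi_L \<nu> x))"
      unfolding X Psi_L_SUP[OF inc sets] SUP_mult_left_ennreal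
      by (intro tendsto_ennrealI expneg_SUP_incseq)
        (use inc in \<open>auto simp: incseq_def intro!: mult_left_mono Psi_L_mono\<close>)
    moreover have "(\<lambda>n. \<integral>\<^sup>+ \<omega>. ennreal (expneg (X n * L t \<omega>)) \<partial>P)
        = (\<lambda>n. ennreal (expneg (ennreal t * Psi_L \<nu> (X n))))"
      by (simp add: X_def fin)
    ultimately show ?thesis by (simp add: LIMSEQ_unique)
  qed
qed

text \<open>The natural filtration as a measure space, so that measurability with respect to it is
  \<open>borel_measurable (past P L t)\<close>.\<close>

definition past :: "'a measure \<Rightarrow> (real \<Rightarrow> 'a \<Rightarrow> ennreal) \<Rightarrow> real \<Rightarrow> 'a measure" where
  "past P L t = sigma (space P) {L u -` B \<inter> space P | u B. 0 \<le> u \<and> u \<le> t \<and> B \<in> sets borel}"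

lemma space_past [simp]: "space (past P L t) = space P"
  by (auto simp: past_def space_measure_of_conv)

lemma sets_past: "sets (past P L t) = natural_filtration P L t"
  unfolding past_def natural_filtration_def by (rule sets_measure_of) auto

lemma measurable_past:
  "0 \<le> u \<Longrightarrow> u \<le> t \<Longrightarrow> L u \<in> borel_measurable (past P L t)"
  by (rule measurableI) (auto simp: sets_past natural_filtration_def)

lemma sets_past_subset:
  assumes "subordinator P L \<nu>"
  shows "sets (past P L t) \<subseteq> sets P"
  unfolding sets_past natural_filtration_def
  by (rule sets.sigma_sets_subset)
    (auto intro!: measurable_sets[OF subordinatorD(3)[OF assms]])

text \<open>The independence of the increment over \<open>(t, t + s]\<close> from the past, for functions instead of events. Two
  equalities of measures replace two inductions over measurable functions: the first passes from
  sets \<open>B\<close> to the function \<open>\<phi>\<close> of the increment, the second from events \<open>A\<close> of the past to the variable \<open>Y\<close>.\<close>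

lemma subordinator_markov:
  assumes sub: "subordinator P L \<nu>" and t: "0 \<le> t" and s: "0 \<le> s"
    and Y [measurable]: "Y \<in> borel_measurable (past P L t)"
    and \<phi> [measurable]: "\<phi> \<in> borel_measurable borel"
  shows "(\<integral>\<^sup>+ \<omega>. Y \<omega> * indicator {\<omega>. L t \<omega> < \<infinity>} \<omega> * \<phi> (L (t + s) \<omega> - L t \<omega>) \<partial>P)
    = (\<integral>\<^sup>+ \<omega>. Y \<omega> * indicator {\<omega>. L t \<omega> < \<infinity>} \<omega> \<partial>P) * (\<integral>\<^sup>+ \<omega>. \<phi> (L s \<omega>) \<partial>P)"
proof -
  interpret prob_space P by (rule subordinatorD[OF sub])
  let ?G = "past P L t"
  let ?alive = "\<lambda>\<omega>. indicator {\<omega>. L t \<omega> < \<infinity>} \<omega> :: ennreal"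
  let ?D = "\<lambda>\<omega>. L (t + s) \<omega> - L t \<omega>"
  have ts: "0 \<le> t + s" using t s by simp
  note [measurable] = subordinatorD(3)[OF sub t] subordinatorD(3)[OF sub s] subordinatorD(3)[OF sub ts]
  have PG [measurable]: "(\<lambda>\<omega>. \<omega>) \<in> measurable P ?G"
    using sets_past_subset[OF sub, of t] by (auto intro!: measurableI)
  have ind: "emeasure P {\<omega>\<in>A. L t \<omega> < \<infinity> \<and> ?D \<omega> \<in> B}
      = emeasure P {\<omega>\<in>A. L t \<omega> < \<infinity>} * emeasure P {\<omega>\<in>space P. L s \<omega> \<in> B}"
    if "A \<in> sets ?G" "B \<in> sets borel" for A B
    using sub t s that unfolding subordinator_def sets_past
    by (simp add: emeasure_eq_measure ennreal_mult)
  have Asub: "A \<in> sets P" "A \<subseteq> space P" if "A \<in> sets ?G" for A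
    using sets_past_subset[OF sub, of t] that sets.sets_into_space[of A P] by auto
  have event: "(\<integral>\<^sup>+ \<omega>. indicator A \<omega> * ?alive \<omega> * \<phi> (?D \<omega>) \<partial>P)
      = (\<integral>\<^sup>+ \<omega>. indicator A \<omega> * ?alive \<omega> \<partial>P) * (\<integral>\<^sup>+ \<omega>. \<phi> (L s \<omega>) \<partial>P)"
    if A: "A \<in> sets ?G" for A
  proof -
    note [measurable] = Asub(1)[OF A]
    define a where "a = emeasure P {\<omega>\<in>A. L t \<omega> < \<infinity>}"
    have eq: "distr (density P (\<lambda>\<omega>. indicator A \<omega> * ?alive \<omega>)) borel ?D
        = scale_measure a (distr P borel (L s))"
    proof (rule measure_eqI)
      fix B assume "B \<in> sets (distr (density P (\<lambda>\<omega>. indicator A \<omega> * ?alive \<omega>)) borel ?D)"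
      then have B [measurable]: "B \<in> sets borel" by simp
      have "emeasure (distr (density P (\<lambda>\<omega>. indicator A \<omega> * ?alive \<omega>)) borel ?D) B
          = (\<integral>\<^sup>+ \<omega>. indicator {\<omega>\<in>A. L t \<omega> < \<infinity> \<and> ?D \<omega> \<in> B} \<omega> \<partial>P)"
        by (subst emeasure_distr, simp, simp, subst emeasure_density, simp, simp,
            intro nn_integral_cong) (auto simp: indicator_def)
      also have "\<dots> = emeasure P {\<omega>\<in>A. L t \<omega> < \<infinity> \<and> ?D \<omega> \<in> B}"
      proof (rule nn_integral_indicator)
        have "{\<omega>\<in>A. L t \<omega> < \<infinity> \<and> ?D \<omega> \<in> B} = A \<inter> {\<omega>\<in>space P. L t \<omega> < \<infinity> \<and> ?D \<omega> \<in> B}"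
          using Asub(2)[OF A] by auto
        then show "{\<omega>\<in>A. L t \<omega> < \<infinity> \<and> ?D \<omega> \<in> B} \<in> sets P" by simp
      qed
      also have "\<dots> = a * emeasure P {\<omega>\<in>space P. L s \<omega> \<in> B}"
        unfolding a_def by (rule ind[OF A B])
      also have "\<dots> = emeasure (scale_measure a (distr P borel (L s))) B"
        by (simp add: emeasure_distr vimage_def Int_def conj_commute)
      finally show "emeasure (distr (density P (\<lambda>\<omega>. indicator A \<omega> * ?alive \<omega>)) borel ?D) B
          = emeasure (scale_measure a (distr P borel (L s))) B" .
    qed simp
    have a: "a = (\<integral>\<^sup>+ \<omega>. indicator A \<omega> * ?alive \<omega> \<partial>P)"
    proof -
      have "{\<omega>\<in>A. L t \<omega> < \<infinity>} = A \<inter> {\<omega>\<in>space P. L t \<omega> < \<infinity>}" using Asub(2)[OF A] by auto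
      then have "a = (\<integral>\<^sup>+ \<omega>. indicator {\<omega>\<in>A. L t \<omega> < \<infinity>} \<omega> \<partial>P)"
        unfolding a_def by (subst nn_integral_indicator) auto
      then show ?thesis by (auto intro!: nn_integral_cong simp: indicator_def)
    qed
    have "(\<integral>\<^sup>+ \<omega>. indicator A \<omega> * ?alive \<omega> * \<phi> (?D \<omega>) \<partial>P)
        = (\<integral>\<^sup>+ x. \<phi> x \<partial>distr (density P (\<lambda>\<omega>. indicator A \<omega> * ?alive \<omega>)) borel ?D)"
      by (simp add: nn_integral_distr nn_integral_density)
    also have "\<dots> = a * (\<integral>\<^sup>+ \<omega>. \<phi> (L s \<omega>) \<partial>P)"
      unfolding eq by (simp add: nn_integral_scale_measure nn_integral_distr)
    finally show ?thesis unfolding a .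
  qed
  define c where "c = (\<integral>\<^sup>+ \<omega>. \<phi> (L s \<omega>) \<partial>P)"
  have eq: "distr (density P (\<lambda>\<omega>. ?alive \<omega> * \<phi> (?D \<omega>))) ?G (\<lambda>\<omega>. \<omega>)
      = scale_measure c (distr (density P ?alive) ?G (\<lambda>\<omega>. \<omega>))"
  proof (rule measure_eqI)
    fix A assume "A \<in> sets (distr (density P (\<lambda>\<omega>. ?alive \<omega> * \<phi> (?D \<omega>))) ?G (\<lambda>\<omega>. \<omega>))"
    then have A: "A \<in> sets ?G" by simp
    note [measurable] = Asub(1)[OF A]
    have Aeq: "{\<omega> \<in> space P. \<omega> \<in> A} = A" "A \<inter> space P = A" using Asub(2)[OF A] by auto
    show "emeasure (distr (density P (\<lambda>\<omega>. ?alive \<omega> * \<phi> (?D \<omega>))) ?G (\<lambda>\<omega>. \<omega>)) A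
        = emeasure (scale_measure c (distr (density P ?alive) ?G (\<lambda>\<omega>. \<omega>))) A"
      using event[OF A] A unfolding c_def [symmetric]
      by (simp add: emeasure_distr emeasure_density Aeq mult_ac)
  qed simp
  have "(\<integral>\<^sup>+ \<omega>. Y \<omega> * ?alive \<omega> * \<phi> (?D \<omega>) \<partial>P)
      = (\<integral>\<^sup>+ \<omega>. Y \<omega> \<partial>distr (density P (\<lambda>\<omega>. ?alive \<omega> * \<phi> (?D \<omega>))) ?G (\<lambda>\<omega>. \<omega>))"
    by (simp add: nn_integral_distr nn_integral_density mult_ac)
  also have "\<dots> = (\<integral>\<^sup>+ \<omega>. Y \<omega> * ?alive \<omega> \<partial>P) * c"
    unfolding eq
    by (simp add: nn_integral_scale_measure nn_integral_distr nn_integral_density mult_ac)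
  finally show ?thesis unfolding c_def .
qed

text \<open>Induction over the partition, the last increment being split off by independence. Independence holds
  only on the event that \<open>L\<close> is still finite, and this is where the monotonicity of the exponents \<open>c\<close> enters:
  if the last one is positive, then all are, so that a path that has been killed already contributes \<open>0\<close>;
  if it is \<open>0\<close>, the last increment does not matter.\<close>

lemma subordinator_laplace_partition:
  fixes c :: "nat \<Rightarrow> ennreal" and q :: "nat \<Rightarrow> real"
  assumes sub: "subordinator P L \<nu>"
    and q0: "q 0 = 0" and q: "\<And>i. i < m \<Longrightarrow> q i \<le> q (Suc i)"
    and c: "\<And>i. Suc i < m \<Longrightarrow> c (Suc i) \<le> c i"
  shows "(\<integral>\<^sup>+ \<omega>. ennreal (expneg (\<Sum>i<m. c i * (L (q (Suc i)) \<omega> - L (q i) \<omega>))) \<partial>P)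
    = ennreal (expneg (\<Sum>i<m. Psi_L \<nu> (c i) * ennreal (q (Suc i) - q i)))"
  using q c
proof (induction m)
  case 0
  interpret prob_space P by (rule subordinatorD[OF sub])
  show ?case by (simp add: emeasure_space_1)
next
  case (Suc m)
  interpret prob_space P by (rule subordinatorD[OF sub])
  have qmono: "i \<le> j \<Longrightarrow> j \<le> Suc m \<Longrightarrow> q i \<le> q j" for i j
  proof (induction rule: dec_induct)
    case (step n)
    then show ?case using Suc.prems(1)[of n] by auto
  qed simp
  have qpos: "i \<le> Suc m \<Longrightarrow> 0 \<le> q i" for i using qmono[of 0 i] q0 by simp
  have cmono: "i \<le> m \<Longrightarrow> c m \<le> c i" for i
  proof (induction rule: inc_induct)
    case (step n)
    then show ?case using Suc.prems(2)[of n] by auto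
  qed simp
  let ?t = "q m" and ?s = "q (Suc m) - q m"
  have t: "0 \<le> ?t" and s: "0 \<le> ?s" using qpos[of m] qmono[of m "Suc m"] by auto
  define Y where "Y \<omega> = ennreal (expneg (\<Sum>i<m. c i * (L (q (Suc i)) \<omega> - L (q i) \<omega>)))" for \<omega>
  have IH: "(\<integral>\<^sup>+ \<omega>. Y \<omega> \<partial>P) = ennreal (expneg (\<Sum>i<m. Psi_L \<nu> (c i) * ennreal (q (Suc i) - q i)))"
    unfolding Y_def by (rule Suc.IH) (use Suc.prems in auto)
  have split: "ennreal (expneg (\<Sum>i<Suc m. c i * (L (q (Suc i)) \<omega> - L (q i) \<omega>)))
      = Y \<omega> * ennreal (expneg (c m * (L (?t + ?s) \<omega> - L ?t \<omega>)))" for \<omega>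
    by (simp add: Y_def expneg_add ennreal_mult)
  show ?case
  proof (cases "c m = 0")
    case True
    then show ?thesis using IH unfolding split by simp
  next
    case False
    have [measurable]: "L (q i) \<in> borel_measurable (past P L ?t)" if "i \<le> m" for i
      by (rule measurable_past) (use that qpos qmono in auto)
    have Y [measurable]: "Y \<in> borel_measurable (past P L ?t)"
    proof -
      have "(\<lambda>\<omega>. \<Sum>i<m. c i * (L (q (Suc i)) \<omega> - L (q i) \<omega>)) \<in> borel_measurable (past P L ?t)"
        by (intro borel_measurable_sum) measurable
      then show ?thesis unfolding Y_def by measurable
    qed
    \<comment> \<open>A path that is infinite at \<open>q m\<close> has an infinite increment in an earlier cell.\<close>
    have dead: "Y \<omega> = 0" if \<omega>: "\<omega> \<in> space P" and top: "L ?t \<omega> = \<infinity>" for \<omega>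
    proof -
      have "\<exists>i<m. L (q (Suc i)) \<omega> = \<infinity> \<and> L (q i) \<omega> \<noteq> \<infinity>"
      proof (rule ccontr)
        assume *: "\<not> ?thesis"
        have "i \<le> m \<Longrightarrow> L (q i) \<omega> \<noteq> \<infinity>" for i
        proof (induction i)
          case 0
          then show ?case using q0 subordinatorD(4)[OF sub \<omega>] by simp
        qed (use * in auto)
        then show False using top by auto
      qed
      then obtain i where i: "i < m" "L (q (Suc i)) \<omega> = \<infinity>" "L (q i) \<omega> \<noteq> \<infinity>" by blast
      have "c i \<noteq> 0" using cmono[of i] i False by auto
      then have "c i * (L (q (Suc i)) \<omega> - L (q i) \<omega>) = \<infinity>"
        using i by (simp add: ennreal_mult_top)
      then have S: "(\<Sum>i<m. c i * (L (q (Suc i)) \<omega> - L (q i) \<omega>)) = \<infinity>"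
        using member_le_sum[of i "{..<m}" "\<lambda>i. c i * (L (q (Suc i)) \<omega> - L (q i) \<omega>)"] i(1)
        by (auto simp: top_unique)
      show ?thesis unfolding Y_def S by simp
    qed
    have alive: "Y \<omega> = Y \<omega> * indicator {\<omega>. L ?t \<omega> < \<infinity>} \<omega>" if "\<omega> \<in> space P" for \<omega>
      using dead[OF that] by (cases "L ?t \<omega> = \<infinity>") (auto simp: less_top)
    have "(\<integral>\<^sup>+ \<omega>. ennreal (expneg (\<Sum>i<Suc m. c i * (L (q (Suc i)) \<omega> - L (q i) \<omega>))) \<partial>P)
        = (\<integral>\<^sup>+ \<omega>. Y \<omega> * indicator {\<omega>. L ?t \<omega> < \<infinity>} \<omega>
            * ennreal (expneg (c m * (L (?t + ?s) \<omega> - L ?t \<omega>))) \<partial>P)"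
      unfolding split by (intro nn_integral_cong) (subst alive, auto)
    also have "\<dots> = (\<integral>\<^sup>+ \<omega>. Y \<omega> * indicator {\<omega>. L ?t \<omega> < \<infinity>} \<omega> \<partial>P)
        * (\<integral>\<^sup>+ \<omega>. ennreal (expneg (c m * L ?s \<omega>)) \<partial>P)"
      by (rule subordinator_markov[OF sub t s Y]) measurable
    also have "(\<integral>\<^sup>+ \<omega>. Y \<omega> * indicator {\<omega>. L ?t \<omega> < \<infinity>} \<omega> \<partial>P) = (\<integral>\<^sup>+ \<omega>. Y \<omega> \<partial>P)"
      by (intro nn_integral_cong) (rule alive [symmetric])
    also have "(\<integral>\<^sup>+ \<omega>. ennreal (expneg (c m * L ?s \<omega>)) \<partial>P)
        = ennreal (expneg (ennreal ?s * Psi_L \<nu> (c m)))"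
      by (rule subordinator_laplace[OF sub s])
    finally show ?thesis
      unfolding IH by (simp add: expneg_add ennreal_mult mult.commute)
  qed
qed

section \<open>Stieltjes integrals of nonincreasing functions\<close>

lemma antimono_from_0_iff:
  fixes g :: "real \<Rightarrow> ennreal"
  shows "antimono_on {0..} g \<longleftrightarrow> (\<forall>x\<ge>0. \<forall>y\<ge>x. g y \<le> g x)"
  unfolding monotone_on_def by auto

lemma antimono_from_0D:
  fixes g :: "real \<Rightarrow> ennreal"
  shows "antimono_on {0..} g \<Longrightarrow> 0 \<le> x \<Longrightarrow> x \<le> y \<Longrightarrow> g y \<le> g x"
  by (simp add: antimono_from_0_iff)

text \<open>Composition with the order reversing bijection \<open>expneg\<close> reduces this to real-valued monotone functions; the
  value \<open>\<infinity>\<close> on the negative half line makes \<open>g\<close> nonincreasing on all of \<open>\<real>\<close>.\<close>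

lemma borel_measurable_antimono_from_0:
  fixes g :: "real \<Rightarrow> ennreal"
  assumes "antimono_on {0..} g"
  shows "(\<lambda>x. g x * indicator {0..} x) \<in> borel_measurable borel"
proof -
  define f where "f x = (if x < 0 then \<top> else g x)" for x
  have "mono (\<lambda>x. expneg (f x))"
    using assms by (intro monoI expneg_antimono) (auto simp: f_def antimono_from_0_iff)
  then have [measurable]: "(\<lambda>x. expneg (f x)) \<in> borel_measurable borel"
    by (rule borel_measurable_mono)
  have "(\<lambda>x. neglog (expneg (f x)) * indicator {0..} x) \<in> borel_measurable borel"
    by measurable
  also have "(\<lambda>x. neglog (expneg (f x)) * indicator {0..} x) = (\<lambda>x. g x * indicator {0..} x)"
    by (auto simp: neglog_expneg f_def indicator_def)
  finally show ?thesis .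
qed

lemma emeasure_lborel_atLeast: "emeasure lborel {a::real..} = \<top>"
proof -
  have "of_nat n \<le> emeasure lborel {a..}" for n
  proof -
    have "of_nat n = emeasure lborel {a..a + real n}"
      by (simp add: ennreal_of_nat_eq_real_of_nat)
    also have "\<dots> \<le> emeasure lborel {a..}" by (intro emeasure_mono) auto
    finally show ?thesis .
  qed
  then have "(SUP n. of_nat n) \<le> emeasure lborel {a..}" by (rule SUP_least)
  then show ?thesis by (simp add: ennreal_SUP_of_nat_eq_top top_unique)
qed

lemma emeasure_below_ennreal: "emeasure lborel {u. 0 \<le> u \<and> ennreal u < a} = a"
proof (cases a)
  case (real r)
  then have "{u. 0 \<le> u \<and> ennreal u < a} = {0..<r}"
    by (auto simp: ennreal_less_iff)
  then show ?thesis using real by simp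
next
  case top
  then have "{u. 0 \<le> u \<and> ennreal u < a} = {0::real..}" by auto
  then show ?thesis using top by (simp add: emeasure_lborel_atLeast)
qed

lemma nn_integral_below_ennreal:
  "(\<integral>\<^sup>+ u. c * indicator {u. 0 \<le> u \<and> ennreal u < a} u \<partial>lborel) = a * c"
proof -
  have "(\<integral>\<^sup>+ u. c * indicator {u. 0 \<le> u \<and> ennreal u < a} u \<partial>lborel)
      = c * emeasure lborel {u. 0 \<le> u \<and> ennreal u < a}"
    by (rule nn_integral_cmult_indicator) measurable
  then show ?thesis by (simp add: emeasure_below_ennreal mult.commute)
qed

lemma nn_integral_layer_cake:
  assumes "sigma_finite_measure M" and [measurable]: "f \<in> borel_measurable M"
  shows "(\<integral>\<^sup>+ x. f x \<partial>M) = (\<integral>\<^sup>+ u\<in>{0..}. emeasure M {x\<in>space M. ennreal u < f x} \<partial>lborel)"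
proof -
  interpret sigma_finite_measure M by fact
  interpret pair_sigma_finite M lborel by standard
  have "(\<integral>\<^sup>+ x. f x \<partial>M) = (\<integral>\<^sup>+ x. \<integral>\<^sup>+ u. indicator {u. 0 \<le> u \<and> ennreal u < f x} u \<partial>lborel \<partial>M)"
    by (simp add: emeasure_below_ennreal)
  also have "\<dots> = (\<integral>\<^sup>+ u. \<integral>\<^sup>+ x. indicator {u. 0 \<le> u \<and> ennreal u < f x} u \<partial>M \<partial>lborel)"
    by (rule Fubini'[symmetric]) (simp add: indicator_def)
  also have "\<dots> = (\<integral>\<^sup>+ u\<in>{0..}. emeasure M {x\<in>space M. ennreal u < f x} \<partial>lborel)"
  proof (intro nn_integral_cong)
    fix u :: real
    have "(\<integral>\<^sup>+ x. indicator {u. 0 \<le> u \<and> ennreal u < f x} u \<partial>M)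
        = (\<integral>\<^sup>+ x. indicator {0..} u * indicator {x\<in>space M. ennreal u < f x} x \<partial>M)"
      by (intro nn_integral_cong) (auto simp: indicator_def)
    also have "\<dots> = indicator {0..} u * emeasure M {x\<in>space M. ennreal u < f x}"
      by (rule nn_integral_cmult_indicator) measurable
    finally show "(\<integral>\<^sup>+ x. indicator {u. 0 \<le> u \<and> ennreal u < f x} u \<partial>M)
        = emeasure M {x\<in>space M. ennreal u < f x} * indicator {0..} u" by (simp add: mult.commute)
  qed
  finally show ?thesis .
qed

text \<open>A nonincreasing function has at most countably many right jumps. Together with the rationals they form a
  countable set from which every point can be approximated from the right (or is hit) with convergence of
  the values of \<open>g\<close>. One sequence of partitions serves finitely many functions.\<close>

lemma right_dense_partitions:
  fixes g :: "'k \<Rightarrow> real \<Rightarrow> ennreal"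
  assumes "finite K" and anti: "\<And>k. k \<in> K \<Longrightarrow> antimono_on {0..} (g k)"
  obtains C :: "nat \<Rightarrow> real set"
    where "\<And>n. finite (C n)" "\<And>n. 0 \<in> C n" "\<And>n. C n \<subseteq> {0..}" "incseq C"
      "\<And>k x u. k \<in> K \<Longrightarrow> 0 \<le> x \<Longrightarrow> u < g k x \<Longrightarrow> \<exists>n. \<exists>y\<in>C n. x \<le> y \<and> u < g k y"
proof -
  \<comment> \<open>the right jumps of \<open>g k\<close>\<close>
  define J where "J k = {x. 0 \<le> x \<and> (\<exists>u<g k x. \<forall>y>x. g k y \<le> u)}" for k
  have J: "countable (J k)" if "k \<in> K" for k
  proof -
    have "\<exists>r::rat. \<exists>u<g k x. (\<forall>y>x. g k y \<le> u) \<and> u < ennreal (real_of_rat r) \<and> ennreal (real_of_rat r) < g k x"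
      if "x \<in> J k" for x
    proof -
      obtain u where u: "u < g k x" "\<forall>y>x. g k y \<le> u" using \<open>x \<in> J k\<close> by (auto simp: J_def)
      from ennreal_rat_dense[OF u(1)] u show ?thesis by blast
    qed
    \<comment> \<open>Rationals in the gaps of distinct right jumps are distinct, so they index the jumps injectively.\<close>
    then obtain r :: "real \<Rightarrow> rat" where r: "\<And>x. x \<in> J k \<Longrightarrow> \<exists>u<g k x. (\<forall>y>x. g k y \<le> u)
        \<and> u < ennreal (real_of_rat (r x)) \<and> ennreal (real_of_rat (r x)) < g k x"
      by metis
    have less: "ennreal (real_of_rat (r y)) < ennreal (real_of_rat (r x))"
      if "x \<in> J k" "y \<in> J k" "x < y" for x y
      using r[OF that(1)] r[OF that(2)] that(3) by (meson le_less_trans less_le_trans less_imp_le)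
    have "inj_on r (J k)"
      by (rule inj_onI) (metis less less_irrefl linorder_neqE)
    then show ?thesis by (rule countableI') 
  qed
  define D where "D = \<rat> \<inter> {0..} \<union> (\<Union>k\<in>K. J k)"
  have cD: "countable D"
    unfolding D_def using J assms(1) by (auto intro: countable_rat countable_finite)
  have neD: "D \<noteq> {}" by (auto simp: D_def)
  have D0: "D \<subseteq> {0..}" by (auto simp: D_def J_def)
  define C where "C n = insert 0 (from_nat_into D ` {..n})" for n :: nat
  show thesis
  proof (rule that)
    show "C n \<subseteq> {0..}" for n
      using from_nat_into[OF neD] D0 by (auto simp: C_def)
    show "incseq C" by (fastforce simp: C_def incseq_def)
    fix k x and u :: ennreal assume k: "k \<in> K" and x: "0 \<le> x" and u: "u < g k x"
    have "\<exists>y\<in>D. x \<le> y \<and> u < g k y"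
    proof (cases "x \<in> J k")
      case True
      then show ?thesis using k u by (auto simp: D_def)
    next
      case False
      then obtain z where z: "x < z" "u < g k z" using u x by (auto simp: J_def not_le)
      obtain y where y: "y \<in> \<rat>" "x < y" "y < z" using Rats_dense_in_real[OF z(1)] by blast
      have "g k z \<le> g k y" using antimono_from_0D[OF anti[OF k], of y z] x y by simp
      then show ?thesis using y x z(2) by (intro bexI[of _ y]) (auto simp: D_def)
    qed
    then obtain y where y: "y \<in> D" "x \<le> y" "u < g k y" by blast
    obtain n where "from_nat_into D n = y" using from_nat_into_surj[OF cD y(1)] by blast
    then show "\<exists>n. \<exists>y\<in>C n. x \<le> y \<and> u < g k y"
      using y by (auto simp: C_def intro!: exI[of _ n])
  qed (auto simp: C_def)
qed

definition lower_sum :: "(real \<Rightarrow> ennreal) \<Rightarrow> (real \<Rightarrow> ennreal) \<Rightarrow> real list \<Rightarrow> ennreal" where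
  "lower_sum g A p = (\<Sum>i<length p - 1. g (p ! Suc i) * (A (p ! Suc i) - A (p ! i)))"

text \<open>The infimum of a nonincreasing function over \<open>(a, b]\<close> is its value at \<open>b\<close>.\<close>

lemma stieltjes_eq_lower_sum:
  fixes g :: "real \<Rightarrow> ennreal"
  assumes "antimono_on {0..} g"
  shows "stieltjes g A = (\<Squnion>p\<in>{p. sorted_wrt (<) p \<and> set p \<subseteq> {0..}}. lower_sum g A p)"
  unfolding stieltjes_def lower_sum_def
proof (intro SUP_cong refl sum.cong)
  fix p i assume p: "p \<in> {p. sorted_wrt (<) p \<and> set p \<subseteq> {0::real..}}" and "i \<in> {..<length p - 1}"
  then have i: "Suc i < length p" by auto
  have less: "p ! i < p ! Suc i" using p i by (auto simp: sorted_wrt_iff_nth_less)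
  have "p ! i \<in> set p" using i by simp
  then have pos: "0 \<le> p ! i" using p by blast
  have "(\<Sqinter>s\<in>{p ! i<..p ! Suc i}. g s) = g (p ! Suc i)"
    using less pos assms
    by (intro antisym INF_greatest INF_lower) (auto simp: antimono_from_0_iff)
  then show "(\<Sqinter>s\<in>{p ! i<..p ! Suc i}. g s) * (A (p ! Suc i) - A (p ! i))
      = g (p ! Suc i) * (A (p ! Suc i) - A (p ! i))" by simp
qed

text \<open>At a fixed level \<open>v\<close>, the cells on which \<open>g\<close> exceeds \<open>v\<close> form an initial segment of the partition, so the
  increments of \<open>A\<close> telescope. The convention \<open>\<infinity> - \<infinity> = \<infinity>\<close> of \<^typ>\<open>ennreal\<close> does no harm: if a cell that counts
  has \<open>A = \<infinity>\<close> at its right end, then both sides are infinite.\<close>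

lemma telescope_superlevel:
  fixes A :: "real \<Rightarrow> ennreal" and q :: "nat \<Rightarrow> real"
  assumes "A (q 0) = 0" and "\<And>i j. i \<le> j \<Longrightarrow> j \<le> m \<Longrightarrow> A (q i) \<le> A (q j)"
    and "\<And>i j. i \<le> j \<Longrightarrow> j \<le> m \<Longrightarrow> (g (q j) :: ennreal) \<le> g (q i)"
  shows "(\<Sum>i<m. (A (q (Suc i)) - A (q i)) * of_bool (v < g (q (Suc i))))
    = (SUP i\<in>{i. i \<le> m \<and> v < g (q i)}. A (q i))"
  using assms(2,3)
proof (induction m)
  case 0
  have "(SUP i\<in>{i. i \<le> 0 \<and> v < g (q i)}. A (q i)) \<le> 0"
    by (intro SUP_least) (simp add: assms(1))
  then show ?case by simp
next
  case (Suc m)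
  have IH: "(\<Sum>i<m. (A (q (Suc i)) - A (q i)) * of_bool (v < g (q (Suc i))))
      = (SUP i\<in>{i. i \<le> m \<and> v < g (q i)}. A (q i))"
    by (rule Suc.IH) (use Suc.prems in auto)
  show ?case
  proof (cases "v < g (q (Suc m))")
    case True
    then have all: "v < g (q i)" if "i \<le> Suc m" for i
      using Suc.prems(2)[of i "Suc m"] that by (auto intro: less_le_trans)
    have "(SUP i\<in>{i. i \<le> m \<and> v < g (q i)}. A (q i)) = A (q m)"
      using all Suc.prems(1)
      by (intro antisym SUP_least SUP_upper2[of m]) auto
    moreover have "(SUP i\<in>{i. i \<le> Suc m \<and> v < g (q i)}. A (q i)) = A (q (Suc m))"
      using all Suc.prems(1)
      by (intro antisym SUP_least SUP_upper2[of "Suc m"]) auto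
    ultimately show ?thesis
      using IH True Suc.prems(1)[of m "Suc m"] by (simp add: add_diff_inverse_ennreal)
  next
    case False
    then have "{i. i \<le> Suc m \<and> v < g (q i)} = {i. i \<le> m \<and> v < g (q i)}"
      by (auto simp: le_Suc_eq)
    then show ?thesis using IH False by simp
  qed
qed

text \<open>The total increment of a nondecreasing \<open>A\<close> with \<open>A(0) = 0\<close> over the superlevel set of \<open>g\<close> at \<open>u\<close>, as seen by the
  points of \<open>S\<close>. Unlike the lower sums, it is obviously monotone in \<open>S\<close>.\<close>

definition superlevel_sup :: "(real \<Rightarrow> ennreal) \<Rightarrow> (real \<Rightarrow> ennreal) \<Rightarrow> real set \<Rightarrow> real \<Rightarrow> ennreal" where
  "superlevel_sup g A S u = (SUP x\<in>{x\<in>S. ennreal u < g x}. A x)"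

lemma superlevel_sup_mono: "S \<subseteq> T \<Longrightarrow> superlevel_sup g A S u \<le> superlevel_sup g A T u"
  unfolding superlevel_sup_def by (intro SUP_subset_mono) auto

lemma partition_list:
  assumes "finite C" "0 \<in> C" "C \<subseteq> {0::real..}"
  defines "p \<equiv> sorted_list_of_set C"
  shows "sorted_wrt (<) p" "set p \<subseteq> {0..}" "p \<noteq> []" "p ! 0 = 0" "set p = C"
proof -
  show 1: "sorted_wrt (<) p" "set p \<subseteq> {0..}" "set p = C"
    using assms by (auto simp: p_def strict_sorted_list_of_set)
  then show 2: "p \<noteq> []" using assms(2) by auto
  have "0 \<in> set p" using 1 assms(2) by simp
  then show "p ! 0 = 0" using 1(1,2)
    by (cases p) auto
qed

context
  fixes g A :: "real \<Rightarrow> ennreal"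
  assumes g: "antimono_on {0..} g" and A0: "A 0 = 0"
    and A: "\<And>x y. 0 \<le> x \<Longrightarrow> x \<le> y \<Longrightarrow> A x \<le> A y"
begin

lemma lower_sum_sums_superlevel:
  assumes "sorted_wrt (<) p" "set p \<subseteq> {0..}" "p \<noteq> []" "p ! 0 = 0"
  shows "superlevel_sup g A (set p) u
    = (\<Sum>i<length p - 1. (A (p ! Suc i) - A (p ! i)) * of_bool (ennreal u < g (p ! Suc i)))"
proof -
  have mono: "0 \<le> p ! i" "p ! i \<le> p ! j" if "i \<le> j" "j \<le> length p - 1" for i j
  proof -
    have "j < length p" using that assms(3) by (cases p) auto
    then have "p ! i \<in> set p" using that by simp
    then show "0 \<le> p ! i" using assms(2) by blast
    show "p ! i \<le> p ! j" using assms(1) that \<open>j < length p\<close>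
      by (cases "i = j") (auto simp: sorted_wrt_iff_nth_less less_imp_le)
  qed
  have "superlevel_sup g A (set p) u = (SUP i\<in>{i. i \<le> length p - 1 \<and> ennreal u < g (p ! i)}. A (p ! i))"
  proof -
    have "{x\<in>set p. ennreal u < g x} = (!) p ` {i. i \<le> length p - 1 \<and> ennreal u < g (p ! i)}"
    proof -
      have "i \<le> length p - 1 \<longleftrightarrow> i < length p" for i using assms(3) by (cases p) auto
      then show ?thesis by (auto simp: in_set_conv_nth)
    qed
    then show ?thesis by (simp add: superlevel_sup_def image_comp)
  qed
  also have "\<dots> = (\<Sum>i<length p - 1. (A (p ! Suc i) - A (p ! i)) * of_bool (ennreal u < g (p ! Suc i)))"
    by (rule telescope_superlevel[symmetric])
      (use mono in \<open>auto simp: assms(4) A0 intro!: A antimono_from_0D[OF g]\<close>)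
  finally show ?thesis .
qed

lemma borel_measurable_superlevel_sup:
  assumes "sorted_wrt (<) p" "set p \<subseteq> {0..}" "p \<noteq> []" "p ! 0 = 0"
  shows "superlevel_sup g A (set p) \<in> borel_measurable borel"
  unfolding lower_sum_sums_superlevel[OF assms, abs_def] by measurable

text \<open>Layer cake: integrating the telescoped increments over all levels gives back the lower sum. Hence lower
  sums increase under refinement.\<close>

lemma lower_sum_eq_integral:
  assumes "sorted_wrt (<) p" "set p \<subseteq> {0..}" "p \<noteq> []" "p ! 0 = 0"
  shows "lower_sum g A p = (\<integral>\<^sup>+ u\<in>{0..}. superlevel_sup g A (set p) u \<partial>lborel)"
proof -
  have "(\<integral>\<^sup>+ u\<in>{0..}. superlevel_sup g A (set p) u \<partial>lborel)
      = (\<integral>\<^sup>+ u. (\<Sum>i<length p - 1. (A (p ! Suc i) - A (p ! i))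
          * indicator {u. 0 \<le> u \<and> ennreal u < g (p ! Suc i)} u) \<partial>lborel)"
    unfolding lower_sum_sums_superlevel[OF assms] sum_distrib_right
    by (intro nn_integral_cong sum.cong) (auto simp: indicator_def)
  also have "\<dots> = (\<Sum>i<length p - 1. \<integral>\<^sup>+ u. (A (p ! Suc i) - A (p ! i))
          * indicator {u. 0 \<le> u \<and> ennreal u < g (p ! Suc i)} u \<partial>lborel)"
    by (rule nn_integral_sum) measurable
  finally show ?thesis by (simp add: nn_integral_below_ennreal lower_sum_def)
qed

lemma lower_sum_le_integral:
  assumes "sorted_wrt (<) p" "set p \<subseteq> {0..}"
  shows "lower_sum g A p \<le> (\<integral>\<^sup>+ u\<in>{0..}. superlevel_sup g A {0..} u \<partial>lborel)"
proof (cases "p = []")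
  case True
  then show ?thesis by (simp add: lower_sum_def)
next
  case False
  have le: "lower_sum g A p \<le> (\<integral>\<^sup>+ u\<in>{0..}. superlevel_sup g A {0..} u \<partial>lborel)"
    if "sorted_wrt (<) p" "set p \<subseteq> {0..}" "p \<noteq> []" "p ! 0 = 0" for p
    unfolding lower_sum_eq_integral[OF that]
    by (intro nn_integral_mono mult_right_mono superlevel_sup_mono) (use that in auto)
  show ?thesis
  proof (cases "p ! 0 = 0")
    case True
    then show ?thesis using le assms False by blast
  next
    case nz: False
    \<comment> \<open>A partition that does not start in \<open>0\<close> is extended by \<open>0\<close>, which only adds a cell.\<close>
    obtain a r where p: "p = a # r" using False by (cases p) auto
    then have "0 < a" using nz assms(2) by auto
    then have "sorted_wrt (<) (0 # p)" using assms(1) by (auto simp: p)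
    then have "lower_sum g A (0 # p) \<le> (\<integral>\<^sup>+ u\<in>{0..}. superlevel_sup g A {0..} u \<partial>lborel)"
      using assms(2) by (intro le) auto
    moreover have "lower_sum g A p \<le> lower_sum g A (0 # p)"
    proof -
      have "length (0 # p) - 1 = Suc (length p - 1)" by (simp add: p)
      then show ?thesis
        unfolding lower_sum_def by (simp only: sum.lessThan_Suc_shift) simp
    qed
    ultimately show ?thesis by simp
  qed
qed

text \<open>A point \<open>x\<close> with \<open>g x > u\<close> is followed by a point \<open>y \<ge> x\<close> of some \<open>C n\<close> with \<open>g y > u\<close>, and \<open>A y \<ge> A x\<close>. So the
  suprema over \<open>C n\<close> increase to the supremum over all points, at every level \<open>u\<close>, and monotone convergence
  gives the Stieltjes integral as the limit along \<open>C\<close>. This holds for each nondecreasing \<open>A\<close> separately, so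
  one sequence \<open>C\<close> serves all paths of a process.\<close>

lemma
  fixes C :: "nat \<Rightarrow> real set"
  assumes C: "\<And>n. finite (C n)" "\<And>n. 0 \<in> C n" "\<And>n. C n \<subseteq> {0..}" "incseq C"
    and dense: "\<And>x u. 0 \<le> x \<Longrightarrow> u < g x \<Longrightarrow> \<exists>n. \<exists>y\<in>C n. x \<le> y \<and> u < g y"
  shows incseq_lower_sum: "incseq (\<lambda>n. lower_sum g A (sorted_list_of_set (C n)))"
    and SUP_lower_sum: "(SUP n. lower_sum g A (sorted_list_of_set (C n)))
      = (\<integral>\<^sup>+ u\<in>{0..}. superlevel_sup g A {0..} u \<partial>lborel)"
    and stieltjes_SUP: "stieltjes g A = (SUP n. lower_sum g A (sorted_list_of_set (C n)))"
proof -
  note p = partition_list[OF C(1) C(2) C(3)]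
  have low: "lower_sum g A (sorted_list_of_set (C n)) = (\<integral>\<^sup>+ u\<in>{0..}. superlevel_sup g A (C n) u \<partial>lborel)" for n
    using lower_sum_eq_integral[OF p(1-4)[of n]] p(5)[of n] by simp
  have [measurable]: "superlevel_sup g A (C n) \<in> borel_measurable borel" for n
    using borel_measurable_superlevel_sup[OF p(1-4)[of n]] p(5)[of n] by simp
  have inc: "superlevel_sup g A (C m) u \<le> superlevel_sup g A (C n) u" if "m \<le> n" for m n u
    using C(4) that by (intro superlevel_sup_mono) (auto simp: incseq_def)
  show "incseq (\<lambda>n. lower_sum g A (sorted_list_of_set (C n)))"
    unfolding incseq_def low by (auto intro!: nn_integral_mono mult_right_mono inc)
  have sup: "superlevel_sup g A {0..} u = (SUP n. superlevel_sup g A (C n) u)" for u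
  proof (rule antisym)
    show "superlevel_sup g A {0..} u \<le> (SUP n. superlevel_sup g A (C n) u)"
      unfolding superlevel_sup_def[of g A "{0..}"]
    proof (rule SUP_least)
      fix x assume x: "x \<in> {x \<in> {0..}. ennreal u < g x}"
      then obtain n y where y: "y \<in> C n" "x \<le> y" "ennreal u < g y" using dense[of x "ennreal u"] by auto
      have "A x \<le> A y" using x y by (intro A) auto
      also have "\<dots> \<le> superlevel_sup g A (C n) u"
        unfolding superlevel_sup_def using y by (intro SUP_upper) auto
      also have "\<dots> \<le> (SUP n. superlevel_sup g A (C n) u)" by (intro SUP_upper) auto
      finally show "A x \<le> (SUP n. superlevel_sup g A (C n) u)" .
    qed
  qed (use C(3) in \<open>auto intro!: SUP_least superlevel_sup_mono\<close>)
  have "(\<integral>\<^sup>+ u\<in>{0..}. superlevel_sup g A {0..} u \<partial>lborel)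
      = (\<integral>\<^sup>+ u. (SUP n. superlevel_sup g A (C n) u * indicator {0..} u) \<partial>lborel)"
    unfolding sup SUP_mult_right_ennreal ..
  also have "\<dots> = (SUP n. lower_sum g A (sorted_list_of_set (C n)))"
    unfolding low using inc
    by (intro nn_integral_monotone_convergence_SUP) (auto simp: incseq_def le_fun_def intro!: mult_right_mono)
  finally show S: "(SUP n. lower_sum g A (sorted_list_of_set (C n)))
      = (\<integral>\<^sup>+ u\<in>{0..}. superlevel_sup g A {0..} u \<partial>lborel)" ..
  show "stieltjes g A = (SUP n. lower_sum g A (sorted_list_of_set (C n)))"
    unfolding stieltjes_eq_lower_sum[OF g]
  proof (rule antisym)
    show "(\<Squnion>p\<in>{p. sorted_wrt (<) p \<and> set p \<subseteq> {0..}}. lower_sum g A p)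
        \<le> (SUP n. lower_sum g A (sorted_list_of_set (C n)))"
      unfolding S by (intro SUP_least lower_sum_le_integral) auto
    show "(SUP n. lower_sum g A (sorted_list_of_set (C n)))
        \<le> (\<Squnion>p\<in>{p. sorted_wrt (<) p \<and> set p \<subseteq> {0..}}. lower_sum g A p)"
      using p(1,2) by (intro SUP_least SUP_upper) auto
  qed
qed

end

text \<open>For \<open>A(s) = s\<close>, the superlevel sets are intervals starting in \<open>0\<close>, and the supremum is their length. So the
  limit of the lower sums is the Lebesgue integral.\<close>

lemma integral_superlevel_length:
  fixes g :: "real \<Rightarrow> ennreal"
  assumes g: "antimono_on {0..} g"
  shows "(\<integral>\<^sup>+ u\<in>{0..}. superlevel_sup g ennreal {0..} u \<partial>lborel) = (\<integral>\<^sup>+ s\<in>{0..}. g s \<partial>lborel)"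
proof -
  have "(\<integral>\<^sup>+ s\<in>{0..}. g s \<partial>lborel)
      = (\<integral>\<^sup>+ u\<in>{0..}. emeasure lborel {x\<in>space lborel. ennreal u < g x * indicator {0..} x} \<partial>lborel)"
    using borel_measurable_antimono_from_0[OF g]
    by (intro nn_integral_layer_cake) (auto simp: lborel.sigma_finite_measure_axioms)
  also have "\<dots> = (\<integral>\<^sup>+ u\<in>{0..}. superlevel_sup g ennreal {0..} u \<partial>lborel)"
  proof (intro nn_integral_cong arg_cong2[of _ _ _ _ "(*)"] refl)
    fix u :: real
    define S where "S = {x. 0 \<le> x \<and> ennreal u < g x}"
    define s where "s = superlevel_sup g ennreal {0..} u"
    have S: "{x\<in>space lborel. ennreal u < g x * indicator {0..} x} = S"
      by (auto simp: S_def indicator_def)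
    have s: "s = (SUP x\<in>S. ennreal x)" by (simp add: s_def superlevel_sup_def S_def)
    have Sm: "S \<in> sets borel"
      unfolding S[symmetric] using borel_measurable_antimono_from_0[OF g]
      by (auto simp: borel_measurable_iff_greater)
    have "{x. 0 \<le> x \<and> ennreal x < s} \<subseteq> S"
    proof safe
      fix x :: real assume x: "0 \<le> x" "ennreal x < s"
      then obtain y where y: "y \<in> S" "ennreal x < ennreal y" unfolding s less_SUP_iff by blast
      then have "x \<le> y" using x by (auto simp: S_def ennreal_less_iff)
      then have "g y \<le> g x" using g x by (auto simp: antimono_from_0_iff)
      then show "x \<in> S" using y x by (auto simp: S_def)
    qed
    from emeasure_mono[OF this, of lborel] have 1: "s \<le> emeasure lborel S"
      using Sm by (simp add: emeasure_below_ennreal)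
    have "S \<subseteq> {x. 0 \<le> x \<and> ennreal x \<le> s}"
      unfolding s by (auto simp: S_def intro!: SUP_upper)
    then have "emeasure lborel S \<le> emeasure lborel {x. 0 \<le> x \<and> ennreal x \<le> s}"
      by (intro emeasure_mono) auto
    also have "\<dots> = s"
    proof (cases s)
      case (real r)
      then have "{x. 0 \<le> x \<and> ennreal x \<le> s} = {0..r}" by auto
      then show ?thesis using real by simp
    next
      case top
      then have "{x. 0 \<le> x \<and> ennreal x \<le> s} = {0::real..}" by auto
      then show ?thesis using top by (simp add: emeasure_lborel_atLeast)
    qed
    finally show "emeasure lborel {x\<in>space lborel. ennreal u < g x * indicator {0..} x}
        = superlevel_sup g ennreal {0..} u"
      unfolding S using 1 by (simp add: s_def)
  qed
  finally show ?thesis ..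
qed

section \<open>The Laplace transform of a Stieltjes integral of a subordinator\<close>

text \<open>Lower sums of nonincreasing integrands are linear in the integrand, since no infimum is left. Hence a sum
  of integrals is treated as the integral of the sum.\<close>

lemma lower_sum_sum: "lower_sum (\<lambda>s. \<Sum>k\<in>K. g k s) A p = (\<Sum>k\<in>K. lower_sum (g k) A p)"
  unfolding lower_sum_def sum_distrib_right by (rule sum.swap)

lemma laplace_lower_sum:
  assumes sub: "subordinator P L \<nu>" and h: "antimono_on {0..} h"
    and p: "sorted_wrt (<) p" "set p \<subseteq> {0..}" "p \<noteq> []" "p ! 0 = 0"
  shows "(\<integral>\<^sup>+ \<omega>. ennreal (expneg (lower_sum h (\<lambda>s. L s \<omega>) p)) \<partial>P)
    = ennreal (expneg (lower_sum (\<lambda>s. Psi_L \<nu> (h s)) ennreal p))"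
proof -
  let ?m = "length p - 1"
  have less: "p ! i < p ! Suc i" "0 \<le> p ! i" "0 \<le> p ! Suc i" if "i < ?m" for i
  proof -
    have i: "Suc i < length p" using that by simp
    show "p ! i < p ! Suc i" using p(1) i by (auto simp: sorted_wrt_iff_nth_less)
    have "p ! i \<in> set p" "p ! Suc i \<in> set p" using i by simp_all
    then show "0 \<le> p ! i" "0 \<le> p ! Suc i" using p(2) by blast+
  qed
  have "(\<integral>\<^sup>+ \<omega>. ennreal (expneg (\<Sum>i<?m. h (p ! Suc i) * (L (p ! Suc i) \<omega> - L (p ! i) \<omega>))) \<partial>P)
      = ennreal (expneg (\<Sum>i<?m. Psi_L \<nu> (h (p ! Suc i)) * ennreal (p ! Suc i - p ! i)))"
  proof (rule subordinator_laplace_partition[OF sub, where q = "(!) p"])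
    show "p ! i \<le> p ! Suc i" if "i < ?m" for i using less[OF that] by simp
    show "h (p ! Suc (Suc i)) \<le> h (p ! Suc i)" if "Suc i < ?m" for i
      using less[OF that] by (intro antimono_from_0D[OF h]) auto
  qed (rule p(4))
  also have "(\<Sum>i<?m. Psi_L \<nu> (h (p ! Suc i)) * ennreal (p ! Suc i - p ! i))
      = lower_sum (\<lambda>s. Psi_L \<nu> (h s)) ennreal p"
    unfolding lower_sum_def by (intro sum.cong refl) (use less in \<open>simp add: ennreal_minus\<close>)
  finally show ?thesis unfolding lower_sum_def .
qed

text \<open>Both sides are limits along one sequence of partitions that is right dense for the integrands \<open>g k\<close> and, at
  the same time, for the composite \<open>\<Psi>\<^sub>L \<circ> \<Sum>\<^sub>k g k\<close>, to which the deterministic integrator \<open>s\<close> belongs.\<close>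

lemma subordinator_stieltjes_laplace:
  assumes sub: "subordinator P L \<nu>" and "finite K"
    and g: "\<And>k. k \<in> K \<Longrightarrow> antimono_on {0..} (g k)"
  shows "(\<integral>\<^sup>+ \<omega>. ennreal (expneg (\<Sum>k\<in>K. stieltjes (g k) (\<lambda>s. L s \<omega>))) \<partial>P)
    = ennreal (expneg (\<integral>\<^sup>+ s\<in>{0..}. Psi_L \<nu> (\<Sum>k\<in>K. g k s) \<partial>lborel))"
proof -
  interpret prob_space P by (rule subordinatorD[OF sub])
  define h where "h s = (\<Sum>k\<in>K. g k s)" for s
  have h: "antimono_on {0..} h"
    using g unfolding h_def antimono_from_0_iff by (auto intro!: sum_mono)
  have \<psi>: "antimono_on {0..} (\<lambda>s. Psi_L \<nu> (h s))"
    using h by (auto simp: antimono_from_0_iff intro!: Psi_L_mono)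
  \<comment> \<open>the integrands together with \<open>\<Psi>\<^sub>L \<circ> h\<close>, which gets the index \<open>None\<close>\<close>
  define G where "G = case_option (\<lambda>s. Psi_L \<nu> (h s)) g"
  have fin: "finite (insert None (Some ` K))" using \<open>finite K\<close> by simp
  have anti: "antimono_on {0..} (G k)" if "k \<in> insert None (Some ` K)" for k
    using that g \<psi> by (auto simp: G_def)
  obtain C :: "nat \<Rightarrow> real set"
    where C: "\<And>n. finite (C n)" "\<And>n. 0 \<in> C n" "\<And>n. C n \<subseteq> {0..}" "incseq C"
      and dense: "\<And>k x u. k \<in> insert None (Some ` K) \<Longrightarrow> 0 \<le> x \<Longrightarrow> u < G k x
        \<Longrightarrow> \<exists>n. \<exists>y\<in>C n. x \<le> y \<and> u < G k y"
    by (rule right_dense_partitions[where g = G, OF fin anti], assumption) (rule that)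
  have denseg: "\<exists>n. \<exists>y\<in>C n. x \<le> y \<and> u < g k y" if "k \<in> K" "0 \<le> x" "u < g k x" for k x u
    using dense[of "Some k" x u] that by (simp add: G_def)
  have dense\<psi>: "\<exists>n. \<exists>y\<in>C n. x \<le> y \<and> u < Psi_L \<nu> (h y)" if "0 \<le> x" "u < Psi_L \<nu> (h x)" for x u
    using dense[of None x u] that by (simp add: G_def)
  let ?p = "\<lambda>n. sorted_list_of_set (C n)"
  note p = partition_list[OF C(1-3)]
  have path: "L 0 \<omega> = 0" "0 \<le> x \<Longrightarrow> x \<le> y \<Longrightarrow> L x \<omega> \<le> L y \<omega>" if "\<omega> \<in> space P" for \<omega> x y
    using subordinatorD(4,5)[OF sub that] by auto
  have inc: "incseq (\<lambda>n. lower_sum (g k) (\<lambda>s. L s \<omega>) (?p n))" if "k \<in> K" "\<omega> \<in> space P" for k \<omega>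
    by (rule incseq_lower_sum[OF g[OF that(1)] _ _ C denseg[OF that(1)]]) (use path[OF that(2)] in auto)
  have incsum: "incseq (\<lambda>n. lower_sum h (\<lambda>s. L s \<omega>) (?p n))" if "\<omega> \<in> space P" for \<omega>
    unfolding h_def lower_sum_sum by (intro incseq_sumI2 inc that)
  have sup: "(\<Sum>k\<in>K. stieltjes (g k) (\<lambda>s. L s \<omega>)) = (SUP n. lower_sum h (\<lambda>s. L s \<omega>) (?p n))"
    if "\<omega> \<in> space P" for \<omega>
  proof -
    have "(\<Sum>k\<in>K. stieltjes (g k) (\<lambda>s. L s \<omega>))
        = (\<Sum>k\<in>K. SUP n. lower_sum (g k) (\<lambda>s. L s \<omega>) (?p n))"
      by (intro sum.cong refl stieltjes_SUP[OF g _ _ C denseg]) (use path[OF that] in auto)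
    also have "\<dots> = (SUP n. \<Sum>k\<in>K. lower_sum (g k) (\<lambda>s. L s \<omega>) (?p n))"
      by (rule ennreal_SUP_sum[symmetric]) (rule inc[OF _ that])
    finally show ?thesis unfolding h_def lower_sum_sum .
  qed
  have "(\<lambda>n. \<integral>\<^sup>+ \<omega>. ennreal (expneg (lower_sum h (\<lambda>s. L s \<omega>) (?p n))) \<partial>P)
      \<longlonglongrightarrow> (\<integral>\<^sup>+ \<omega>. ennreal (expneg (SUP n. lower_sum h (\<lambda>s. L s \<omega>) (?p n))) \<partial>P)"
  proof (rule nn_integral_dominated_convergence[where w = "\<lambda>_. 1"])
    have [measurable]: "(\<lambda>\<omega>. lower_sum h (\<lambda>s. L s \<omega>) (?p n)) \<in> borel_measurable P" for n
      unfolding lower_sum_def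
    proof (intro borel_measurable_sum)
      fix i assume "i \<in> {..<length (?p n) - 1}"
      then have "?p n ! i \<in> set (?p n)" "?p n ! Suc i \<in> set (?p n)" by (auto intro!: nth_mem)
      then have "0 \<le> ?p n ! i" "0 \<le> ?p n ! Suc i" using p(2)[of n] by blast+
      then have [measurable]: "L (?p n ! i) \<in> borel_measurable P" "L (?p n ! Suc i) \<in> borel_measurable P"
        by (auto intro!: subordinatorD(3)[OF sub])
      show "(\<lambda>\<omega>. h (?p n ! Suc i) * (L (?p n ! Suc i) \<omega> - L (?p n ! i) \<omega>)) \<in> borel_measurable P"
        by measurable
    qed
    show "(\<lambda>\<omega>. ennreal (expneg (lower_sum h (\<lambda>s. L s \<omega>) (?p n)))) \<in> borel_measurable P" for n
      by measurable
    show "(\<lambda>\<omega>. ennreal (expneg (SUP n. lower_sum h (\<lambda>s. L s \<omega>) (?p n)))) \<in> borel_measurable P"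
      by measurable
    show "AE \<omega> in P. (\<lambda>n. ennreal (expneg (lower_sum h (\<lambda>s. L s \<omega>) (?p n))))
        \<longlonglongrightarrow> ennreal (expneg (SUP n. lower_sum h (\<lambda>s. L s \<omega>) (?p n)))"
      by (intro AE_I2 tendsto_ennrealI expneg_SUP_incseq incsum)
  qed (auto simp: emeasure_space_1)
  moreover have "(\<lambda>n. ennreal (expneg (lower_sum (\<lambda>s. Psi_L \<nu> (h s)) ennreal (?p n))))
      \<longlonglongrightarrow> ennreal (expneg (\<integral>\<^sup>+ s\<in>{0..}. Psi_L \<nu> (h s) \<partial>lborel))"
  proof -
    have "incseq (\<lambda>n. lower_sum (\<lambda>s. Psi_L \<nu> (h s)) ennreal (?p n))"
      by (rule incseq_lower_sum[OF \<psi> _ _ C dense\<psi>]) (auto intro: ennreal_leI)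
    moreover have "(SUP n. lower_sum (\<lambda>s. Psi_L \<nu> (h s)) ennreal (?p n))
        = (\<integral>\<^sup>+ s\<in>{0..}. Psi_L \<nu> (h s) \<partial>lborel)"
      unfolding integral_superlevel_length[OF \<psi>, symmetric]
      by (rule SUP_lower_sum[OF \<psi> _ _ C dense\<psi>]) (auto intro: ennreal_leI)
    ultimately show ?thesis by (metis expneg_SUP_incseq tendsto_ennrealI)
  qed
  ultimately have "(\<integral>\<^sup>+ \<omega>. ennreal (expneg (SUP n. lower_sum h (\<lambda>s. L s \<omega>) (?p n))) \<partial>P)
      = ennreal (expneg (\<integral>\<^sup>+ s\<in>{0..}. Psi_L \<nu> (h s) \<partial>lborel))"
    unfolding laplace_lower_sum[OF sub h p(1-4)] by (rule LIMSEQ_unique)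
  also have "(\<integral>\<^sup>+ \<omega>. ennreal (expneg (SUP n. lower_sum h (\<lambda>s. L s \<omega>) (?p n))) \<partial>P)
      = (\<integral>\<^sup>+ \<omega>. ennreal (expneg (\<Sum>k\<in>K. stieltjes (g k) (\<lambda>s. L s \<omega>))) \<partial>P)"
    by (intro nn_integral_cong) (simp add: sup)
  finally show ?thesis unfolding h_def .
qed

section \<open>The Laplace transform of H\<close>

locale nonneg_cdf =
  fixes F :: "real \<Rightarrow> real" and \<mu> :: "real measure"
  assumes real_distribution: "real_distribution \<mu>" and AE_nonneg: "AE x in \<mu>. 0 \<le> x"
    and F_cdf: "F = cdf \<mu>"
begin

sublocale real_distribution \<mu> by (rule real_distribution)

lemma F_mono: "x \<le> y \<Longrightarrow> F x \<le> F y"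
  unfolding F_cdf by (rule cdf_nondecreasing)

lemma F_nonneg [simp]: "0 \<le> F x" unfolding F_cdf by (rule cdf_nonneg)

lemma F_le_1 [simp]: "F x \<le> 1" unfolding F_cdf by (rule cdf_bounded_prob)

lemma borel_measurable_F [measurable]: "F \<in> borel_measurable borel"
  by (rule borel_measurable_mono) (simp add: monoI F_mono)

lemma F_neg: "x < 0 \<Longrightarrow> F x = 0"
proof -
  assume x: "x < 0"
  have "AE y in \<mu>. y \<notin> {..x}" using AE_nonneg by eventually_elim (use x in auto)
  then have "emeasure \<mu> {..x} = 0" by (subst (asm) AE_iff_measurable[OF _ refl]) (auto simp: atMost_def)
  then show ?thesis unfolding F_cdf cdf_def2 by (simp add: measure_def)
qed

lemma left_val_finite: "left_val F (ennreal x) = measure \<mu> {..<x}" if "0 \<le> x"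
  unfolding left_val_def using that F_cdf cdf_at_left by (auto intro!: tendsto_Lim)

lemma left_val_top: "left_val F \<top> = 1"
  by (simp add: left_val_def)

lemma left_val_mono: "u \<le> v \<Longrightarrow> left_val F u \<le> left_val F v"
  by (cases u; cases v)
    (auto simp: left_val_finite left_val_top top_unique intro!: finite_measure_mono)

text \<open>For \<open>s > 0\<close> this is \<open>F(s / t)\<close> with the convention \<open>F(s / 0) = F(\<infinity>) = 1\<close>.\<close>

definition F_over :: "real \<Rightarrow> real \<Rightarrow> real" where
  "F_over t s = (if t = 0 then 1 else F (s / t))"

lemma borel_measurable_F_over [measurable]: "F_over t \<in> borel_measurable borel"
  unfolding F_over_def by measurable

lemma antitone_left_val:
  "antimono_on {0..} (\<lambda>s. neglog (left_val F (ennreal s / ennreal t)))"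
  unfolding antimono_from_0_iff
  by (intro allI impI neglog_antimono left_val_mono divide_right_mono_ennreal ennreal_leI) 

text \<open>\<open>F\<close> has countably many jumps, so left limits may be replaced by values under the integral.\<close>

lemma AE_left_val:
  assumes t: "0 \<le> t"
  shows "AE s in lborel. 0 \<le> s \<longrightarrow> left_val F (ennreal s / ennreal t) = F_over t s"
proof -
  \<comment> \<open>The point \<open>0\<close> is excluded as well: there \<open>s / t\<close> is \<open>0\<close> even if \<open>t = 0\<close>.\<close>
  let ?N = "insert 0 ((*) t ` {x. measure \<mu> {x} > 0})"
  have "countable ?N" using countable_atoms by auto
  then have "AE s in lborel. s \<notin> ?N"
    by (intro AE_not_in) (rule countable_imp_null_set_lborel)
  then show ?thesis
  proof eventually_elim
    case (elim s)
    show ?case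
    proof
      assume "0 \<le> s"
      then have s: "0 < s" using elim by auto
      show "left_val F (ennreal s / ennreal t) = F_over t s"
      proof (cases "t = 0")
        case True
        then show ?thesis using s by (simp add: F_over_def ennreal_divide_zero left_val_top)
      next
        case False
        then have t: "0 < t" using t by simp
        then have div: "ennreal s / ennreal t = ennreal (s / t)" using s by (intro divide_ennreal) auto
        have "\<not> measure \<mu> {s / t} > 0"
        proof
          assume "measure \<mu> {s / t} > 0"
          then have "t * (s / t) \<in> ?N" by blast
          then show False using elim t by simp
        qed
        then have z: "measure \<mu> {s / t} = 0" by (meson measure_nonneg order_antisym not_le)
        have "{..s / t} = {..<s / t} \<union> {s / t}" by auto
        then have "F (s / t) = measure \<mu> {..<s / t} + measure \<mu> {s / t}"
          unfolding F_cdf cdf_def2 by (simp only:) (rule finite_measure_Union, auto)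
        then show ?thesis using z s t False by (simp add: div left_val_finite F_over_def)
      qed
    qed
  qed
qed

definition exponent :: "ennreal measure \<Rightarrow> 'k set \<Rightarrow> ('k \<Rightarrow> real) \<Rightarrow> ennreal" where
  "exponent \<nu> K t = (\<integral>\<^sup>+ u. (\<integral>\<^sup>+ s\<in>{0..}.
     ennreal (1 - (\<Prod>k\<in>K. expneg (u * neglog (F_over (t k) s)))) \<partial>lborel) \<partial>\<nu>)"

lemma laplace_H:
  assumes sub: "subordinator P L \<nu>" and K: "finite K" and t: "\<And>k. k \<in> K \<Longrightarrow> 0 \<le> t k"
  shows "(\<integral>\<^sup>+ \<omega>. ennreal (expneg (\<Sum>k\<in>K. H F L (t k) \<omega>)) \<partial>P) = ennreal (expneg (exponent \<nu> K t))"
proof -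
  have sets [measurable_cong]: "sets \<nu> = sets borel"
    using subordinatorD(2)[OF sub] by (simp add: levy_measure_def)
  interpret \<nu>: sigma_finite_measure \<nu>
    by (rule sigma_finite_levy_measure[OF subordinatorD(2)[OF sub]])
  interpret pair_sigma_finite \<nu> lborel by standard
  have "AE s in lborel. \<forall>k\<in>K. 0 \<le> s \<longrightarrow> left_val F (ennreal s / ennreal (t k)) = F_over (t k) s"
    using K t by (intro AE_finite_allI AE_left_val) auto
  then have "(\<integral>\<^sup>+ s\<in>{0..}. Psi_L \<nu> (\<Sum>k\<in>K. neglog (left_val F (ennreal s / ennreal (t k)))) \<partial>lborel)
      = (\<integral>\<^sup>+ s\<in>{0..}. Psi_L \<nu> (\<Sum>k\<in>K. neglog (F_over (t k) s)) \<partial>lborel)"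
    by (intro nn_integral_cong_AE, eventually_elim) (auto simp: indicator_def intro!: arg_cong[of _ _ "Psi_L \<nu>"])
  also have "\<dots> = (\<integral>\<^sup>+ s. \<integral>\<^sup>+ u. ennreal (1 - expneg (u * (\<Sum>k\<in>K. neglog (F_over (t k) s)))) * indicator {0..} s \<partial>\<nu> \<partial>lborel)"
    unfolding Psi_L_def by (intro nn_integral_cong nn_integral_multc[symmetric]) measurable
  also have "\<dots> = (\<integral>\<^sup>+ u. \<integral>\<^sup>+ s. ennreal (1 - expneg (u * (\<Sum>k\<in>K. neglog (F_over (t k) s)))) * indicator {0..} s \<partial>lborel \<partial>\<nu>)"
    by (rule Fubini') measurable
  also have "\<dots> = exponent \<nu> K t"
    unfolding exponent_def by (simp add: sum_distrib_left expneg_sum)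
  finally show ?thesis
    unfolding H_def by (subst subordinator_stieltjes_laplace[OF sub K antitone_left_val]) simp
qed

end

section \<open>Powers of a distribution function as probability kernels\<close>

text \<open>Products of copies of a kernel form a kernel: boxes generate the product \<open>\<sigma>\<close>-algebra, and the mass of a box
  is a finite product of measurable functions.\<close>

lemma measurable_PiM_iid_kernel:
  assumes K [measurable]: "K \<in> M \<rightarrow>\<^sub>M subprob_algebra N" and I: "finite I"
  shows "(\<lambda>z. Pi\<^sub>M I (\<lambda>_. K z)) \<in> M \<rightarrow>\<^sub>M subprob_algebra (Pi\<^sub>M I (\<lambda>_. N))"
proof -
  have K': "subprob_space (K z)" "sets (K z) = sets N" if "z \<in> space M" for z
    using subprob_space_kernel[OF K that] sets_kernel[OF K that] by auto
  have space: "space (K z) = space N" if "z \<in> space M" for z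
    using sets_eq_imp_space_eq[OF K'(2)[OF that]] .
  have box: "emeasure (Pi\<^sub>M I (\<lambda>_. K z)) (Pi\<^sub>E I A) = (\<Prod>i\<in>I. emeasure (K z) (A i))"
    if z: "z \<in> space M" and A: "\<And>i. i \<in> I \<Longrightarrow> A i \<in> sets N" for z A
  proof -
    interpret subprob_space "K z" by (rule K'[OF z])
    interpret product_sigma_finite "\<lambda>_. K z" by standard
    show ?thesis by (rule emeasure_PiM[OF I]) (simp add: K'[OF z] A)
  qed
  have box_meas: "(\<lambda>z. emeasure (Pi\<^sub>M I (\<lambda>_. K z)) (Pi\<^sub>E I A)) \<in> borel_measurable M"
    if [measurable]: "\<And>i. i \<in> I \<Longrightarrow> A i \<in> sets N" for A
    by (subst measurable_cong[OF box]) (auto intro!: borel_measurable_prod_ennreal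
      measurable_emeasure_kernel[OF K] simp: that)
  show ?thesis
  proof (rule measurable_subprob_algebra_generated[OF sets_PiM Int_stable_prod_algebra prod_algebra_sets_into_space])
    fix z assume z: "z \<in> space M"
    interpret subprob_space "K z" by (rule K'[OF z])
    show "sets (Pi\<^sub>M I (\<lambda>_. K z)) = sets (Pi\<^sub>M I (\<lambda>_. N))"
      by (rule sets_PiM_cong) (simp_all add: K'[OF z])
    show "subprob_space (Pi\<^sub>M I (\<lambda>_. K z))"
    proof
      have "emeasure (Pi\<^sub>M I (\<lambda>_. K z)) (Pi\<^sub>E I (\<lambda>_. space N)) = (\<Prod>i\<in>I. emeasure (K z) (space N))"
        by (rule box[OF z]) simp
      also have "\<dots> \<le> 1"
        using emeasure_space_le_1 by (intro prod_le_1) (auto simp: space[OF z])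
      finally show "emeasure (Pi\<^sub>M I (\<lambda>_. K z)) (space (Pi\<^sub>M I (\<lambda>_. K z))) \<le> 1"
        by (simp add: space_PiM space[OF z])
      show "space (Pi\<^sub>M I (\<lambda>_. K z)) \<noteq> {}"
        using subprob_not_empty by (simp add: space_PiM PiE_eq_empty_iff)
    qed
  next
    fix A assume "A \<in> prod_algebra I (\<lambda>_. N)"
    then show "(\<lambda>z. emeasure (Pi\<^sub>M I (\<lambda>_. K z)) A) \<in> borel_measurable M"
      unfolding prod_algebra_eq_finite[OF I] by (auto intro!: box_meas)
  qed (rule box_meas, simp)
qed

context nonneg_cdf
begin

lemma df_pow_bounds [simp]: "0 \<le> df_pow F z x" "df_pow F z x \<le> 1"
  by (auto simp: df_pow_def)

lemma df_pow_mono: "x \<le> y \<Longrightarrow> df_pow F z x \<le> df_pow F z y"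
  unfolding df_pow_def by (intro expneg_antimono mult_left_mono neglog_antimono F_mono) auto

lemma borel_measurable_df_pow [measurable]:
  "(\<lambda>x. df_pow F (fst x) (snd x)) \<in> borel_measurable (borel \<Otimes>\<^sub>M borel)"
  unfolding df_pow_def by measurable

lemma df_pow_neg: "z \<noteq> 0 \<Longrightarrow> x < 0 \<Longrightarrow> df_pow F z x = 0"
  by (simp add: df_pow_def F_neg neglog_def ennreal_mult_top)

lemma df_pow_real: "0 < r \<Longrightarrow> df_pow F (ennreal r) x = F x powr r"
  using F_le_1[of x] F_nonneg[of x]
  by (auto simp: df_pow_def neglog_def expneg_def ennreal_mult_top ennreal_mult[symmetric]
      powr_def mult_nonneg_nonpos simp del: F_le_1 F_nonneg)

lemma df_pow_top: "df_pow F \<top> x = (if F x = 1 then 1 else 0)"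
  using F_le_1[of x] F_nonneg[of x]
  by (auto simp: df_pow_def neglog_def expneg_def ennreal_top_mult ennreal_eq_0_iff
      simp del: F_le_1 F_nonneg)

lemma F_right_cont: "(F \<longlongrightarrow> F a) (at_right a)"
  using cdf_is_right_cont[of a] unfolding F_cdf continuous_within .

lemma F_at_top: "(F \<longlongrightarrow> 1) at_top"
  unfolding F_cdf by (rule cdf_lim_at_top_prob)

text \<open>For \<open>0 < z < \<infinity>\<close> this is continuity of the power function; for \<open>z = \<infinity>\<close>, where \<open>F\<^sup>z\<close> is the indicator of
  \<open>F = 1\<close>, the function is constant to the right of each point.\<close>

lemma df_pow_right_cont:
  assumes "z \<noteq> 0"
  shows "continuous (at_right a) (df_pow F z)"
  unfolding continuous_within
proof (cases z)
  case (real r)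
  then have r: "0 < r" using assms by (auto simp: less_le)
  show "(df_pow F z \<longlongrightarrow> df_pow F z a) (at_right a)"
    unfolding real(2) df_pow_real[OF r, abs_def]
    by (intro tendsto_powr' F_right_cont tendsto_const) (use r in auto)
next
  case top
  show "(df_pow F z \<longlongrightarrow> df_pow F z a) (at_right a)"
  proof (cases "F a = 1")
    case True
    then have "F y = 1" if "a < y" for y
      using F_mono[of a y] F_le_1[of y] that by simp
    then have "\<forall>\<^sub>F y in at_right a. df_pow F z y = df_pow F z a"
      using True by (auto simp: top df_pow_top eventually_at_right_less intro: eventually_mono[OF eventually_at_right_less])
    then show ?thesis by (rule tendsto_eventually)
  next
    case False
    then have "F a < 1" by (simp add: less_le)
    from order_tendstoD(2)[OF F_right_cont this]
    have "\<forall>\<^sub>F y in at_right a. df_pow F z y = df_pow F z a"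
      by eventually_elim (use False in \<open>auto simp: top df_pow_top\<close>)
    then show ?thesis by (rule tendsto_eventually)
  qed
qed

lemma df_pow_at_bot:
  assumes "z \<noteq> 0"
  shows "(df_pow F z \<longlongrightarrow> 0) at_bot"
  by (rule tendsto_eventually, rule eventually_mono[OF eventually_gt_at_bot[of 0, unfolded]])
    (use assms in \<open>auto intro: df_pow_neg\<close>)

lemma df_pow_at_top:
  assumes "z \<noteq> 0" and "z = \<top> \<Longrightarrow> \<exists>x. F x = 1"
  shows "(df_pow F z \<longlongrightarrow> 1) at_top"
proof (cases z)
  case (real r)
  then have r: "0 < r" using assms by (auto simp: less_le)
  have "((\<lambda>x. F x powr r) \<longlongrightarrow> 1 powr r) at_top"
    by (intro tendsto_powr' F_at_top tendsto_const) (use r in auto)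
  then show ?thesis unfolding real(2) df_pow_real[OF r, abs_def] by simp
next
  case top
  then obtain x where x: "F x = 1" using assms by blast
  have "F y = 1" if "x \<le> y" for y
    using F_mono[of x y] F_le_1[of y] that x by simp
  then have "\<forall>\<^sub>F y in at_top. df_pow F z y = 1"
    by (auto simp: top df_pow_top intro: eventually_mono[OF eventually_ge_at_top[of x]])
  then show ?thesis by (rule tendsto_eventually)
qed

lemma sets_law_X [simp, measurable_cong]: "sets (law_X F z) = sets borel"
  by (simp add: law_X_def)

lemma space_law_X [simp]: "space (law_X F z) = UNIV"
  by (simp add: law_X_def)

lemma emeasure_law_X_atMost:
  assumes "z \<noteq> 0"
  shows "emeasure (law_X F z) {..x} = ennreal (df_pow F z x)"
  unfolding law_X_def
  by (rule emeasure_interval_measure_Iic[OF df_pow_mono df_pow_right_cont df_pow_at_bot])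
    (use assms in auto)

text \<open>\<open>F\<^sup>0 = 1\<close> is constant, so it induces the null measure. \<open>Z\<close> is almost surely positive, but as a kernel
  \<open>law_X\<close> has to be a subprobability measure at every \<open>z\<close>.\<close>

lemma law_X_0: "emeasure (law_X F 0) UNIV = 0"
proof -
  have 1: "df_pow F 0 = (\<lambda>_. 1)" by (simp add: df_pow_def fun_eq_iff)
  have "emeasure (law_X F 0) {- real n<..real n} = 0" for n
    unfolding law_X_def 1 by (subst emeasure_interval_measure_Ioc) auto
  then have "{- real n<..real n} \<in> null_sets (law_X F 0)" for n by (intro null_setsI) auto
  then have "(\<Union>n. {- real n<..real n}) \<in> null_sets (law_X F 0)" by (rule null_sets_UN)
  also have "(\<Union>n. {- real n<..real n}) = UNIV"
  proof -
    have "\<exists>n. - real n < x \<and> x \<le> real n" for x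
    proof -
      obtain n where "\<bar>x\<bar> < real n" using reals_Archimedean2 by blast
      then show ?thesis by (intro exI[of _ n]) auto
    qed
    then show ?thesis by auto
  qed
  finally show ?thesis by auto
qed

lemma emeasure_law_X_atMost_any:
  "emeasure (law_X F z) {..x} = (if z = 0 then 0 else ennreal (df_pow F z x))"
proof (cases "z = 0")
  case True
  have "emeasure (law_X F 0) {..x} \<le> emeasure (law_X F 0) UNIV" by (intro emeasure_mono) auto
  then show ?thesis using True by (simp add: law_X_0)
qed (simp add: emeasure_law_X_atMost)

lemma emeasure_law_X_UNIV: "emeasure (law_X F z) UNIV = (SUP n. emeasure (law_X F z) {..real n})"
proof -
  have "(\<Union>n. {..real n}) = UNIV" using real_arch_simple by auto
  then show ?thesis
    using SUP_emeasure_incseq[of "\<lambda>n. {..real n}" "law_X F z"]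
    by (simp add: incseq_def image_subset_iff)
qed

lemma law_X_kernel [measurable]: "law_X F \<in> borel \<rightarrow>\<^sub>M subprob_algebra borel"
proof (rule measurable_subprob_algebra_generated)
  show "sets borel = sigma_sets UNIV (range atMost :: real set set)"
    by (subst borel_eq_atMost) simp
  show "Int_stable (range atMost :: real set set)" by (auto simp: Int_stable_def)
  have [measurable]: "(\<lambda>z. emeasure (law_X F z) {..x}) \<in> borel_measurable borel" for x
    unfolding emeasure_law_X_atMost_any df_pow_def by measurable
  then show "(\<lambda>z. emeasure (law_X F z) A) \<in> borel_measurable borel" if "A \<in> range atMost" for A
    using that by auto
  show "(\<lambda>z. emeasure (law_X F z) UNIV) \<in> borel_measurable borel"
    unfolding emeasure_law_X_UNIV by measurable
  show "subprob_space (law_X F z)" for z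
  proof
    show "emeasure (law_X F z) (space (law_X F z)) \<le> 1"
      by (auto simp: emeasure_law_X_UNIV emeasure_law_X_atMost_any intro!: SUP_least)
  qed simp
qed auto

lemma prob_law_X:
  assumes "z \<noteq> 0" and "z = \<top> \<Longrightarrow> \<exists>x. F x = 1"
  shows "prob_space (law_X F z)"
  unfolding law_X_def using real_distribution_interval_measure[OF df_pow_mono df_pow_right_cont df_pow_at_bot df_pow_at_top] assms
  by (auto simp: real_distribution_def)

lemma AE_law_X_nonneg: "AE x in law_X F z. 0 \<le> x"
proof -
  have "emeasure (law_X F z) {..- (1 / Suc n)} = 0" for n
    by (auto simp: emeasure_law_X_atMost_any df_pow_neg)
  then have "AE x in law_X F z. x \<notin> {..- (1 / Suc n)}" for n
    by (intro AE_not_in null_setsI) auto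
  then have "AE x in law_X F z. \<forall>n. x \<notin> {..- (1 / Suc n)}"
    unfolding AE_all_countable ..
  then show ?thesis
  proof eventually_elim
    case (elim x)
    show ?case
    proof (rule ccontr)
      assume "\<not> 0 \<le> x"
      then have "0 < - x" by simp
      from reals_Archimedean[OF this] obtain n where "inverse (real (Suc n)) < - x" by blast
      then show False using elim[rule_format, of n] by (simp add: inverse_eq_divide)
    qed
  qed
qed

text \<open>The integral formula for \<open>\<Psi>\<^sub>F\<close> persists at \<open>z = \<infinity>\<close> by monotone convergence.\<close>

lemma Psi_eq: "Psi F z = (\<integral>\<^sup>+ s\<in>{0..}. ennreal (1 - df_pow F z s) \<partial>lborel)"
proof (cases "z = \<infinity>")
  case False
  then obtain r where "z = ennreal r" "0 \<le> r" by (cases z) auto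
  then show ?thesis by (simp add: Psi_def Psi_fin_def)
next
  case True
  let ?L = "\<integral>\<^sup>+ s\<in>{0..}. ennreal (1 - df_pow F z s) \<partial>lborel"
  have ind: "(\<integral>\<^sup>+ s\<in>{0..}. ennreal (1 - df_pow F y s) \<partial>lborel)
      = (\<integral>\<^sup>+ s. ennreal (1 - expneg (y * (neglog (F s) * indicator {0..} s))) \<partial>lborel)" for y
    by (intro nn_integral_cong) (auto simp: indicator_def df_pow_def)
  have mono: "Psi_fin F x \<le> Psi_fin F y" if "x \<le> y" for x y
    unfolding Psi_fin_def df_pow_def using that
    by (intro nn_integral_mono mult_right_mono ennreal_leI diff_left_mono expneg_antimono) auto
  have le: "Psi_fin F x \<le> ?L" for x
    unfolding Psi_fin_def df_pow_def True
    by (intro nn_integral_mono mult_right_mono ennreal_leI diff_left_mono expneg_antimono) auto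
  have SUP: "?L = (SUP n. Psi_fin F (real n))"
  proof -
    have "z = (SUP n. ennreal (real n))"
      unfolding True ennreal_of_nat_eq_real_of_nat [symmetric]
      by (simp add: ennreal_SUP_of_nat_eq_top)
    then have "z * (neglog (F s) * indicator {0..} s)
        = (SUP n. ennreal (real n) * (neglog (F s) * indicator {0..} s))" for s
      by (simp only: SUP_mult_right_ennreal)
    then show ?thesis unfolding Psi_fin_def ind
      by (simp only:) (rule nn_integral_expneg_SUP, auto simp: incseq_def intro!: mult_right_mono ennreal_leI)
  qed
  have "(Psi_fin F \<longlongrightarrow> ?L) at_top"
  proof (rule order_tendstoI)
    fix a assume "a < ?L"
    then obtain n where "a < Psi_fin F (real n)" unfolding SUP less_SUP_iff by blast
    then show "\<forall>\<^sub>F x in at_top. a < Psi_fin F x"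
      using mono by (intro eventually_mono[OF eventually_ge_at_top[of "real n"]]) (auto intro: less_le_trans)
  next
    fix a assume "?L < a"
    then show "\<forall>\<^sub>F x in at_top. Psi_fin F x < a"
      using le by (intro always_eventually) (auto intro: le_less_trans)
  qed
  then have "Lim at_top (Psi_fin F) = ?L" by (intro tendsto_Lim) auto
  then show ?thesis using True by (simp add: Psi_def)
qed

lemma borel_measurable_Psi [measurable]: "Psi F \<in> borel_measurable borel"
  unfolding Psi_eq[abs_def] by measurable

text \<open>If \<open>F < 1\<close> everywhere, then \<open>1 - F\<^sup>\<infinity> = 1\<close> has infinite integral. So a finite \<open>\<Psi>\<^sub>F(\<infinity>)\<close> makes \<open>F\<^sup>\<infinity>\<close> a
  distribution function.\<close>

lemma Psi_finite_top: "Psi F \<top> < \<top> \<Longrightarrow> \<exists>x. F x = 1"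
proof (rule ccontr)
  assume fin: "Psi F \<top> < \<top>" and "\<nexists>x. F x = 1"
  then have "df_pow F \<top> s = 0" for s by (simp add: df_pow_top)
  then have "Psi F \<top> = \<top>" unfolding Psi_eq by (simp add: emeasure_lborel_atLeast)
  then show False using fin by simp
qed

lemma prob_law_X_Psi: "z \<noteq> 0 \<Longrightarrow> Psi F z < \<top> \<Longrightarrow> prob_space (law_X F z)"
  using Psi_finite_top by (intro prob_law_X) auto

end

section \<open>Integrals with respect to the sampled law\<close>

text \<open>Overwriting one of several independent coordinates with law \<open>N\<close> by a draw from the density \<open>w\<close> amounts to weighting
  with \<open>w\<close> of that coordinate, because the overwritten value integrates out.\<close>

lemma nn_integral_resample_coordinate:
  fixes N :: "real measure"
  assumes N: "prob_space N" and sets [measurable_cong]: "sets N = sets borel" and I: "finite I" "D \<in> I"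
    and w [measurable]: "w \<in> borel_measurable borel"
    and g [measurable]: "g \<in> borel_measurable (Pi\<^sub>M I (\<lambda>_. borel))"
  shows "(\<integral>\<^sup>+ X. \<integral>\<^sup>+ m. g (X(D := m)) \<partial>density N w \<partial>Pi\<^sub>M I (\<lambda>_. N))
    = (\<integral>\<^sup>+ X. w (X D) * g X \<partial>Pi\<^sub>M I (\<lambda>_. N))"
proof -
  interpret prob_space N by (rule N)
  interpret product_sigma_finite "\<lambda>_. N" by standard
  define J where "J = I - {D}"
  have J: "finite J" "D \<notin> J" "I = insert D J" using I by (auto simp: J_def)
  have setsI: "sets (Pi\<^sub>M I (\<lambda>_. N)) = sets (Pi\<^sub>M I (\<lambda>_. borel))"
    by (intro sets_PiM_cong refl sets)
  have [measurable_cong]: "sets (Pi\<^sub>M (insert D J) (\<lambda>_. N)) = sets (Pi\<^sub>M I (\<lambda>_. borel))"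
    using setsI J(3) by simp
  have [measurable]: "(\<lambda>X. X D) \<in> Pi\<^sub>M I (\<lambda>_. borel) \<rightarrow>\<^sub>M borel" using I by measurable
  have upd: "(\<lambda>p. (fst p)(D := snd p)) \<in> Pi\<^sub>M I (\<lambda>_. borel) \<Otimes>\<^sub>M borel \<rightarrow>\<^sub>M Pi\<^sub>M I (\<lambda>_. borel :: real measure)"
    using measurable_fun_upd[where I = I and J = I and i = D and f = fst and h = snd
        and N = "Pi\<^sub>M I (\<lambda>_. borel) \<Otimes>\<^sub>M borel" and M = "\<lambda>_. borel :: real measure"] I
    by (auto simp: insert_absorb)
  have [measurable]: "(\<lambda>p. g ((fst p)(D := snd p))) \<in> borel_measurable (Pi\<^sub>M I (\<lambda>_. borel) \<Otimes>\<^sub>M borel)"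
    using measurable_compose[OF upd g] .
  have dens: "(\<integral>\<^sup>+ m. g (X(D := m)) \<partial>density N w) = (\<integral>\<^sup>+ m. w m * g (X(D := m)) \<partial>N)"
    if X: "X \<in> space (Pi\<^sub>M I (\<lambda>_. borel))" for X
  proof -
    have "(\<lambda>m. g (X(D := m))) \<in> borel_measurable borel"
      using measurable_compose[OF measurable_Pair1'[OF X] \<open>(\<lambda>p. g ((fst p)(D := snd p))) \<in> _\<close>] by simp
    then have "(\<lambda>m. g (X(D := m))) \<in> borel_measurable N" "w \<in> borel_measurable N"
      using w by (simp_all cong: measurable_cong_sets add: sets)
    then show ?thesis by (intro nn_integral_density)
  qed
  have space: "space (Pi\<^sub>M I (\<lambda>_. N)) = space (Pi\<^sub>M I (\<lambda>_. borel))"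
    by (rule sets_eq_imp_space_eq[OF setsI])
  have "(\<integral>\<^sup>+ X. \<integral>\<^sup>+ m. g (X(D := m)) \<partial>density N w \<partial>Pi\<^sub>M I (\<lambda>_. N))
      = (\<integral>\<^sup>+ X. \<integral>\<^sup>+ m. w m * g (X(D := m)) \<partial>N \<partial>Pi\<^sub>M (insert D J) (\<lambda>_. N))"
    unfolding J(3)[symmetric] by (intro nn_integral_cong dens) (simp add: space)
  also have "\<dots> = (\<integral>\<^sup>+ X. \<integral>\<^sup>+ y. \<integral>\<^sup>+ m. w m * g ((X(D := y))(D := m)) \<partial>N \<partial>N \<partial>Pi\<^sub>M J (\<lambda>_. N))"
    by (rule product_nn_integral_insert[OF J(1,2)]) measurable
  also have "\<dots> = (\<integral>\<^sup>+ X. \<integral>\<^sup>+ m. w m * g (X(D := m)) \<partial>N \<partial>Pi\<^sub>M J (\<lambda>_. N))"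
    by (simp add: emeasure_space_1)
  also have "\<dots> = (\<integral>\<^sup>+ X. \<integral>\<^sup>+ m. w ((X(D := m)) D) * g (X(D := m)) \<partial>N \<partial>Pi\<^sub>M J (\<lambda>_. N))"
    by simp
  also have "\<dots> = (\<integral>\<^sup>+ X. w (X D) * g X \<partial>Pi\<^sub>M (insert D J) (\<lambda>_. N))"
    by (rule product_nn_integral_insert[OF J(1,2), symmetric]) measurable
  finally show ?thesis unfolding J(3)[symmetric] .
qed

lemma measurable_sample_map [measurable]:
  "(\<lambda>p. normalize_sum d (mix d D (fst p) (snd p)))
    \<in> Pi\<^sub>M {1..d} (\<lambda>_. borel) \<Otimes>\<^sub>M borel \<rightarrow>\<^sub>M Pi\<^sub>M {1..d} (\<lambda>_. borel)"
  unfolding normalize_sum_def mix_def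
  by (rule measurable_restrict) (auto intro!: borel_measurable_divide borel_measurable_sum)

lemma measurable_normalize_sum [measurable]:
  "normalize_sum d \<in> Pi\<^sub>M {1..d} (\<lambda>_. borel) \<rightarrow>\<^sub>M Pi\<^sub>M {1..d} (\<lambda>_. borel)"
  unfolding normalize_sum_def
  by (rule measurable_restrict) (auto intro!: borel_measurable_divide borel_measurable_sum)

context nonneg_cdf
begin

text \<open>Tail formula for the mean of \<open>F\<^sup>z\<close>; it identifies the normalizing constant of \<open>law_M\<close>.\<close>

lemma mean_law_X:
  assumes "z \<noteq> 0" "Psi F z < \<top>"
  shows "(\<integral>\<^sup>+ x. ennreal x \<partial>law_X F z) = Psi F z"
proof -
  interpret X: prob_space "law_X F z" by (rule prob_law_X_Psi[OF assms])
  have "emeasure (law_X F z) {x. ennreal u < ennreal x} = ennreal (1 - df_pow F z u)" if "0 \<le> u" for u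
  proof -
    have "emeasure (law_X F z) {x. ennreal u < ennreal x} = emeasure (law_X F z) (space (law_X F z) - {..u})"
      using that by (intro arg_cong[where f = "emeasure _"]) (auto simp: ennreal_less_iff)
    also have "\<dots> = 1 - ennreal (df_pow F z u)"
      by (subst emeasure_compl) (auto simp: emeasure_law_X_atMost[OF assms(1)] X.emeasure_space_1[simplified])
    also have "\<dots> = ennreal (1 - df_pow F z u)"
      by (metis df_pow_bounds(1) ennreal_1 ennreal_minus)
    finally show ?thesis .
  qed
  then have "(\<integral>\<^sup>+ u\<in>{0..}. emeasure (law_X F z) {x. ennreal u < ennreal x} \<partial>lborel) = Psi F z"
    unfolding Psi_eq by (intro nn_integral_cong) (auto simp: indicator_def)
  then show ?thesis
    by (subst nn_integral_layer_cake) (auto simp: X.sigma_finite_measure_axioms)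
qed

text \<open>Tail formula for the mean of \<open>max\<^sub>k t\<^sub>k X\<^sub>k\<close>: by independence, the maximum is at most \<open>u\<close> with probability
  \<open>\<Prod>\<^sub>k F(u / t\<^sub>k)\<^sup>z\<close>.\<close>

lemma nn_integral_Max_law_X:
  assumes z: "z \<noteq> 0" "Psi F z < \<top>" and I: "finite I" "I \<noteq> {}" and t: "\<And>k. k \<in> I \<Longrightarrow> 0 \<le> t k"
  shows "(\<integral>\<^sup>+ X. ennreal (Max ((\<lambda>k. t k * X k) ` I)) \<partial>Pi\<^sub>M I (\<lambda>_. law_X F z))
    = (\<integral>\<^sup>+ s\<in>{0..}. ennreal (1 - (\<Prod>k\<in>I. expneg (z * neglog (F_over (t k) s)))) \<partial>lborel)"
proof -
  interpret X: prob_space "law_X F z" by (rule prob_law_X_Psi[OF z])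
  interpret product_sigma_finite "\<lambda>_. law_X F z" by standard
  let ?P = "Pi\<^sub>M I (\<lambda>_. law_X F z)"
  interpret P: prob_space ?P by (rule prob_space_PiM) (rule X.prob_space_axioms)
  have space: "space ?P = Pi\<^sub>E I (\<lambda>_. UNIV)" by (simp add: space_PiM)
  have coord: "emeasure (law_X F z) {x. t k * x \<le> u} = ennreal (expneg (z * neglog (F_over (t k) u)))"
    if "k \<in> I" "0 \<le> u" for k u
  proof (cases "t k = 0")
    case True
    then show ?thesis using that X.emeasure_space_1 by (simp add: F_over_def)
  next
    case False
    then have "0 < t k" using t[OF that(1)] by simp
    then have "{x. t k * x \<le> u} = {..u / t k}" by (auto simp: field_simps)
    then show ?thesis using False by (simp add: emeasure_law_X_atMost[OF z(1)] df_pow_def F_over_def)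
  qed
  have [measurable]: "(\<lambda>X. Max ((\<lambda>k. t k * X k) ` I)) \<in> borel_measurable ?P"
    by (rule borel_measurable_Max[OF I(1), simplified]) measurable
  have tail: "emeasure ?P {X\<in>space ?P. ennreal u < ennreal (Max ((\<lambda>k. t k * X k) ` I))}
      = ennreal (1 - (\<Prod>k\<in>I. expneg (z * neglog (F_over (t k) u))))" if u: "0 \<le> u" for u
  proof -
    let ?B = "Pi\<^sub>E I (\<lambda>k. {x. t k * x \<le> u})"
    have B: "?B \<in> sets ?P" using I by (intro sets_PiM_I_finite) auto
    have "{X\<in>space ?P. ennreal u < ennreal (Max ((\<lambda>k. t k * X k) ` I))} = space ?P - ?B"
      using I u by (auto simp: space ennreal_less_iff Max_gr_iff PiE_def extensional_def Pi_iff not_le[symmetric])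
    then have "emeasure ?P {X\<in>space ?P. ennreal u < ennreal (Max ((\<lambda>k. t k * X k) ` I))} = 1 - emeasure ?P ?B"
      using B by (simp add: emeasure_compl P.emeasure_space_1)
    also have "emeasure ?P ?B = (\<Prod>k\<in>I. ennreal (expneg (z * neglog (F_over (t k) u))))"
      using u by (subst emeasure_PiM[OF I(1)]) (auto intro!: prod.cong coord)
    also have "\<dots> = ennreal (\<Prod>k\<in>I. expneg (z * neglog (F_over (t k) u)))"
      by (rule prod_ennreal) simp
    also have "1 - \<dots> = ennreal (1 - (\<Prod>k\<in>I. expneg (z * neglog (F_over (t k) u))))"
      by (metis ennreal_1 ennreal_minus expneg_nonneg prod_nonneg)
    finally show ?thesis .
  qed
  show ?thesis
    by (subst nn_integral_layer_cake)
      (auto simp: P.sigma_finite_measure_axioms tail indicator_def intro!: nn_integral_cong)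
qed

lemma sets_law_M [simp, measurable_cong]: "sets (law_M F z) = sets borel"
  by (simp add: law_M_def)

lemma law_M_kernel [measurable]: "law_M F \<in> borel \<rightarrow>\<^sub>M subprob_algebra borel"
proof (rule measurable_subprob_algebra)
  fix z :: ennreal
  show "subprob_space (law_M F z)"
  proof
    have "emeasure (law_M F z) (space (law_M F z)) = (\<integral>\<^sup>+ x. ennreal x / Psi F z \<partial>law_X F z)"
      by (simp add: law_M_def emeasure_density)
    also have "\<dots> = (\<integral>\<^sup>+ x. ennreal x \<partial>law_X F z) / Psi F z"
      by (rule nn_integral_divide) simp
    also have "\<dots> \<le> 1"
    proof (cases "z = 0 \<or> Psi F z = \<top>")
      case True
      then show ?thesis
      proof
        assume "z = 0"
        have "UNIV \<in> null_sets (law_X F 0)" by (intro null_setsI law_X_0) simp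
        then have "AE x in law_X F 0. ennreal x = 0"
          by (rule AE_I'[where N = UNIV]) simp
        then have "(\<integral>\<^sup>+ x. ennreal x \<partial>law_X F 0) = 0"
          by (subst nn_integral_0_iff_AE) auto
        then show ?thesis using \<open>z = 0\<close> by simp
      next
        assume "Psi F z = \<top>"
        then show ?thesis by simp
      qed
    next
      case False
      then show ?thesis
        by (cases "Psi F z = 0") (auto simp: mean_law_X less_top ennreal_divide_self)
    qed
    finally show "emeasure (law_M F z) (space (law_M F z)) \<le> 1" .
  qed (simp add: law_M_def)
next
  fix A :: "real set" assume [measurable]: "A \<in> sets borel"
  have "(\<lambda>z. \<integral>\<^sup>+ x. ennreal x / Psi F z * indicator A x \<partial>law_X F z) \<in> borel_measurable borel"
    by (rule nn_integral_measurable_subprob_algebra2[OF _ law_X_kernel]) measurable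
  then show "(\<lambda>z. emeasure (law_M F z) A) \<in> borel_measurable borel"
    by (simp add: law_M_def emeasure_density)
qed simp

lemma resample_kernel:
  "(\<lambda>z. Pi\<^sub>M {1..d} (\<lambda>_. law_X F z) \<bind> (\<lambda>X. law_M F z \<bind> (\<lambda>m.
      return (Pi\<^sub>M {1..d} (\<lambda>_. borel)) (normalize_sum d (mix d D X m)))))
    \<in> borel \<rightarrow>\<^sub>M subprob_algebra (Pi\<^sub>M {1..d} (\<lambda>_. borel))"
proof (rule measurable_bind[OF measurable_PiM_iid_kernel[OF law_X_kernel]])
  show "(\<lambda>x. law_M F (fst x) \<bind> (\<lambda>m. return (Pi\<^sub>M {1..d} (\<lambda>_. borel)) (normalize_sum d (mix d D (snd x) m))))
      \<in> borel \<Otimes>\<^sub>M Pi\<^sub>M {1..d} (\<lambda>_. borel) \<rightarrow>\<^sub>M subprob_algebra (Pi\<^sub>M {1..d} (\<lambda>_. borel))"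
  proof (rule measurable_bind[OF measurable_compose[OF measurable_fst law_M_kernel]])
    have "(\<lambda>x. (snd (fst x), snd x))
        \<in> (borel \<Otimes>\<^sub>M Pi\<^sub>M {1..d} (\<lambda>_. borel)) \<Otimes>\<^sub>M borel \<rightarrow>\<^sub>M Pi\<^sub>M {1..d} (\<lambda>_. borel) \<Otimes>\<^sub>M borel"
      by measurable
    from measurable_compose[OF measurable_compose[OF this measurable_sample_map] return_measurable]
    show "(\<lambda>x. return (Pi\<^sub>M {1..d} (\<lambda>_. borel)) (normalize_sum d (mix d D (snd (fst x)) (snd x))))
        \<in> (borel \<Otimes>\<^sub>M Pi\<^sub>M {1..d} (\<lambda>_. borel)) \<Otimes>\<^sub>M borel \<rightarrow>\<^sub>M subprob_algebra (Pi\<^sub>M {1..d} (\<lambda>_. borel))"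
      by simp
  qed
qed simp

end

locale normalized_levy = nonneg_cdf +
  fixes \<nu> :: "ennreal measure"
  assumes sets_\<nu> [simp, measurable_cong]: "sets \<nu> = sets borel"
    and \<nu>_0: "emeasure \<nu> {0} = 0"
    and normalized: "(\<integral>\<^sup>+ z. Psi F z \<partial>\<nu>) = 1"
begin

lemma AE_Psi_finite: "AE z in \<nu>. z \<noteq> 0 \<and> Psi F z < \<top>"
proof -
  have "AE z in \<nu>. z \<notin> {0}" using \<nu>_0 by (intro AE_not_in null_setsI) auto
  moreover have "AE z in \<nu>. Psi F z \<noteq> \<infinity>"
    by (rule nn_integral_PInf_AE) (simp_all add: normalized)
  ultimately show ?thesis by eventually_elim (auto simp: less_top)
qed

end

text \<open>The simplifier is to keep the index set in the form \<open>{1..d}\<close>, which the measurability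
  rules for product spaces have to match.\<close>

declare One_nat_def [simp del]

context normalized_levy
begin

text \<open>The factor \<open>\<Psi>\<^sub>F(z)\<close> from the law of \<open>Z\<close> cancels the normalizing constant of \<open>law_M\<close>. Should it vanish, then
  \<open>F\<^sup>z\<close> has mean zero, so the coordinate is almost surely \<open>0\<close> and both sides agree.\<close>

lemma nn_integral_resample:
  assumes z: "z \<noteq> 0" "Psi F z < \<top>" and D: "D \<in> {1..d}"
    and f [measurable]: "f \<in> borel_measurable (Pi\<^sub>M {1..d} (\<lambda>_. borel))"
  shows "Psi F z * (\<integral>\<^sup>+ X. \<integral>\<^sup>+ m. f (normalize_sum d (mix d D X m)) \<partial>law_M F z \<partial>Pi\<^sub>M {1..d} (\<lambda>_. law_X F z))
    = (\<integral>\<^sup>+ X. ennreal (X D) * f (normalize_sum d X) \<partial>Pi\<^sub>M {1..d} (\<lambda>_. law_X F z))"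
proof -
  interpret X: prob_space "law_X F z" by (rule prob_law_X_Psi[OF z])
  let ?P = "Pi\<^sub>M {1..d} (\<lambda>_. law_X F z)"
  have setsP [measurable_cong]: "sets ?P = sets (Pi\<^sub>M {1..d} (\<lambda>_. borel))"
    by (rule sets_PiM_cong) auto
  have mix: "mix d D X m = X(D := m)" if "X \<in> space ?P" for X m
    using that D by (auto simp: mix_def space_PiM PiE_iff extensional_def fun_eq_iff)
  have "(\<integral>\<^sup>+ X. \<integral>\<^sup>+ m. f (normalize_sum d (mix d D X m)) \<partial>law_M F z \<partial>?P)
      = (\<integral>\<^sup>+ X. \<integral>\<^sup>+ m. f (normalize_sum d (X(D := m))) \<partial>density (law_X F z) (\<lambda>x. ennreal x / Psi F z) \<partial>?P)"
    unfolding law_M_def by (intro nn_integral_cong) (simp add: mix)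
  also have "\<dots> = (\<integral>\<^sup>+ X. ennreal (X D) / Psi F z * f (normalize_sum d X) \<partial>?P)"
    by (rule nn_integral_resample_coordinate[OF X.prob_space_axioms sets_law_X finite_atLeastAtMost D]) measurable
  finally have E: "(\<integral>\<^sup>+ X. \<integral>\<^sup>+ m. f (normalize_sum d (mix d D X m)) \<partial>law_M F z \<partial>?P)
      = (\<integral>\<^sup>+ X. ennreal (X D) / Psi F z * f (normalize_sum d X) \<partial>?P)" .
  have [measurable]: "(\<lambda>X. X D) \<in> borel_measurable ?P"
    using D by measurable
  have "Psi F z * (\<integral>\<^sup>+ X. \<integral>\<^sup>+ m. f (normalize_sum d (mix d D X m)) \<partial>law_M F z \<partial>?P)
      = (\<integral>\<^sup>+ X. Psi F z * (ennreal (X D) / Psi F z * f (normalize_sum d X)) \<partial>?P)"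
    unfolding E by (rule nn_integral_cmult[symmetric]) measurable
  also have "\<dots> = (\<integral>\<^sup>+ X. ennreal (X D) * f (normalize_sum d X) \<partial>?P)"
  proof (rule nn_integral_cong_AE)
    have "AE x in law_X F z. Psi F z * (ennreal x / Psi F z) = ennreal x"
    proof (cases "Psi F z = 0")
      case True
      then have "(\<integral>\<^sup>+ x. ennreal x \<partial>law_X F z) = 0"
        using mean_law_X[OF z] by simp
      then have "AE x in law_X F z. ennreal x = 0"
        by (subst (asm) nn_integral_0_iff_AE) (simp_all cong: measurable_cong_sets)
      then show ?thesis by eventually_elim simp
    next
      case False
      then show ?thesis using z
        by (intro AE_I2) (simp add: ennreal_times_divide mult_divide_eq_ennreal mult.commute less_top)
    qed
    then have "AE X in ?P. Psi F z * (ennreal (X D) / Psi F z) = ennreal (X D)"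
      by (intro AE_PiM_component[where M = "\<lambda>_. law_X F z"] X.prob_space_axioms D)
    then show "AE X in ?P. Psi F z * (ennreal (X D) / Psi F z * f (normalize_sum d X))
        = ennreal (X D) * f (normalize_sum d X)"
      by eventually_elim (simp add: mult.assoc[symmetric])
  qed
  finally show ?thesis .
qed

context
  fixes d :: nat assumes d: "1 \<le> d"
begin

lemma prob_density_\<nu>: "prob_space (density \<nu> (Psi F))"
proof (rule prob_spaceI)
  have "space \<nu> = UNIV" using sets_eq_imp_space_eq[OF sets_\<nu>] by simp
  then show "emeasure (density \<nu> (Psi F)) (space (density \<nu> (Psi F))) = 1"
    by (simp add: emeasure_density normalized)
qed

lemma resample_in_subprob:
  "(\<lambda>D. density \<nu> (Psi F) \<bind> (\<lambda>z. Pi\<^sub>M {1..d} (\<lambda>_. law_X F z) \<bind> (\<lambda>X. law_M F z \<bind> (\<lambda>m.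
      return (Pi\<^sub>M {1..d} (\<lambda>_. borel)) (normalize_sum d (mix d D X m))))))
    \<in> uniform_count_measure {1..d} \<rightarrow>\<^sub>M subprob_algebra (Pi\<^sub>M {1..d} (\<lambda>_. borel))"
proof -
  interpret Z: prob_space "density \<nu> (Psi F)" by (rule prob_density_\<nu>)
  let ?K = "\<lambda>D z. Pi\<^sub>M {1..d} (\<lambda>_. law_X F z) \<bind> (\<lambda>X. law_M F z \<bind> (\<lambda>m.
      return (Pi\<^sub>M {1..d} (\<lambda>_. borel)) (normalize_sum d (mix d D X m))))"
  have K: "?K D \<in> density \<nu> (Psi F) \<rightarrow>\<^sub>M subprob_algebra (Pi\<^sub>M {1..d} (\<lambda>_. borel))" for D
    using resample_kernel[of d D] by (simp cong: measurable_cong_sets)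
  have "density \<nu> (Psi F) \<bind> ?K D \<in> space (subprob_algebra (Pi\<^sub>M {1..d} (\<lambda>_. borel)))" for D
    using subprob_space_bind[OF prob_space_imp_subprob_space[OF Z.prob_space_axioms] K]
      sets_bind_measurable[OF K Z.not_empty]
    by (simp only: space_subprob_algebra mem_Collect_eq simp_thms)
  then show ?thesis
    by (simp add: measurable_def sets_uniform_count_measure space_uniform_count_measure)
qed

lemma sets_sample_law: "sets (sample_law F \<nu> d) = sets (Pi\<^sub>M {1..d} (\<lambda>_. borel))"
  unfolding sample_law_def
  by (rule sets_bind_measurable[OF resample_in_subprob])
    (use d in \<open>simp add: space_uniform_count_measure\<close>)

text \<open>Averaging \<open>nn_integral_resample\<close> over the uniform index \<open>D\<close> turns the weight \<open>X\<^sub>D\<close> into the mean of the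
  coordinates: the sampled law is the law of the normalized vector \<open>X\<close>, size-biased by its sum.\<close>

lemma nn_integral_sample_law:
  assumes f [measurable]: "f \<in> borel_measurable (Pi\<^sub>M {1..d} (\<lambda>_. borel))"
  shows "(\<integral>\<^sup>+ q. f q \<partial>sample_law F \<nu> d) = ennreal (1 / d)
    * (\<integral>\<^sup>+ z. \<integral>\<^sup>+ X. (\<Sum>k\<in>{1..d}. ennreal (X k)) * f (normalize_sum d X) \<partial>Pi\<^sub>M {1..d} (\<lambda>_. law_X F z) \<partial>\<nu>)"
proof -
  let ?N = "Pi\<^sub>M {1..d} (\<lambda>_. borel :: real measure)"
  let ?P = "\<lambda>z. Pi\<^sub>M {1..d} (\<lambda>_. law_X F z)"
  have setsP [measurable_cong]: "sets (?P z) = sets ?N" for z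
    by (rule sets_PiM_cong) auto
  have kernel: "(\<lambda>m. return ?N (normalize_sum d (mix d D X m))) \<in> law_M F z \<rightarrow>\<^sub>M subprob_algebra ?N"
    if X: "X \<in> space ?N" for D X z
  proof -
    have "(\<lambda>m. normalize_sum d (mix d D X m)) \<in> borel \<rightarrow>\<^sub>M ?N"
      using measurable_compose[OF measurable_Pair1'[OF X] measurable_sample_map] by simp
    from measurable_compose[OF this return_measurable] show ?thesis
      by (simp cong: measurable_cong_sets)
  qed
  have kernel2: "(\<lambda>X. law_M F z \<bind> (\<lambda>m. return ?N (normalize_sum d (mix d D X m))))
      \<in> ?P z \<rightarrow>\<^sub>M subprob_algebra ?N" for D z
  proof -
    have "law_M F z \<in> space (subprob_algebra borel)"
      using measurable_space[OF law_M_kernel] by simp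
    then have "(\<lambda>X. law_M F z \<bind> (\<lambda>m. return ?N (normalize_sum d (mix d D X m)))) \<in> ?N \<rightarrow>\<^sub>M subprob_algebra ?N"
      by (intro measurable_bind[where N = borel] measurable_const
          measurable_compose[OF measurable_sample_map return_measurable])
    then show ?thesis by (simp cong: measurable_cong_sets)
  qed
  have inner: "(\<integral>\<^sup>+ q. f q \<partial>(?P z \<bind> (\<lambda>X. law_M F z \<bind> (\<lambda>m. return ?N (normalize_sum d (mix d D X m))))))
      = (\<integral>\<^sup>+ X. \<integral>\<^sup>+ m. f (normalize_sum d (mix d D X m)) \<partial>law_M F z \<partial>?P z)" for D z
  proof -
    have "(\<integral>\<^sup>+ q. f q \<partial>(law_M F z \<bind> (\<lambda>m. return ?N (normalize_sum d (mix d D X m)))))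
        = (\<integral>\<^sup>+ m. f (normalize_sum d (mix d D X m)) \<partial>law_M F z)" if X: "X \<in> space (?P z)" for X
    proof -
      have X': "X \<in> space ?N" using X by (simp add: space_PiM)
      have "normalize_sum d (mix d D X m) \<in> space ?N" for m
        by (simp add: normalize_sum_def space_PiM)
      then show ?thesis
        by (simp add: nn_integral_bind[OF f kernel[OF X']] nn_integral_return)
    qed
    then show ?thesis
      by (subst nn_integral_bind[OF f kernel2]) (rule nn_integral_cong)
  qed
  have meas: "(\<lambda>z. \<integral>\<^sup>+ X. \<integral>\<^sup>+ m. f (normalize_sum d (mix d D X m)) \<partial>law_M F z \<partial>?P z) \<in> borel_measurable \<nu>" for D
    unfolding inner[symmetric]
    using nn_integral_measurable_subprob_algebra[OF f, THEN measurable_compose[OF resample_kernel]]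
    by (simp cong: measurable_cong_sets)
  have meas2: "(\<lambda>z. \<integral>\<^sup>+ X. ennreal (X k) * f (normalize_sum d X) \<partial>?P z) \<in> borel_measurable \<nu>"
    if k: "k \<in> {1..d}" for k
  proof -
    have [measurable]: "(\<lambda>X. X k) \<in> borel_measurable ?N" using k by measurable
    have "(\<lambda>X. ennreal (X k) * f (normalize_sum d X)) \<in> borel_measurable ?N" by measurable
    from measurable_compose[OF measurable_PiM_iid_kernel[OF law_X_kernel] nn_integral_measurable_subprob_algebra[OF this]]
    show ?thesis by (simp cong: measurable_cong_sets)
  qed
  have draw_Z: "(\<integral>\<^sup>+ z. \<integral>\<^sup>+ X. \<integral>\<^sup>+ m. f (normalize_sum d (mix d D X m)) \<partial>law_M F z \<partial>?P z \<partial>density \<nu> (Psi F))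
      = (\<integral>\<^sup>+ z. \<integral>\<^sup>+ X. ennreal (X D) * f (normalize_sum d X) \<partial>?P z \<partial>\<nu>)" if D: "D \<in> {1..d}" for D
  proof -
    have "(\<integral>\<^sup>+ z. \<integral>\<^sup>+ X. \<integral>\<^sup>+ m. f (normalize_sum d (mix d D X m)) \<partial>law_M F z \<partial>?P z \<partial>density \<nu> (Psi F))
        = (\<integral>\<^sup>+ z. Psi F z * (\<integral>\<^sup>+ X. \<integral>\<^sup>+ m. f (normalize_sum d (mix d D X m)) \<partial>law_M F z \<partial>?P z) \<partial>\<nu>)"
      by (rule nn_integral_density[OF _ meas]) measurable
    also have "\<dots> = (\<integral>\<^sup>+ z. \<integral>\<^sup>+ X. ennreal (X D) * f (normalize_sum d X) \<partial>?P z \<partial>\<nu>)"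
      using AE_Psi_finite
      by (intro nn_integral_cong_AE, eventually_elim) (auto intro!: nn_integral_resample[OF _ _ D f])
    finally show ?thesis .
  qed
  have "(\<integral>\<^sup>+ q. f q \<partial>sample_law F \<nu> d)
      = (\<integral>\<^sup>+ D. \<integral>\<^sup>+ z. \<integral>\<^sup>+ X. \<integral>\<^sup>+ m. f (normalize_sum d (mix d D X m)) \<partial>law_M F z \<partial>?P z \<partial>density \<nu> (Psi F)
          \<partial>uniform_count_measure {1..d})"
    unfolding sample_law_def
  proof (subst nn_integral_bind[OF f resample_in_subprob], intro nn_integral_cong)
    fix D
    have "(\<lambda>z. ?P z \<bind> (\<lambda>X. law_M F z \<bind> (\<lambda>m. return ?N (normalize_sum d (mix d D X m)))))
        \<in> density \<nu> (Psi F) \<rightarrow>\<^sub>M subprob_algebra ?N"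
      using resample_kernel[of d D] by (simp cong: measurable_cong_sets)
    then show "(\<integral>\<^sup>+ q. f q \<partial>(density \<nu> (Psi F) \<bind> (\<lambda>z. ?P z \<bind> (\<lambda>X. law_M F z \<bind> (\<lambda>m.
          return ?N (normalize_sum d (mix d D X m)))))))
        = (\<integral>\<^sup>+ z. \<integral>\<^sup>+ X. \<integral>\<^sup>+ m. f (normalize_sum d (mix d D X m)) \<partial>law_M F z \<partial>?P z \<partial>density \<nu> (Psi F))"
      by (simp add: nn_integral_bind[OF f] inner)
  qed
  also have "\<dots> = (\<Sum>D\<in>{1..d}. ennreal (1 / d) * (\<integral>\<^sup>+ z. \<integral>\<^sup>+ X. ennreal (X D) * f (normalize_sum d X) \<partial>?P z \<partial>\<nu>))"
    by (simp add: uniform_count_measure_def nn_integral_point_measure_finite draw_Z)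
  also have "\<dots> = ennreal (1 / d) * (\<integral>\<^sup>+ z. \<integral>\<^sup>+ X. (\<Sum>k\<in>{1..d}. ennreal (X k)) * f (normalize_sum d X) \<partial>?P z \<partial>\<nu>)"
    unfolding sum_distrib_left[symmetric] sum_distrib_right
    by (subst nn_integral_sum[symmetric], rule meas2, simp,
        intro arg_cong2[where f = "(*)"] refl nn_integral_cong nn_integral_sum[symmetric]) measurable
  finally show ?thesis .
qed

end

end

section \<open>The sampled law as a Pickands law\<close>

lemma sum_times_normalized:
  fixes X :: "nat \<Rightarrow> real"
  assumes X: "\<And>k. k \<in> {1..d} \<Longrightarrow> 0 \<le> X k" and k: "k \<in> {1..d}"
  shows "(\<Sum>j\<in>{1..d}. X j) * normalize_sum d X k = X k"
proof (cases "(\<Sum>j\<in>{1..d}. X j) = 0")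
  case True
  then have "X k = 0" using X k by (subst (asm) sum_nonneg_eq_0_iff) auto
  then show ?thesis using True by simp
next
  case False
  then show ?thesis using k by (simp add: normalize_sum_def)
qed

lemma normalize_sum_in_simplex:
  assumes X: "\<And>k. k \<in> {1..d} \<Longrightarrow> 0 \<le> X k" and pos: "(\<Sum>j\<in>{1..d}. X j) \<noteq> 0"
  shows "normalize_sum d X \<in> simplex_pts d"
proof -
  have "0 \<le> (\<Sum>j\<in>{1..d}. X j)" by (rule sum_nonneg) (rule X)
  then have "0 < (\<Sum>j\<in>{1..d}. X j)" using pos by simp
  moreover have "X k \<le> (\<Sum>j\<in>{1..d}. X j)" if "k \<in> {1..d}" for k
    using X that by (intro member_le_sum) auto
  moreover have "(\<Sum>k\<in>{1..d}. normalize_sum d X k) = 1"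
    using pos by (simp add: normalize_sum_def sum_divide_distrib[symmetric])
  ultimately show ?thesis
    using X by (auto simp: simplex_pts_def normalize_sum_def)
qed

lemma simplex_ptsD:
  assumes "q \<in> simplex_pts d"
  shows "k \<in> {1..d} \<Longrightarrow> 0 \<le> q k" "k \<in> {1..d} \<Longrightarrow> q k \<le> 1" "(\<Sum>k\<in>{1..d}. q k) = 1"
  using assms by (auto simp: simplex_pts_def PiE_iff)

lemma measurable_Max_coordinates [measurable]:
  fixes d :: nat
  shows "(\<lambda>q. Max ((\<lambda>k. t k * q k) ` {1..d})) \<in> borel_measurable (Pi\<^sub>M {1..d} (\<lambda>_. borel :: real measure))"
  by (rule borel_measurable_Max) auto

lemma simplex_pts_sets: "simplex_pts d \<in> sets (Pi\<^sub>M {1..d} (\<lambda>_. borel))"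
proof -
  have "simplex_pts d = {q\<in>space (Pi\<^sub>M {1..d} (\<lambda>_. borel)). (\<forall>k\<in>{1..d}. 0 \<le> q k \<and> q k \<le> 1) \<and> (\<Sum>k\<in>{1..d}. q k) = 1}"
    by (auto simp: simplex_pts_def space_PiM PiE_iff)
  also have "\<dots> \<in> sets (Pi\<^sub>M {1..d} (\<lambda>_. borel))" by measurable
  finally show ?thesis .
qed

lemma Max_simplex_bounds:
  assumes "q \<in> simplex_pts d" "1 \<le> d" "\<And>k. k \<in> {1..d} \<Longrightarrow> 0 \<le> t k"
  shows "0 \<le> Max ((\<lambda>k. t k * q k) ` {1..d})" "Max ((\<lambda>k. t k * q k) ` {1..d}) \<le> (\<Sum>k\<in>{1..d}. t k)"
proof -
  have "0 \<le> t 1 * q 1" using assms simplex_ptsD[OF assms(1)] by (intro mult_nonneg_nonneg) auto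
  also have "\<dots> \<le> Max ((\<lambda>k. t k * q k) ` {1..d})" using assms(2) by (intro Max_ge) auto
  finally show "0 \<le> Max ((\<lambda>k. t k * q k) ` {1..d})" .
  have "t k * q k \<le> (\<Sum>k\<in>{1..d}. t k)" if k: "k \<in> {1..d}" for k
  proof -
    have "t k * q k \<le> t k" using simplex_ptsD[OF assms(1)] assms(3) k by (intro mult_left_le) auto
    also have "\<dots> \<le> (\<Sum>k\<in>{1..d}. t k)" using assms(3) k by (intro member_le_sum) auto
    finally show ?thesis .
  qed
  then show "Max ((\<lambda>k. t k * q k) ` {1..d}) \<le> (\<Sum>k\<in>{1..d}. t k)"
    using assms(2) by (intro Max.boundedI) auto
qed

text \<open>On the simplex, \<open>max\<^sub>k t\<^sub>k q\<^sub>k\<close> is bounded by \<open>\<Sum>\<^sub>k t\<^sub>k\<close>.\<close>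

lemma integrable_Max_simplex:
  assumes "prob_space \<mu>" and [measurable_cong]: "sets \<mu> = sets (Pi\<^sub>M {1..d} (\<lambda>_. borel))"
    and "AE q in \<mu>. q \<in> simplex_pts d" and [simp]: "1 \<le> d" and t: "\<And>k. k \<in> {1..d} \<Longrightarrow> 0 \<le> t k"
  shows "integrable \<mu> (\<lambda>q. Max ((\<lambda>k. t k * q k) ` {1..d}))"
proof -
  interpret prob_space \<mu> by fact
  show ?thesis
  proof (rule integrable_const_bound[where B = "\<Sum>k\<in>{1..d}. t k"])
    show "AE q in \<mu>. norm (Max ((\<lambda>k. t k * q k) ` {1..d})) \<le> (\<Sum>k\<in>{1..d}. t k)"
      using assms(3)
    proof eventually_elim
      case (elim q)
      have "0 \<le> Max ((\<lambda>k. t k * q k) ` {1..d})" "Max ((\<lambda>k. t k * q k) ` {1..d}) \<le> (\<Sum>k\<in>{1..d}. t k)"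
        by (rule Max_simplex_bounds[OF elim assms(4) t]; assumption)+
      then show ?case by (simp only: real_norm_def abs_of_nonneg)
    qed
    show "(\<lambda>q. Max ((\<lambda>k. t k * q k) ` {1..d})) \<in> borel_measurable \<mu>" by measurable
  qed
qed

context normalized_levy
begin

context
  fixes d :: nat assumes d: "1 \<le> d"
begin

lemma mean_coordinate:
  assumes "z \<noteq> 0" "Psi F z < \<top>" "k \<in> {1..d}"
  shows "(\<integral>\<^sup>+ X. ennreal (X k) \<partial>Pi\<^sub>M {1..d} (\<lambda>_. law_X F z)) = Psi F z"
proof -
  interpret X: prob_space "law_X F z" by (rule prob_law_X_Psi[OF assms(1,2)])
  have "(\<integral>\<^sup>+ X. ennreal (X k) \<partial>Pi\<^sub>M {1..d} (\<lambda>_. law_X F z))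
      = (\<integral>\<^sup>+ x. ennreal x \<partial>distr (Pi\<^sub>M {1..d} (\<lambda>_. law_X F z)) (law_X F z) (\<lambda>X. X k))"
    using assms(3) by (subst nn_integral_distr) (auto cong: measurable_cong_sets)
  also have "\<dots> = Psi F z"
    using distr_PiM_component[where M = "\<lambda>_. law_X F z" and I = "{1..d}" and i = k] assms
    by (simp add: X.prob_space_axioms mean_law_X)
  finally show ?thesis .
qed

lemma AE_law_X_vector_nonneg:
  assumes "z \<noteq> 0" "Psi F z < \<top>"
  shows "AE X in Pi\<^sub>M {1..d} (\<lambda>_. law_X F z). \<forall>k\<in>{1..d}. 0 \<le> X k"
proof (rule AE_finite_allI)
  fix k assume "k \<in> {1..d}"
  then show "AE X in Pi\<^sub>M {1..d} (\<lambda>_. law_X F z). 0 \<le> X k"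
    using prob_law_X_Psi[OF assms] AE_law_X_nonneg
    by (intro AE_PiM_component[where M = "\<lambda>_. law_X F z"])
qed simp

text \<open>The form in which \<open>nn_integral_sample_law\<close> is applied: for \<open>f\<close> homogeneous of degree \<open>1\<close>, the function \<open>g\<close> is
  \<open>f\<close> itself. With \<open>g = 0\<close> it shows that a set is null.\<close>

lemma nn_integral_sample_homogeneous:
  assumes f: "f \<in> borel_measurable (Pi\<^sub>M {1..d} (\<lambda>_. borel))"
    and hom: "\<And>X. (\<And>k. k \<in> {1..d} \<Longrightarrow> 0 \<le> X k)
      \<Longrightarrow> ennreal (\<Sum>k\<in>{1..d}. X k) * f (normalize_sum d X) = g X"
  shows "(\<integral>\<^sup>+ q. f q \<partial>sample_law F \<nu> d)
    = ennreal (1 / d) * (\<integral>\<^sup>+ z. \<integral>\<^sup>+ X. g X \<partial>Pi\<^sub>M {1..d} (\<lambda>_. law_X F z) \<partial>\<nu>)"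
proof -
  have "(\<integral>\<^sup>+ z. \<integral>\<^sup>+ X. (\<Sum>k\<in>{1..d}. ennreal (X k)) * f (normalize_sum d X) \<partial>Pi\<^sub>M {1..d} (\<lambda>_. law_X F z) \<partial>\<nu>)
      = (\<integral>\<^sup>+ z. \<integral>\<^sup>+ X. g X \<partial>Pi\<^sub>M {1..d} (\<lambda>_. law_X F z) \<partial>\<nu>)"
    using AE_Psi_finite
  proof (intro nn_integral_cong_AE, eventually_elim)
    case (elim z)
    then have z: "z \<noteq> 0" "Psi F z < \<top>" by auto
    show ?case
      using AE_law_X_vector_nonneg[OF z]
    proof (intro nn_integral_cong_AE, eventually_elim)
      case (elim X)
      then have "(\<Sum>k\<in>{1..d}. ennreal (X k)) = ennreal (\<Sum>k\<in>{1..d}. X k)" by (intro sum_ennreal) auto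
      then show ?case using hom[of X] elim by auto
    qed
  qed
  then show ?thesis by (simp add: nn_integral_sample_law[OF d f])
qed

lemma nn_integral_sample_coordinate:
  assumes k: "k \<in> {1..d}"
  shows "(\<integral>\<^sup>+ q. ennreal (q k) \<partial>sample_law F \<nu> d) = ennreal (1 / d)"
proof -
  have "(\<integral>\<^sup>+ q. ennreal (q k) \<partial>sample_law F \<nu> d)
      = ennreal (1 / d) * (\<integral>\<^sup>+ z. \<integral>\<^sup>+ X. ennreal (X k) \<partial>Pi\<^sub>M {1..d} (\<lambda>_. law_X F z) \<partial>\<nu>)"
  proof (rule nn_integral_sample_homogeneous)
    show "(\<lambda>q. ennreal (q k)) \<in> borel_measurable (Pi\<^sub>M {1..d} (\<lambda>_. borel))" using k by measurable
    fix X :: "nat \<Rightarrow> real" assume X: "\<And>k. k \<in> {1..d} \<Longrightarrow> 0 \<le> X k"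
    then have "ennreal (\<Sum>k\<in>{1..d}. X k) * ennreal (normalize_sum d X k)
        = ennreal ((\<Sum>k\<in>{1..d}. X k) * normalize_sum d X k)"
      by (intro ennreal_mult[symmetric] sum_nonneg)
        (use k in \<open>auto simp: normalize_sum_def intro!: divide_nonneg_nonneg sum_nonneg\<close>)
    then show "ennreal (\<Sum>k\<in>{1..d}. X k) * ennreal (normalize_sum d X k) = ennreal (X k)"
      by (simp only: sum_times_normalized[OF X k])
  qed
  also have "(\<integral>\<^sup>+ z. \<integral>\<^sup>+ X. ennreal (X k) \<partial>Pi\<^sub>M {1..d} (\<lambda>_. law_X F z) \<partial>\<nu>) = (\<integral>\<^sup>+ z. Psi F z \<partial>\<nu>)"
    using AE_Psi_finite by (intro nn_integral_cong_AE, eventually_elim) (auto intro: mean_coordinate k)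
  finally show ?thesis by (simp add: normalized)
qed

lemma nn_integral_sample_Max:
  assumes t: "\<And>k. k \<in> {1..d} \<Longrightarrow> 0 \<le> t k"
  shows "(\<integral>\<^sup>+ q. ennreal (Max ((\<lambda>k. t k * q k) ` {1..d})) \<partial>sample_law F \<nu> d)
    = ennreal (1 / d) * exponent \<nu> {1..d} t"
proof -
  have ne: "{1..d} \<noteq> {}" using d by simp
  have "(\<integral>\<^sup>+ q. ennreal (Max ((\<lambda>k. t k * q k) ` {1..d})) \<partial>sample_law F \<nu> d)
      = ennreal (1 / d) * (\<integral>\<^sup>+ z. \<integral>\<^sup>+ X. ennreal (Max ((\<lambda>k. t k * X k) ` {1..d}))
          \<partial>Pi\<^sub>M {1..d} (\<lambda>_. law_X F z) \<partial>\<nu>)"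
  proof (rule nn_integral_sample_homogeneous)
    show "(\<lambda>q. ennreal (Max ((\<lambda>k. t k * q k) ` {1..d}))) \<in> borel_measurable (Pi\<^sub>M {1..d} (\<lambda>_. borel))"
      by measurable
    fix X :: "nat \<Rightarrow> real" assume X: "\<And>k. k \<in> {1..d} \<Longrightarrow> 0 \<le> X k"
    let ?s = "\<Sum>k\<in>{1..d}. X k" and ?M = "Max ((\<lambda>k. t k * normalize_sum d X k) ` {1..d})"
    have s: "0 \<le> ?s" using X by (intro sum_nonneg) auto
    have nn: "0 \<le> normalize_sum d X k" if "k \<in> {1..d}" for k
      using X s that by (auto simp: normalize_sum_def)
    have "0 \<le> t 1 * normalize_sum d X 1" using t nn d by (intro mult_nonneg_nonneg) auto
    also have "\<dots> \<le> ?M" using d by (intro Max_ge) auto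
    finally have M: "0 \<le> ?M" .
    have "?s * ?M = Max ((*) ?s ` (\<lambda>k. t k * normalize_sum d X k) ` {1..d})"
      using s ne by (intro mono_Max_commute monoI mult_left_mono) auto
    also have "(*) ?s ` (\<lambda>k. t k * normalize_sum d X k) ` {1..d} = (\<lambda>k. t k * X k) ` {1..d}"
      unfolding image_image
      by (intro image_cong refl) (metis mult.left_commute sum_times_normalized X)
    finally show "ennreal ?s * ennreal ?M = ennreal (Max ((\<lambda>k. t k * X k) ` {1..d}))"
      using s M by (simp add: ennreal_mult[symmetric])
  qed
  also have "(\<integral>\<^sup>+ z. \<integral>\<^sup>+ X. ennreal (Max ((\<lambda>k. t k * X k) ` {1..d})) \<partial>Pi\<^sub>M {1..d} (\<lambda>_. law_X F z) \<partial>\<nu>)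
      = exponent \<nu> {1..d} t"
    unfolding exponent_def using AE_Psi_finite
    by (intro nn_integral_cong_AE, eventually_elim) (use ne t in \<open>auto intro!: nn_integral_Max_law_X\<close>)
  finally show ?thesis .
qed

lemma prob_sample_law: "prob_space (sample_law F \<nu> d)"
proof
  note [measurable_cong] = sets_sample_law[OF d]
  have "emeasure (sample_law F \<nu> d) (space (sample_law F \<nu> d)) = (\<integral>\<^sup>+ q. 1 \<partial>sample_law F \<nu> d)" by simp
  also have "\<dots> = ennreal (1 / d) * (\<integral>\<^sup>+ z. \<integral>\<^sup>+ X. (\<Sum>k\<in>{1..d}. ennreal (X k)) * 1
      \<partial>Pi\<^sub>M {1..d} (\<lambda>_. law_X F z) \<partial>\<nu>)"
    by (rule nn_integral_sample_law[OF d]) simp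
  also have "(\<integral>\<^sup>+ z. \<integral>\<^sup>+ X. (\<Sum>k\<in>{1..d}. ennreal (X k)) * 1 \<partial>Pi\<^sub>M {1..d} (\<lambda>_. law_X F z) \<partial>\<nu>)
      = (\<integral>\<^sup>+ z. of_nat d * Psi F z \<partial>\<nu>)"
    using AE_Psi_finite
  proof (intro nn_integral_cong_AE, eventually_elim)
    case (elim z)
    have "(\<integral>\<^sup>+ X. (\<Sum>k\<in>{1..d}. ennreal (X k)) \<partial>Pi\<^sub>M {1..d} (\<lambda>_. law_X F z))
        = (\<Sum>k\<in>{1..d}. \<integral>\<^sup>+ X. ennreal (X k) \<partial>Pi\<^sub>M {1..d} (\<lambda>_. law_X F z))"
      by (rule nn_integral_sum) measurable
    then show ?case using elim by (simp add: mean_coordinate)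
  qed
  also have "\<dots> = of_nat d" by (simp add: nn_integral_cmult normalized)
  finally show "emeasure (sample_law F \<nu> d) (space (sample_law F \<nu> d)) = 1"
    using d by (simp add: ennreal_of_nat_eq_real_of_nat ennreal_mult[symmetric])
qed

lemma AE_sample_law_simplex: "AE q in sample_law F \<nu> d. q \<in> simplex_pts d"
proof -
  have S [measurable]: "simplex_pts d \<in> sets (Pi\<^sub>M {1..d} (\<lambda>_. borel))" by (rule simplex_pts_sets)
  have "(\<integral>\<^sup>+ q. indicator (- simplex_pts d) q \<partial>sample_law F \<nu> d)
      = ennreal (1 / d) * (\<integral>\<^sup>+ z. \<integral>\<^sup>+ X. 0 \<partial>Pi\<^sub>M {1..d} (\<lambda>_. law_X F z) \<partial>\<nu>)"
  proof (rule nn_integral_sample_homogeneous)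
    show "(indicator (- simplex_pts d) :: _ \<Rightarrow> ennreal) \<in> borel_measurable (Pi\<^sub>M {1..d} (\<lambda>_. borel))"
    proof -
      have "(\<lambda>q. 1 - indicator (simplex_pts d) q :: ennreal) \<in> borel_measurable (Pi\<^sub>M {1..d} (\<lambda>_. borel))"
        by measurable
      also have "(\<lambda>q. 1 - indicator (simplex_pts d) q :: ennreal) = indicator (- simplex_pts d)"
        by (auto simp: indicator_def)
      finally show ?thesis .
    qed
    fix X :: "nat \<Rightarrow> real" assume "\<And>k. k \<in> {1..d} \<Longrightarrow> 0 \<le> X k"
    then show "ennreal (\<Sum>k\<in>{1..d}. X k) * indicator (- simplex_pts d) (normalize_sum d X) = 0"
      using normalize_sum_in_simplex[of d X] by (cases "(\<Sum>k\<in>{1..d}. X k) = 0") auto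
  qed
  then have 0: "(\<integral>\<^sup>+ q. indicator (- simplex_pts d) q \<partial>sample_law F \<nu> d) = 0" by simp
  note [measurable_cong] = sets_sample_law[OF d]
  have "{q \<in> space (sample_law F \<nu> d). q \<notin> simplex_pts d} \<in> sets (sample_law F \<nu> d)"
    by measurable
  moreover have "emeasure (sample_law F \<nu> d) {q \<in> space (sample_law F \<nu> d). q \<notin> simplex_pts d} = 0"
  proof -
    have "emeasure (sample_law F \<nu> d) {q \<in> space (sample_law F \<nu> d). q \<notin> simplex_pts d}
        = (\<integral>\<^sup>+ q. indicator {q \<in> space (sample_law F \<nu> d). q \<notin> simplex_pts d} q \<partial>sample_law F \<nu> d)"
      using calculation by simp
    also have "\<dots> = (\<integral>\<^sup>+ q. indicator (- simplex_pts d) q \<partial>sample_law F \<nu> d)"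
      by (intro nn_integral_cong) (auto simp: indicator_def)
    finally show ?thesis using 0 by simp
  qed
  ultimately show ?thesis by (simp add: AE_iff_measurable[OF _ refl])
qed

lemma pickands_sample_law:
  "pickands_law d (exponent \<nu> {1..d}) (sample_law F \<nu> d)"
  unfolding pickands_law_def
proof (intro conjI ballI allI impI)
  note [measurable_cong] = sets_sample_law[OF d]
  interpret Q: prob_space "sample_law F \<nu> d" by (rule prob_sample_law)
  show "prob_space (sample_law F \<nu> d)" "AE q in sample_law F \<nu> d. q \<in> simplex_pts d"
    "sets (sample_law F \<nu> d) = sets (Pi\<^sub>M {1..d} (\<lambda>_. borel))"
    by (rule prob_sample_law AE_sample_law_simplex sets_sample_law[OF d])+
  show "(\<integral>q. q k \<partial>sample_law F \<nu> d) = 1 / real d" if k: "k \<in> {1..d}" for k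
  proof (subst integral_eq_nn_integral)
    show "(\<lambda>q. q k) \<in> borel_measurable (sample_law F \<nu> d)" using k by measurable
    show "AE q in sample_law F \<nu> d. 0 \<le> q k"
      using AE_sample_law_simplex by eventually_elim (use simplex_ptsD k in auto)
  qed (simp add: nn_integral_sample_coordinate[OF k])
  show "exponent \<nu> {1..d} t = ennreal (real d * (\<integral>q. Max ((\<lambda>k. t k * q k) ` {1..d}) \<partial>sample_law F \<nu> d))"
    if "\<forall>k\<in>{1..d}. 0 \<le> t k" for t
  proof -
    have t: "\<And>k. k \<in> {1..d} \<Longrightarrow> 0 \<le> t k" using that by auto
    have "ennreal (\<integral>q. Max ((\<lambda>k. t k * q k) ` {1..d}) \<partial>sample_law F \<nu> d)
        = (\<integral>\<^sup>+ q. ennreal (Max ((\<lambda>k. t k * q k) ` {1..d})) \<partial>sample_law F \<nu> d)"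
    proof (rule nn_integral_eq_integral[symmetric])
      show "integrable (sample_law F \<nu> d) (\<lambda>q. Max ((\<lambda>k. t k * q k) ` {1..d}))"
        by (rule integrable_Max_simplex[OF prob_sample_law sets_sample_law[OF d] AE_sample_law_simplex d t])
      show "AE q in sample_law F \<nu> d. 0 \<le> Max ((\<lambda>k. t k * q k) ` {1..d})"
        using AE_sample_law_simplex by eventually_elim (rule Max_simplex_bounds[OF _ d t])
    qed
    moreover have M: "(\<integral>\<^sup>+ q. ennreal (Max ((\<lambda>k. t k * q k) ` {1..d})) \<partial>sample_law F \<nu> d)
        = ennreal (1 / d) * exponent \<nu> {1..d} t"
      by (rule nn_integral_sample_Max) (rule t)
    ultimately have "ennreal (real d * (\<integral>q. Max ((\<lambda>k. t k * q k) ` {1..d}) \<partial>sample_law F \<nu> d))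
        = ennreal (real d) * (ennreal (1 / d) * exponent \<nu> {1..d} t)"
      by (simp add: ennreal_mult' M)
    also have "\<dots> = exponent \<nu> {1..d} t"
      using d by (simp add: mult.assoc[symmetric] ennreal_mult[symmetric])
    finally show ?thesis ..
  qed
qed

end

end

section \<open>Uniqueness of the Pickands law\<close>

lemma sets_PiM_boxes:
  fixes I :: "'i set"
  assumes "finite I"
  shows "sets (Pi\<^sub>M I (\<lambda>_. borel :: real measure))
    = sigma_sets (Pi\<^sub>E I (\<lambda>_. UNIV)) (range (\<lambda>x. Pi\<^sub>E I (\<lambda>k. {..x k :: real})))"
proof -
  let ?E = "\<lambda>_::'i. range atMost :: real set set"
  have "sets (Pi\<^sub>M I (\<lambda>_. borel :: real measure)) = sets (Pi\<^sub>M I (\<lambda>i. sigma UNIV (?E i)))"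
    by (intro sets_PiM_cong refl) (simp add: borel_eq_atMost)
  also have "\<dots> = sets (sigma (Pi\<^sub>E I (\<lambda>_. UNIV))
      {{f\<in>(Pi\<^sub>E I (\<lambda>_. UNIV)). \<forall>i\<in>j. f i \<in> A i} | A j. j \<in> {I} \<and> A \<in> Pi j ?E})"
  proof (rule sets_PiM_sigma)
    fix i assume "i \<in> I"
    have "UNIV = \<Union> (range (\<lambda>n. {..real n}))" using real_arch_simple by auto
    then show "\<exists>S\<subseteq>?E i. countable S \<and> UNIV = \<Union> S"
      by (intro exI[of _ "range (\<lambda>n. {..real n})"]) auto
  qed (use assms in auto)
  also have "{{f\<in>(Pi\<^sub>E I (\<lambda>_. UNIV)). \<forall>i\<in>j. f i \<in> A i} | A j. j \<in> {I} \<and> A \<in> Pi j ?E}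
      = range (\<lambda>x. Pi\<^sub>E I (\<lambda>k. {..x k :: real}))"
  proof safe
    fix A assume A: "A \<in> Pi I ?E"
    then have "\<forall>i\<in>I. \<exists>x. A i = {..x}" by auto
    then obtain x where "\<forall>i\<in>I. A i = {..x i}" by metis
    then have "{f\<in>(Pi\<^sub>E I (\<lambda>_. UNIV)). \<forall>i\<in>I. f i \<in> A i} = Pi\<^sub>E I (\<lambda>k. {..x k})"
      by (auto simp: PiE_iff extensional_def)
    then show "{f\<in>(Pi\<^sub>E I (\<lambda>_. UNIV)). \<forall>i\<in>I. f i \<in> A i} \<in> range (\<lambda>x. Pi\<^sub>E I (\<lambda>k. {..x k}))" by auto
  next
    fix x :: "'i \<Rightarrow> real"
    show "\<exists>A j. Pi\<^sub>E I (\<lambda>k. {..x k}) = {f\<in>(Pi\<^sub>E I (\<lambda>_. UNIV)). \<forall>i\<in>j. f i \<in> A i} \<and> j \<in> {I} \<and> A \<in> Pi j ?E"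
      by (intro exI[of _ "\<lambda>k. {..x k}"] exI[of _ I]) (auto simp: PiE_iff extensional_def)
  qed
  also have "sets (sigma (Pi\<^sub>E I (\<lambda>_. UNIV)) (range (\<lambda>x. Pi\<^sub>E I (\<lambda>k. {..x k :: real}))))
      = sigma_sets (Pi\<^sub>E I (\<lambda>_. UNIV)) (range (\<lambda>x. Pi\<^sub>E I (\<lambda>k. {..x k :: real})))"
    by (rule sets_measure_of) auto
  finally show ?thesis .
qed

text \<open>On \<open>[0, \<infinity>)\<^sup>I\<close> it suffices to compare boxes with positive corners: corners with a negative coordinate give null
  sets, and zero coordinates are reached by continuity from above.\<close>

lemma finite_measure_eqI_positive_boxes:
  fixes I :: "'i set"
  assumes I: "finite I"
    and sets: "sets M = sets (Pi\<^sub>M I (\<lambda>_. borel :: real measure))"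
      "sets N = sets (Pi\<^sub>M I (\<lambda>_. borel :: real measure))"
    and fin: "finite_measure M" "finite_measure N"
    and nn: "AE y in M. \<forall>k\<in>I. 0 \<le> y k" "AE y in N. \<forall>k\<in>I. 0 \<le> y k"
    and eq: "\<And>x. (\<And>k. k \<in> I \<Longrightarrow> 0 < x k)
      \<Longrightarrow> emeasure M (Pi\<^sub>E I (\<lambda>k. {..x k})) = emeasure N (Pi\<^sub>E I (\<lambda>k. {..x k}))"
  shows "M = N"
proof (rule measure_eqI_generator_eq)
  let ?B = "\<lambda>x. Pi\<^sub>E I (\<lambda>k. {..x k :: real})"
  interpret M: finite_measure M by fact
  interpret N: finite_measure N by fact
  have B [simp]: "?B x \<in> sets M" "?B x \<in> sets N" for x
    using I by (auto simp: sets intro!: sets_PiM_I_finite)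
  show "Int_stable (range ?B)"
  proof (rule Int_stableI, safe)
    fix x y
    have "?B x \<inter> ?B y = ?B (\<lambda>k. min (x k) (y k))" by (auto simp: PiE_iff)
    then show "?B x \<inter> ?B y \<in> range ?B" by auto
  qed
  show "range ?B \<subseteq> Pow (Pi\<^sub>E I (\<lambda>_. UNIV))" by (auto simp: PiE_iff)
  show "sets M = sigma_sets (Pi\<^sub>E I (\<lambda>_. UNIV)) (range ?B)"
    "sets N = sigma_sets (Pi\<^sub>E I (\<lambda>_. UNIV)) (range ?B)"
    using sets sets_PiM_boxes[OF I] by auto
  show "range (\<lambda>n::nat. ?B (\<lambda>_. real n)) \<subseteq> range ?B" by auto
  show "(\<Union>n. ?B (\<lambda>_. real n)) = Pi\<^sub>E I (\<lambda>_. UNIV)"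
  proof safe
    fix y :: "'i \<Rightarrow> real" assume y: "y \<in> Pi\<^sub>E I (\<lambda>_. UNIV)"
    obtain n where n: "(\<Sum>k\<in>I. \<bar>y k\<bar>) \<le> real n" using real_arch_simple by blast
    have "y k \<le> real n" if "k \<in> I" for k
      using member_le_sum[of k I "\<lambda>k. \<bar>y k\<bar>"] that I n by auto
    then show "y \<in> (\<Union>n. ?B (\<lambda>_. real n))" using y by (auto simp: PiE_iff)
  qed (auto simp: PiE_iff extensional_def)
  show "emeasure M (?B (\<lambda>_. real n)) \<noteq> \<infinity>" for n by simp
  fix A assume "A \<in> range ?B"
  then obtain x where A: "A = ?B x" by auto
  show "emeasure M A = emeasure N A"
  proof (cases "\<exists>k\<in>I. x k < 0")
    case True
    have "emeasure M A = 0"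
    proof -
      have "AE y in M. y \<notin> ?B x" using nn(1)
        by eventually_elim (use True in \<open>force simp: PiE_iff\<close>)
      then have "?B x \<in> null_sets M" by (simp add: AE_iff_null_sets)
      then show ?thesis unfolding A by blast
    qed
    moreover have "emeasure N A = 0"
    proof -
      have "AE y in N. y \<notin> ?B x" using nn(2)
        by eventually_elim (use True in \<open>force simp: PiE_iff\<close>)
      then have "?B x \<in> null_sets N" by (simp add: AE_iff_null_sets)
      then show ?thesis unfolding A by blast
    qed
    ultimately show ?thesis by simp
  next
    case False
    let ?x = "\<lambda>n k. x k + 1 / Suc n"
    have dec: "decseq (\<lambda>n. ?B (?x n))"
      unfolding decseq_def
    proof (intro allI impI PiE_mono)
      fix m n k assume "m \<le> (n::nat)"
      then have "1 / real (Suc n) \<le> 1 / real (Suc m)" by (intro divide_left_mono) auto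
      then show "{..?x n k} \<subseteq> {..?x m k}" by simp
    qed
    have lim: "(\<Inter>n. ?B (?x n)) = ?B x"
    proof (intro antisym subsetI)
      fix y assume y: "y \<in> (\<Inter>n. ?B (?x n))"
      then have le: "y k \<le> ?x n k" if "k \<in> I" for k n
        using that by (auto simp: PiE_iff)
      have "y k \<le> x k" if "k \<in> I" for k
      proof (rule LIMSEQ_le_const)
        show "(\<lambda>n. ?x n k) \<longlonglongrightarrow> x k"
          using tendsto_add[OF tendsto_const LIMSEQ_Suc[OF lim_1_over_n], of "x k"] by simp
        show "\<exists>N. \<forall>n\<ge>N. y k \<le> ?x n k" using le[OF that] by blast
      qed
      moreover have "y \<in> extensional I" using y by (auto simp: PiE_iff)
      ultimately show "y \<in> ?B x" by (auto simp: PiE_iff)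
    next
      fix y assume y: "y \<in> ?B x"
      have "?B x \<subseteq> ?B (?x n)" for n by (intro PiE_mono) auto
      then show "y \<in> (\<Inter>n. ?B (?x n))" using y by blast
    qed
    have "(\<lambda>n. emeasure M (?B (?x n))) \<longlonglongrightarrow> emeasure M (?B x)"
      "(\<lambda>n. emeasure N (?B (?x n))) \<longlonglongrightarrow> emeasure N (?B x)"
      using Lim_emeasure_decseq[of "\<lambda>n. ?B (?x n)" M] Lim_emeasure_decseq[of "\<lambda>n. ?B (?x n)" N] dec
      unfolding lim by (auto simp: image_subset_iff)
    moreover have "emeasure M (?B (?x n)) = emeasure N (?B (?x n))" for n
      using False by (intro eq) (auto simp: not_less intro!: add_nonneg_pos)
    ultimately show ?thesis unfolding A by (simp add: LIMSEQ_unique)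
  qed
qed

text \<open>The measure \<open>ds \<mu>(dq)\<close>, transported by \<open>(q, s) \<mapsto> q / s\<close>, is the exponent measure of the extreme value
  distribution with spectral law \<open>\<mu>\<close> (up to the factor \<open>d\<close>). It is infinite near the origin; the restriction to
  \<open>s < d max\<^sub>k q\<^sub>k\<close>, that is to points \<open>y\<close> with \<open>d max\<^sub>k y\<^sub>k > 1\<close>, makes it finite and still contains all
  points with \<open>\<Sum>\<^sub>k y\<^sub>k > 1\<close>.\<close>

definition radial_measure :: "nat \<Rightarrow> (nat \<Rightarrow> real) measure \<Rightarrow> (nat \<Rightarrow> real) measure" where
  "radial_measure d \<mu> = distr
     (density (\<mu> \<Otimes>\<^sub>M lborel) (indicator {(q, s). 0 < s \<and> s < real d * Max (q ` {1..d})}))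
     (Pi\<^sub>M {1..d} (\<lambda>_. borel)) (\<lambda>(q, s). \<lambda>k\<in>{1..d}. q k / s)"

context
  fixes d :: nat and \<mu> :: "(nat \<Rightarrow> real) measure"
  assumes d: "1 \<le> d" and prob: "prob_space \<mu>"
    and sets: "sets \<mu> = sets (Pi\<^sub>M {1..d} (\<lambda>_. borel))"
    and simplex: "AE q in \<mu>. q \<in> simplex_pts d"
begin

lemma measurable_radial [measurable]:
  "(\<lambda>(q, s). \<lambda>k\<in>{1..d}. q k / s) \<in> \<mu> \<Otimes>\<^sub>M lborel \<rightarrow>\<^sub>M Pi\<^sub>M {1..d} (\<lambda>_. borel)"
proof -
  have "(\<lambda>(q, s). \<lambda>k\<in>{1..d}. q k / s) \<in> Pi\<^sub>M {1..d} (\<lambda>_. borel) \<Otimes>\<^sub>M borel \<rightarrow>\<^sub>M Pi\<^sub>M {1..d} (\<lambda>_. borel :: real measure)"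
    unfolding case_prod_beta
    by (intro measurable_restrict borel_measurable_divide measurable_snd
        measurable_compose[OF measurable_fst measurable_component_singleton])
  also have "(Pi\<^sub>M {1..d} (\<lambda>_. borel :: real measure) \<Otimes>\<^sub>M (borel :: real measure)
        \<rightarrow>\<^sub>M Pi\<^sub>M {1..d} (\<lambda>_. borel :: real measure))
      = (\<mu> \<Otimes>\<^sub>M lborel \<rightarrow>\<^sub>M Pi\<^sub>M {1..d} (\<lambda>_. borel))"
    by (intro measurable_cong_sets sets_pair_measure_cong) (simp_all add: sets)
  finally show ?thesis .
qed

lemma sets_radial_measure: "sets (radial_measure d \<mu>) = sets (Pi\<^sub>M {1..d} (\<lambda>_. borel))"
  by (simp add: radial_measure_def)

lemma emeasure_radial_measure:
  assumes [measurable]: "A \<in> sets (Pi\<^sub>M {1..d} (\<lambda>_. borel))"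
  shows "emeasure (radial_measure d \<mu>) A
    = (\<integral>\<^sup>+ q. \<integral>\<^sup>+ s. indicator {s. 0 < s \<and> s < real d * Max (q ` {1..d}) \<and> (\<lambda>k\<in>{1..d}. q k / s) \<in> A} s
        \<partial>lborel \<partial>\<mu>)"
proof -
  interpret prob_space \<mu> by (rule prob)
  interpret pair_sigma_finite \<mu> lborel by standard
  note [measurable_cong] = sets
  have [measurable]: "(\<lambda>q. Max (q ` {1..d})) \<in> borel_measurable \<mu>"
    using measurable_Max_coordinates[of "\<lambda>_. 1" d] by (simp cong: measurable_cong_sets add: sets)
  have ind [measurable]: "(indicator {(q, s). 0 < s \<and> s < real d * Max (q ` {1..d})} :: _ \<Rightarrow> ennreal)
      \<in> borel_measurable (\<mu> \<Otimes>\<^sub>M lborel)"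
  proof -
    have "(\<lambda>p. of_bool (0 < snd p \<and> snd p < real d * Max (fst p ` {1..d})) :: ennreal)
        \<in> borel_measurable (\<mu> \<Otimes>\<^sub>M lborel)" by measurable
    also have "(\<lambda>p. of_bool (0 < snd p \<and> snd p < real d * Max (fst p ` {1..d})) :: ennreal)
        = indicator {(q, s). 0 < s \<and> s < real d * Max (q ` {1..d})}"
      by (auto simp: fun_eq_iff)
    finally show ?thesis .
  qed
  have "emeasure (radial_measure d \<mu>) A
      = (\<integral>\<^sup>+ p. indicator {(q, s). 0 < s \<and> s < real d * Max (q ` {1..d})} p
          * indicator A ((\<lambda>(q, s). \<lambda>k\<in>{1..d}. q k / s) p) \<partial>(\<mu> \<Otimes>\<^sub>M lborel))"
    unfolding radial_measure_def
    by (simp add: nn_integral_indicator[symmetric] nn_integral_distr nn_integral_density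
        sets_distr del: nn_integral_indicator)
  also have "\<dots> = (\<integral>\<^sup>+ q. \<integral>\<^sup>+ s. indicator {(q, s). 0 < s \<and> s < real d * Max (q ` {1..d})} (q, s)
          * indicator A ((\<lambda>(q, s). \<lambda>k\<in>{1..d}. q k / s) (q, s)) \<partial>lborel \<partial>\<mu>)"
    by (rule lborel.nn_integral_fst[symmetric]) measurable
  finally show ?thesis
    by (simp add: indicator_def if_distrib[where f = "(*) _"] of_bool_conj[symmetric] conj_assoc)
qed

text \<open>For fixed \<open>q\<close> in the simplex, \<open>q / s\<close> lies in the box iff \<open>s \<ge> m := max\<^sub>k q\<^sub>k / x\<^sub>k\<close>. The admissible \<open>s\<close> form an
  interval from \<open>m\<close> to \<open>c := d max\<^sub>k q\<^sub>k\<close>, of length \<open>max c m - m\<close>, and \<open>max c m\<close> is again a maximum of multiples of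
  the coordinates.\<close>

lemma emeasure_radial_box:
  assumes x: "\<And>k. k \<in> {1..d} \<Longrightarrow> 0 < x k"
  shows "emeasure (radial_measure d \<mu>) (Pi\<^sub>E {1..d} (\<lambda>k. {..x k}))
    = ennreal ((\<integral>q. Max ((\<lambda>k. max (real d) (1 / x k) * q k) ` {1..d}) \<partial>\<mu>)
        - (\<integral>q. Max ((\<lambda>k. 1 / x k * q k) ` {1..d}) \<partial>\<mu>))"
proof -
  interpret prob_space \<mu> by (rule prob)
  let ?M = "\<lambda>t q. Max ((\<lambda>k. t k * q k) ` {1..d})"
  let ?u = "\<lambda>k. max (real d) (1 / x k)" and ?v = "\<lambda>k. 1 / x k"
  have v: "0 \<le> ?v k" "0 \<le> ?u k" if "k \<in> {1..d}" for k
    using x[OF that] by (auto simp: less_imp_le le_max_iff_disj)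
  have int: "integrable \<mu> (?M ?u)" "integrable \<mu> (?M ?v)"
    by (rule integrable_Max_simplex[OF prob sets simplex d]; use v in blast)+
  have slice: "emeasure lborel {s. 0 < s \<and> s < real d * Max (q ` {1..d}) \<and> (\<lambda>k\<in>{1..d}. q k / s) \<in> Pi\<^sub>E {1..d} (\<lambda>k. {..x k})}
      = ennreal (?M ?u q - ?M ?v q)" and le: "?M ?v q \<le> ?M ?u q"
    if q: "q \<in> simplex_pts d" for q
  proof -
    define c where "c = real d * Max (q ` {1..d})"
    define m where "m = ?M ?v q"
    note [simp] = simplex_ptsD(1)[OF q]
    have m: "0 \<le> m" unfolding m_def by (rule Max_simplex_bounds(1)[OF q d]) (use v in blast)
    have fin: "finite {1..d}" "{1..d} \<noteq> {}" using d by auto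
    have box: "(\<lambda>k\<in>{1..d}. q k / s) \<in> Pi\<^sub>E {1..d} (\<lambda>k. {..x k}) \<longleftrightarrow> m \<le> s" if "0 < s" for s
    proof -
      have "(\<lambda>k\<in>{1..d}. q k / s) \<in> Pi\<^sub>E {1..d} (\<lambda>k. {..x k}) \<longleftrightarrow> (\<forall>k\<in>{1..d}. q k / s \<le> x k)"
        by (auto simp: PiE_iff)
      also have "\<dots> \<longleftrightarrow> (\<forall>k\<in>{1..d}. ?v k * q k \<le> s)"
      proof (intro ball_cong refl)
        fix k assume "k \<in> {1..d}"
        then show "q k / s \<le> x k \<longleftrightarrow> ?v k * q k \<le> s" using x[of k] that by (simp add: field_simps)
      qed
      also have "\<dots> \<longleftrightarrow> m \<le> s" unfolding m_def using fin by (subst Max_le_iff) auto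
      finally show ?thesis .
    qed
    \<comment> \<open>Both maxima merge into one because \<open>q\<close> has nonnegative coordinates.\<close>
    have cm: "?M ?u q = max c m"
    proof -
      have c: "c = ?M (\<lambda>_. real d) q"
      proof -
        have "c = Max ((*) (real d) ` q ` {1..d})"
          unfolding c_def using fin by (intro mono_Max_commute monoI mult_left_mono) auto
        then show ?thesis by (simp add: image_image)
      qed
      show ?thesis
      proof (rule antisym)
        show "?M ?u q \<le> max c m"
        proof (intro Max.boundedI)
          fix a assume "a \<in> (\<lambda>k. ?u k * q k) ` {1..d}"
          then obtain k where k: "k \<in> {1..d}" "a = ?u k * q k" by auto
          have "real d * q k \<le> c" "?v k * q k \<le> m" unfolding c m_def using k by (auto intro!: Max_ge)
          then show "a \<le> max c m" unfolding k(2) by (auto simp: max_def)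
        qed (use fin in auto)
        have "?M t q \<le> ?M ?u q" if t: "\<And>k. k \<in> {1..d} \<Longrightarrow> t k \<le> ?u k" for t
        proof (rule Max.boundedI)
          fix a assume "a \<in> (\<lambda>k. t k * q k) ` {1..d}"
          then obtain k where k: "k \<in> {1..d}" "a = t k * q k" by blast
          have "t k * q k \<le> ?u k * q k" using t[OF k(1)] k(1) by (intro mult_right_mono) auto
          also have "\<dots> \<le> ?M ?u q" using k(1) by (intro Max_ge) auto
          finally show "a \<le> ?M ?u q" unfolding k(2) .
        qed (use fin in auto)
        from this[of "\<lambda>_. real d"] this[of ?v] have "c \<le> ?M ?u q" "m \<le> ?M ?u q"
          unfolding c m_def by simp_all
        then show "max c m \<le> ?M ?u q" by simp
      qed
    qed
    show "?M ?v q \<le> ?M ?u q" using cm by (simp add: m_def)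
    have "emeasure lborel {s. 0 < s \<and> s < c \<and> m \<le> s} = ennreal (max c m - m)"
    proof (cases "m = 0")
      case True
      then have S: "{s. 0 < s \<and> s < c \<and> m \<le> s} = {0<..<c}" by auto
      show ?thesis unfolding S using True by (cases "0 \<le> c") (auto simp: max_def)
    next
      case False
      then have S: "{s. 0 < s \<and> s < c \<and> m \<le> s} = {m..<c}" using m by auto
      show ?thesis unfolding S by (cases "m \<le> c") (auto simp: max_def)
    qed
    moreover have "{s. 0 < s \<and> s < real d * Max (q ` {1..d}) \<and> (\<lambda>k\<in>{1..d}. q k / s) \<in> Pi\<^sub>E {1..d} (\<lambda>k. {..x k})}
        = {s. 0 < s \<and> s < c \<and> m \<le> s}" using box by (auto simp: c_def)
    ultimately show "emeasure lborel {s. 0 < s \<and> s < real d * Max (q ` {1..d}) \<and> (\<lambda>k\<in>{1..d}. q k / s) \<in> Pi\<^sub>E {1..d} (\<lambda>k. {..x k})}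
        = ennreal (?M ?u q - ?M ?v q)" by (simp add: cm m_def)
  qed
  have "emeasure (radial_measure d \<mu>) (Pi\<^sub>E {1..d} (\<lambda>k. {..x k})) = (\<integral>\<^sup>+ q. ennreal (?M ?u q - ?M ?v q) \<partial>\<mu>)"
  proof (subst emeasure_radial_measure)
    show "Pi\<^sub>E {1..d} (\<lambda>k. {..x k}) \<in> sets (Pi\<^sub>M {1..d} (\<lambda>_. borel))" by (intro sets_PiM_I_finite) auto
    show "(\<integral>\<^sup>+ q. \<integral>\<^sup>+ s. indicator {s. 0 < s \<and> s < real d * Max (q ` {1..d})
        \<and> (\<lambda>k\<in>{1..d}. q k / s) \<in> Pi\<^sub>E {1..d} (\<lambda>k. {..x k})} s \<partial>lborel \<partial>\<mu>) = (\<integral>\<^sup>+ q. ennreal (?M ?u q - ?M ?v q) \<partial>\<mu>)"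
      using simplex
    proof (intro nn_integral_cong_AE, eventually_elim)
      case (elim q)
      let ?S = "{s. 0 < s \<and> s < real d * Max (q ` {1..d}) \<and> (\<lambda>k\<in>{1..d}. q k / s) \<in> Pi\<^sub>E {1..d} (\<lambda>k. {..x k})}"
      have "?S \<in> sets lborel"
      proof -
        have "?S = {s \<in> space borel. 0 < s \<and> s < real d * Max (q ` {1..d}) \<and> (\<forall>k\<in>{1..d}. q k / s \<le> x k)}"
          by (auto simp: PiE_iff)
        also have "\<dots> \<in> sets borel" by measurable
        finally show ?thesis by simp
      qed
      then show ?case using slice[OF elim(2)] by simp
    qed
  qed
  also have "\<dots> = ennreal (\<integral>q. ?M ?u q - ?M ?v q \<partial>\<mu>)"
    using int simplex by (intro nn_integral_eq_integral) (auto elim!: eventually_mono dest: le)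
  also have "(\<integral>q. ?M ?u q - ?M ?v q \<partial>\<mu>) = (\<integral>q. ?M ?u q \<partial>\<mu>) - (\<integral>q. ?M ?v q \<partial>\<mu>)"
    using int by (rule Bochner_Integration.integral_diff)
  finally show ?thesis .
qed

text \<open>For \<open>q\<close> in the simplex and \<open>y = q / s\<close> one has \<open>\<Sum>\<^sub>k y\<^sub>k = 1 / s\<close> and \<open>y / \<Sum>\<^sub>k y\<^sub>k = q\<close>. So the set consists of all
  \<open>q / s\<close> with \<open>q \<in> A\<close> and \<open>0 < s < 1\<close>; since \<open>d max\<^sub>k q\<^sub>k \<ge> 1\<close>, the cutoff does not interfere.\<close>

lemma radial_measure_recovers:
  assumes A: "A \<in> sets (Pi\<^sub>M {1..d} (\<lambda>_. borel))"
  shows "emeasure (radial_measure d \<mu>)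
      {y\<in>space (Pi\<^sub>M {1..d} (\<lambda>_. borel)). 1 < (\<Sum>k\<in>{1..d}. y k) \<and> normalize_sum d y \<in> A} = emeasure \<mu> A"
proof -
  note [measurable] = A
  let ?C = "{y\<in>space (Pi\<^sub>M {1..d} (\<lambda>_. borel :: real measure)). 1 < (\<Sum>k\<in>{1..d}. y k) \<and> normalize_sum d y \<in> A}"
  have C: "?C \<in> sets (Pi\<^sub>M {1..d} (\<lambda>_. borel))" by measurable
  have "emeasure (radial_measure d \<mu>) ?C = (\<integral>\<^sup>+ q. indicator A q \<partial>\<mu>)"
    unfolding emeasure_radial_measure[OF C]
    using simplex
  proof (intro nn_integral_cong_AE, eventually_elim)
    case (elim q)
    have sum: "(\<Sum>k\<in>{1..d}. q k) = 1" by (rule simplex_ptsD(3)[OF elim(2)])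
    have ext: "q \<in> extensional {1..d}" using elim(2) by (auto simp: simplex_pts_def PiE_iff)
    have c: "1 \<le> real d * Max (q ` {1..d})"
    proof -
      have "(\<Sum>k\<in>{1..d}. q k) \<le> of_nat (card {1..d}) * Max (q ` {1..d})"
        by (rule sum_bounded_above) (auto intro: Max_ge)
      then show ?thesis using sum by simp
    qed
    have iff: "(\<lambda>k\<in>{1..d}. q k / s) \<in> ?C \<longleftrightarrow> s < 1 \<and> q \<in> A" if s: "0 < s" for s
    proof -
      have S: "(\<Sum>k\<in>{1..d}. (\<lambda>k\<in>{1..d}. q k / s) k) = 1 / s"
        using sum by (simp add: sum_divide_distrib[symmetric])
      have "normalize_sum d (\<lambda>k\<in>{1..d}. q k / s) = q"
        unfolding normalize_sum_def S using s ext by (auto simp: fun_eq_iff extensional_def)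
      then show ?thesis using s S by (auto simp: space_PiM)
    qed
    have "{s. 0 < s \<and> s < real d * Max (q ` {1..d}) \<and> (\<lambda>k\<in>{1..d}. q k / s) \<in> ?C}
        = {s. 0 < s \<and> s < real d * Max (q ` {1..d}) \<and> s < 1 \<and> q \<in> A}"
      using iff by blast
    also have "\<dots> = (if q \<in> A then {0<..<1} else {})" using c by auto
    finally show ?case by (simp only:) (simp add: indicator_def)
  qed
  also have "\<dots> = emeasure \<mu> A" using A by (intro nn_integral_indicator) (simp add: sets)
  finally show ?thesis .
qed

lemma finite_radial_measure: "finite_measure (radial_measure d \<mu>)"
proof
  interpret prob_space \<mu> by (rule prob)
  have "emeasure (radial_measure d \<mu>) (space (radial_measure d \<mu>))
      = (\<integral>\<^sup>+ q. \<integral>\<^sup>+ s. indicator {s. 0 < s \<and> s < real d * Max (q ` {1..d})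
          \<and> (\<lambda>k\<in>{1..d}. q k / s) \<in> space (radial_measure d \<mu>)} s \<partial>lborel \<partial>\<mu>)"
    by (rule emeasure_radial_measure) (metis sets.top sets_radial_measure)
  also have "\<dots> \<le> (\<integral>\<^sup>+ q. ennreal (real d) \<partial>\<mu>)"
    using simplex
  proof (intro nn_integral_mono_AE, eventually_elim)
    case (elim q)
    have "Max (q ` {1..d}) \<le> 1"
      using simplex_ptsD(2)[OF elim(2)] d by (intro Max.boundedI) auto
    then have "real d * Max (q ` {1..d}) \<le> real d * 1" by (intro mult_left_mono) auto
    then have "(\<integral>\<^sup>+ s. indicator {s. 0 < s \<and> s < real d * Max (q ` {1..d})
          \<and> (\<lambda>k\<in>{1..d}. q k / s) \<in> space (radial_measure d \<mu>)} s \<partial>lborel)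
        \<le> (\<integral>\<^sup>+ s. indicator {0..real d} s \<partial>lborel)"
      by (intro nn_integral_mono) (auto simp: indicator_def)
    then show ?case by simp
  qed
  also have "\<dots> < \<infinity>" by (simp add: emeasure_space_1)
  finally show "emeasure (radial_measure d \<mu>) (space (radial_measure d \<mu>)) \<noteq> \<infinity>" by simp
qed

lemma AE_radial_measure_nonneg: "AE y in radial_measure d \<mu>. \<forall>k\<in>{1..d}. 0 \<le> y k"
proof (rule AE_finite_allI)
  fix k assume k: "k \<in> {1..d}"
  let ?A = "{y\<in>space (Pi\<^sub>M {1..d} (\<lambda>_. borel :: real measure)). y k < 0}"
  have [measurable]: "(\<lambda>y. y k) \<in> borel_measurable (Pi\<^sub>M {1..d} (\<lambda>_. borel :: real measure))"
    using k by measurable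
  have A: "?A \<in> sets (Pi\<^sub>M {1..d} (\<lambda>_. borel))" by measurable
  have "emeasure (radial_measure d \<mu>) ?A = (\<integral>\<^sup>+ q. 0 \<partial>\<mu>)"
    unfolding emeasure_radial_measure[OF A]
    using simplex
  proof (intro nn_integral_cong_AE, eventually_elim)
    case (elim q)
    have "\<not> q k / s < 0" if "0 < s" for s
      using simplex_ptsD(1)[OF elim(2) k] that by (simp add: divide_less_0_iff)
    then have empty: "{s. 0 < s \<and> s < real d * Max (q ` {1..d}) \<and> (\<lambda>k\<in>{1..d}. q k / s) \<in> ?A} = {}"
      using k by auto
    show ?case unfolding empty by simp
  qed
  then have "?A \<in> null_sets (radial_measure d \<mu>)"
    using A by (intro null_setsI) (simp_all add: sets_radial_measure)
  then show "AE y in radial_measure d \<mu>. 0 \<le> y k"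
    by (rule AE_I') (auto simp: sets_eq_imp_space_eq[OF sets_radial_measure] not_le)
qed simp

end

lemma pickands_law_unique:
  assumes d: "1 \<le> d" and 1: "pickands_law d l \<mu>" and 2: "pickands_law d l \<mu>'"
  shows "\<mu> = \<mu>'"
proof -
  have P: "prob_space \<mu>" "sets \<mu> = sets (Pi\<^sub>M {1..d} (\<lambda>_. borel))" "AE q in \<mu>. q \<in> simplex_pts d"
    and P': "prob_space \<mu>'" "sets \<mu>' = sets (Pi\<^sub>M {1..d} (\<lambda>_. borel))" "AE q in \<mu>'. q \<in> simplex_pts d"
    using 1 2 by (auto simp: pickands_law_def)
  have Max: "(\<integral>q. Max ((\<lambda>k. t k * q k) ` {1..d}) \<partial>\<mu>) = (\<integral>q. Max ((\<lambda>k. t k * q k) ` {1..d}) \<partial>\<mu>')"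
    if t: "\<And>k. k \<in> {1..d} \<Longrightarrow> 0 \<le> t k" for t
  proof -
    have nn: "0 \<le> (\<integral>q. Max ((\<lambda>k. t k * q k) ` {1..d}) \<partial>M)" if "AE q in M. q \<in> simplex_pts d" for M
      using that by (intro integral_nonneg_AE) (auto elim!: eventually_mono intro!: Max_simplex_bounds(1)[OF _ d] t)
    have val: "l t = ennreal (real d * (\<integral>q. Max ((\<lambda>k. t k * q k) ` {1..d}) \<partial>M))"
      if "pickands_law d l M" for M
      using that t unfolding pickands_law_def by blast
    have "ennreal (real d * (\<integral>q. Max ((\<lambda>k. t k * q k) ` {1..d}) \<partial>\<mu>))
        = ennreal (real d * (\<integral>q. Max ((\<lambda>k. t k * q k) ` {1..d}) \<partial>\<mu>'))"
      unfolding val[OF 1, symmetric] val[OF 2, symmetric] ..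
    then show ?thesis using nn[OF P(3)] nn[OF P'(3)] d by simp
  qed
  have radial: "radial_measure d \<mu> = radial_measure d \<mu>'"
  proof (rule finite_measure_eqI_positive_boxes[where I = "{1..d}"])
    fix x :: "nat \<Rightarrow> real" assume x: "\<And>k. k \<in> {1..d} \<Longrightarrow> 0 < x k"
    have t: "0 \<le> 1 / x k" "0 \<le> max (real d) (1 / x k)" if "k \<in> {1..d}" for k
      using x[OF that] by (auto simp: less_imp_le le_max_iff_disj)
    have "emeasure (radial_measure d M) (Pi\<^sub>E {1..d} (\<lambda>k. {..x k}))
        = ennreal ((\<integral>q. Max ((\<lambda>k. max (real d) (1 / x k) * q k) ` {1..d}) \<partial>M)
          - (\<integral>q. Max ((\<lambda>k. 1 / x k * q k) ` {1..d}) \<partial>M))"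
      if "prob_space M" "sets M = sets (Pi\<^sub>M {1..d} (\<lambda>_. borel))" "AE q in M. q \<in> simplex_pts d" for M
      by (rule emeasure_radial_box[OF d that]) (rule x)
    from this[OF P] this[OF P'] Max[of "\<lambda>k. max (real d) (1 / x k)"] Max[of "\<lambda>k. 1 / x k"] t
    show "emeasure (radial_measure d \<mu>) (Pi\<^sub>E {1..d} (\<lambda>k. {..x k}))
        = emeasure (radial_measure d \<mu>') (Pi\<^sub>E {1..d} (\<lambda>k. {..x k}))" by simp
  qed (rule finite_atLeastAtMost sets_radial_measure[OF d P] sets_radial_measure[OF d P']
      finite_radial_measure[OF d P] finite_radial_measure[OF d P']
      AE_radial_measure_nonneg[OF d P] AE_radial_measure_nonneg[OF d P'])+
  show ?thesis
  proof (rule measure_eqI)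
    show "sets \<mu> = sets \<mu>'" using P P' by simp
    fix A assume "A \<in> sets \<mu>"
    then have A: "A \<in> sets (Pi\<^sub>M {1..d} (\<lambda>_. borel))" using P by simp
    show "emeasure \<mu> A = emeasure \<mu>' A"
      using radial_measure_recovers[OF d P A] radial_measure_recovers[OF d P' A] radial by simp
  qed
qed


section \<open>The sampling algorithm\<close>

context nonneg_cdf
begin

text \<open>The case of a single time \<open>t = 1\<close>; it turns the normalization of \<open>H\<close> into that of the law of \<open>Z\<close>.\<close>

lemma integral_Psi_eq_Psi_H:
  assumes "subordinator P L \<nu>"
  shows "(\<integral>\<^sup>+ z. Psi F z \<partial>\<nu>) = Psi_H P F L 1"
proof -
  have "(\<integral>\<^sup>+ \<omega>. ennreal (expneg (\<Sum>k\<in>{()}. H F L 1 \<omega>)) \<partial>P) = ennreal (expneg (exponent \<nu> {()} (\<lambda>_. 1)))"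
    by (rule laplace_H[OF assms]) auto
  then have "Psi_H P F L 1 = exponent \<nu> {()} (\<lambda>_. 1)"
    by (simp add: Psi_H_def neglog_expneg)
  also have "\<dots> = (\<integral>\<^sup>+ z. Psi F z \<partial>\<nu>)"
    unfolding exponent_def Psi_eq by (simp add: F_over_def df_pow_def)
  finally show ?thesis ..
qed

lemma ell_eq_exponent:
  assumes "subordinator P L \<nu>" and t: "\<And>k. k \<in> {1..d} \<Longrightarrow> 0 \<le> t k"
  shows "ell P F L d t = exponent \<nu> {1..d} t"
proof -
  have E: "(\<integral>\<^sup>+ \<omega>. ennreal (expneg (\<Sum>k\<in>{1..d}. H F L (t k) \<omega>)) \<partial>P)
      = ennreal (expneg (exponent \<nu> {1..d} t))"
    by (rule laplace_H[OF assms(1) finite_atLeastAtMost]) (rule t)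
  show ?thesis unfolding ell_def E by (simp only: enn2real_ennreal expneg_nonneg neglog_expneg)
qed

end

lemma pickands_law_cong:
  assumes "\<And>t. (\<And>k. k \<in> {1..d} \<Longrightarrow> 0 \<le> t k) \<Longrightarrow> l t = l' t"
  shows "pickands_law d l \<mu> \<longleftrightarrow> pickands_law d l' \<mu>"
proof -
  have "(\<forall>t. (\<forall>k\<in>{1..d}. 0 \<le> t k) \<longrightarrow> l t = r t) \<longleftrightarrow> (\<forall>t. (\<forall>k\<in>{1..d}. 0 \<le> t k) \<longrightarrow> l' t = r t)" for r
    using assms by metis
  then show ?thesis unfolding pickands_law_def by (simp only:)
qed

theorem lemma3p1:
  fixes P :: "'a measure" and F :: "real \<Rightarrow> real" and L :: "real \<Rightarrow> 'a \<Rightarrow> ennreal"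
    and \<nu> :: "ennreal measure" and d :: nat
  assumes "F \<in> dist_funs"
    and "subordinator P L \<nu>"
    and "emeasure \<nu> (space \<nu>) \<noteq> 0"
    and "admissible P F L"
    and "Psi_H P F L 1 = 1"
    and "d \<ge> 2"
  shows "pickands_law d (ell P F L d) (sample_law F \<nu> d) \<and>
    (\<forall>Q. pickands_law d (ell P F L d) Q \<longrightarrow> sample_law F \<nu> d = Q)"
proof -
  obtain \<mu> where "nonneg_cdf F \<mu>"
    using assms(1) nonneg_cdf.intro unfolding dist_funs_def by blast
  then interpret nonneg_cdf F \<mu> .
  have d: "1 \<le> d" using assms(6) by simp
  have "normalized_levy F \<mu> \<nu>"
    using subordinatorD(2)[OF assms(2)] integral_Psi_eq_Psi_H[OF assms(2)] assms(5)
    by (intro normalized_levy.intro normalized_levy_axioms.intro nonneg_cdf_axioms)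
      (simp_all add: levy_measure_def)
  then have "pickands_law d (exponent \<nu> {1..d}) (sample_law F \<nu> d)"
    by (rule normalized_levy.pickands_sample_law[OF _ d])
  moreover have "pickands_law d (ell P F L d) (sample_law F \<nu> d)
      \<longleftrightarrow> pickands_law d (exponent \<nu> {1..d}) (sample_law F \<nu> d)"
    by (rule pickands_law_cong) (rule ell_eq_exponent[OF assms(2)])
  ultimately have "pickands_law d (ell P F L d) (sample_law F \<nu> d)" by (simp only:)
  then show ?thesis using pickands_law_unique[OF d] by blast
qed

end
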